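(* Let $c\in\mathbb{R}$, let $(M^3(c),g)$ be a $3$-dimensional space form of constant sectional curvature $c$, let $(N^2,h)$ be a $2$-dimensional Riemannian manifold, and let $\pi:(M^3(c),g)\longrightarrow (N^2,h)$ be a Riemannian submersion. Then $\pi$ is biharmonic if and only if $\pi$ is harmonic.
   Context: All manifolds, maps and tensor fields are assumed smooth. $M^3(c)$ denotes a $3$-dimensional space form with constant sectional curvature $c$. For a map $\varphi:(M,g)\to(N,h)$ between Riemannian manifolds, the tension field is $\tau(\varphi)=\mathrm{Trace}_g\nabla \mathrm{d}\varphi$, a section of $\varphi^{*}TN$; $\varphi$ is harmonic if $\tau(\varphi)\equiv 0$. The map $\varphi$ is biharmonic if it is a critical point of the bienergy $E^2(\varphi,\Omega)=\frac12\int_\Omega|\tau(\varphi)|^2\,\mathrm{d}x$ for every compact subset $\Omega\subset M$; equivalently, if its bitension field vanishes identically: $$\tau^2(\varphi):=\mathrm{Trace}_g(\nabla^{\varphi}\nabla^{\varphi}-\nabla^{\varphi}_{\nabla^M})\tau(\varphi)-\mathrm{Trace}_g R^N(\mathrm{d}\varphi,\tau(\varphi))\mathrm{d}\varphi=0,$$ where $\nabla^\varphi$ is the pull-back connection on $\varphi^*TN$ and $R^N(X,Y)Z=[\nabla^N_X,\nabla^N_Y]Z-\nabla^N_{[X,Y]}Z$. *)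

theory Defs
  imports "HOL-Analysis.Analysis"
begin

section \<open>Smooth maps between open subsets of Euclidean spaces\<close>

text \<open>All partial derivatives up to order \<open>k\<close> exist and are continuous; only used on open sets \<open>S\<close>.\<close>

fun Ck_on :: "nat \<Rightarrow> 'a set \<Rightarrow> ('a::euclidean_space \<Rightarrow> 'b::real_normed_vector) \<Rightarrow> bool" where
  "Ck_on 0 S f \<longleftrightarrow> continuous_on S f"
| "Ck_on (Suc k) S f \<longleftrightarrow> (\<forall>u\<in>S. f differentiable (at u)) \<and>
     (\<forall>v. Ck_on k S (\<lambda>u. frechet_derivative f (at u) v))"

definition smooth_on :: "'a set \<Rightarrow> ('a::euclidean_space \<Rightarrow> 'b::real_normed_vector) \<Rightarrow> bool" where
  "smooth_on S f \<longleftrightarrow> (\<forall>k. Ck_on k S f)"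


section \<open>Smooth and Riemannian manifolds\<close>

text \<open>
  The underlying set of a manifold is a whole type, whose topology is that of the manifold.  A chart
  \<open>(U, x)\<close> consists of its domain \<open>U\<close> and its coordinate map \<open>x\<close>, of which only the
  restriction to \<open>U\<close> matters.  Atlases need not be maximal.
\<close>

type_synonym ('m, 'n) chart = "'m set \<times> ('m \<Rightarrow> real^'n)"

definition chart_inv :: "('m, 'n) chart \<Rightarrow> real^'n \<Rightarrow> 'm" where
  "chart_inv c = inv_into (fst c) (snd c)"

definition local_dom :: "('m, 'n) chart \<Rightarrow> ('k, 'l) chart \<Rightarrow> ('m \<Rightarrow> 'k) \<Rightarrow> (real^'n) set" where
  "local_dom c d \<phi> = snd c ` (fst c \<inter> \<phi> -` fst d)"

definition local_rep :: "('m, 'n) chart \<Rightarrow> ('k, 'l) chart \<Rightarrow> ('m \<Rightarrow> 'k) \<Rightarrow> real^'n \<Rightarrow> real^'l" where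
  "local_rep c d \<phi> = snd d \<circ> \<phi> \<circ> chart_inv c"

definition smooth_atlas :: "('m::{t2_space, second_countable_topology}, 'n::finite) chart set \<Rightarrow> bool" where
  "smooth_atlas A \<longleftrightarrow>
     (\<Union>c\<in>A. fst c) = UNIV \<and>
     (\<forall>c\<in>A. open (fst c) \<and> open (snd c ` fst c) \<and>
        homeomorphism (fst c) (snd c ` fst c) (snd c) (chart_inv c)) \<and>
     (\<forall>c\<in>A. \<forall>d\<in>A. smooth_on (local_dom c d id) (local_rep c d id))"

text \<open>
  A Riemannian metric is given by its Gram matrices in the charts: \<open>g c u\<close> is the matrix
  \<open>(g(\<partial>\<^sub>i, \<partial>\<^sub>j))\<close> of the chart \<open>c\<close> at the point with coordinates \<open>u\<close>.  The matrices of different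
  charts are related by the transformation law of a covariant 2-tensor.
\<close>

definition gram :: "(real^'n \<Rightarrow> real^'n^'n) \<Rightarrow> real^'n \<Rightarrow> real^'n \<Rightarrow> real^'n \<Rightarrow> real" where
  "gram G u a b = a \<bullet> (G u *v b)"

definition riemannian_manifold ::
  "('m::{t2_space, second_countable_topology}, 'n::finite) chart set \<Rightarrow>
   (('m, 'n) chart \<Rightarrow> real^'n \<Rightarrow> real^'n^'n) \<Rightarrow> bool" where
  "riemannian_manifold A g \<longleftrightarrow>
     smooth_atlas A \<and>
     (\<forall>c\<in>A. smooth_on (snd c ` fst c) (g c) \<and>
        (\<forall>u\<in>snd c ` fst c. transpose (g c u) = g c u \<and> (\<forall>a. a \<noteq> 0 \<longrightarrow> gram (g c) u a a > 0))) \<and>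
     (\<forall>c\<in>A. \<forall>d\<in>A. \<forall>u\<in>local_dom c d id. \<forall>a b.
        gram (g c) u a b =
        gram (g d) (local_rep c d id u)
          (frechet_derivative (local_rep c d id) (at u) a)
          (frechet_derivative (local_rep c d id) (at u) b))"


section \<open>Levi-Civita connection, curvature and geodesics in a chart\<close>

text \<open>Below, \<open>G\<close> and \<open>H\<close> are Gram matrices \<open>g c\<close>, \<open>h d\<close> of metrics in fixed charts.\<close>

definition christoffel :: "(real^'n \<Rightarrow> real^'n^'n) \<Rightarrow> real^'n \<Rightarrow> 'n::finite \<Rightarrow> 'n \<Rightarrow> 'n \<Rightarrow> real" where
  "christoffel G u k i j =
     (\<Sum>l\<in>UNIV. matrix_inv (G u) $ k $ l *
        (frechet_derivative (\<lambda>v. G v $ j $ l) (at u) (axis i 1)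
         + frechet_derivative (\<lambda>v. G v $ i $ l) (at u) (axis j 1)
         - frechet_derivative (\<lambda>v. G v $ i $ j) (at u) (axis l 1))) / 2"

definition Gam :: "(real^'n::finite \<Rightarrow> real^'n^'n) \<Rightarrow> real^'n \<Rightarrow> real^'n \<Rightarrow> real^'n \<Rightarrow> real^'n" where
  "Gam G u a b = (\<chi> k. \<Sum>i\<in>UNIV. \<Sum>j\<in>UNIV. christoffel G u k i j * a $ i * b $ j)"

definition cov_deriv ::
  "(real^'n::finite \<Rightarrow> real^'n^'n) \<Rightarrow> (real^'n \<Rightarrow> real^'n) \<Rightarrow> (real^'n \<Rightarrow> real^'n) \<Rightarrow> real^'n \<Rightarrow> real^'n" where
  "cov_deriv G X Y u = frechet_derivative Y (at u) (X u) + Gam G u (X u) (Y u)"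

text \<open>
  \<open>R(a,b)w = [\<nabla>\<^sub>a, \<nabla>\<^sub>b]w - \<nabla>\<^sub>[\<^sub>a\<^sub>,\<^sub>b\<^sub>] w\<close>, where tangent vectors are extended to vector fields with constant
  coefficients; the bracket term then vanishes.
\<close>

definition curv ::
  "(real^'n::finite \<Rightarrow> real^'n^'n) \<Rightarrow> real^'n \<Rightarrow> real^'n \<Rightarrow> real^'n \<Rightarrow> real^'n \<Rightarrow> real^'n" where
  "curv G u a b w =
     cov_deriv G (\<lambda>_. a) (cov_deriv G (\<lambda>_. b) (\<lambda>_. w)) u
     - cov_deriv G (\<lambda>_. b) (cov_deriv G (\<lambda>_. a) (\<lambda>_. w)) u"

definition sectional_curv ::
  "(real^'n::finite \<Rightarrow> real^'n^'n) \<Rightarrow> real^'n \<Rightarrow> real^'n \<Rightarrow> real^'n \<Rightarrow> real" where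
  "sectional_curv G u a b =
     gram G u (curv G u a b b) a / (gram G u a a * gram G u b b - (gram G u a b)\<^sup>2)"

definition constant_sectional_curvature ::
  "('m, 'n::finite) chart set \<Rightarrow> (('m, 'n) chart \<Rightarrow> real^'n \<Rightarrow> real^'n^'n) \<Rightarrow> real \<Rightarrow> bool" where
  "constant_sectional_curvature A g \<kappa> \<longleftrightarrow>
     (\<forall>c\<in>A. \<forall>u\<in>snd c ` fst c. \<forall>a b. a \<noteq> b \<and> independent {a, b} \<longrightarrow>
        sectional_curv (g c) u a b = \<kappa>)"

text \<open>Here \<open>w\<close> is the velocity of \<open>\<gamma>\<close> in the coordinates of the chart \<open>c\<close>.\<close>

definition geodesic ::
  "('m::topological_space, 'n::finite) chart set \<Rightarrow> (('m, 'n) chart \<Rightarrow> real^'n \<Rightarrow> real^'n^'n) \<Rightarrow>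
   (real \<Rightarrow> 'm) \<Rightarrow> bool" where
  "geodesic A g \<gamma> \<longleftrightarrow>
     continuous_on UNIV \<gamma> \<and>
     (\<forall>c\<in>A. \<exists>w. \<forall>t. \<gamma> t \<in> fst c \<longrightarrow>
        ((snd c \<circ> \<gamma>) has_vector_derivative w t) (at t) \<and>
        (w has_vector_derivative - Gam (g c) (snd c (\<gamma> t)) (w t) (w t)) (at t))"

definition geodesically_complete ::
  "('m::topological_space, 'n::finite) chart set \<Rightarrow> (('m, 'n) chart \<Rightarrow> real^'n \<Rightarrow> real^'n^'n) \<Rightarrow> bool" where
  "geodesically_complete A g \<longleftrightarrow>
     (\<forall>c\<in>A. \<forall>p\<in>fst c. \<forall>v. \<exists>\<gamma>. geodesic A g \<gamma> \<and> \<gamma> 0 = p \<and>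
        ((snd c \<circ> \<gamma>) has_vector_derivative v) (at 0))"

text \<open>Space forms are complete; they are not required to be simply connected.\<close>

definition space_form ::
  "('m::{t2_space, second_countable_topology}, 'n::finite) chart set \<Rightarrow>
   (('m, 'n) chart \<Rightarrow> real^'n \<Rightarrow> real^'n^'n) \<Rightarrow> real \<Rightarrow> bool" where
  "space_form A g \<kappa> \<longleftrightarrow>
     riemannian_manifold A g \<and> geodesically_complete A g \<and> constant_sectional_curvature A g \<kappa>"


section \<open>Riemannian submersions\<close>

definition smooth_map ::
  "('m::topological_space, 'n::finite) chart set \<Rightarrow> ('k::topological_space, 'l::finite) chart set \<Rightarrow>
   ('m \<Rightarrow> 'k) \<Rightarrow> bool" where
  "smooth_map A B \<phi> \<longleftrightarrow>
     continuous_on UNIV \<phi> \<and>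
     (\<forall>c\<in>A. \<forall>d\<in>B. smooth_on (local_dom c d \<phi>) (local_rep c d \<phi>))"

text \<open>The vectors \<open>a\<close> and \<open>b\<close> below are horizontal, i.e. orthogonal to the kernel of the differential.\<close>

definition riemannian_submersion ::
  "('m::topological_space, 'n::finite) chart set \<Rightarrow> (('m, 'n) chart \<Rightarrow> real^'n \<Rightarrow> real^'n^'n) \<Rightarrow>
   ('k::topological_space, 'l::finite) chart set \<Rightarrow> (('k, 'l) chart \<Rightarrow> real^'l \<Rightarrow> real^'l^'l) \<Rightarrow>
   ('m \<Rightarrow> 'k) \<Rightarrow> bool" where
  "riemannian_submersion A g B h \<phi> \<longleftrightarrow>
     smooth_map A B \<phi> \<and>
     (\<forall>c\<in>A. \<forall>d\<in>B. \<forall>u\<in>local_dom c d \<phi>.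
        let F = local_rep c d \<phi>; D = frechet_derivative F (at u) in
          surj D \<and>
          (\<forall>a b. (\<forall>v. D v = 0 \<longrightarrow> gram (g c) u a v = 0 \<and> gram (g c) u b v = 0) \<longrightarrow>
             gram (h d) (F u) (D a) (D b) = gram (g c) u a b))"


section \<open>Tension and bitension fields\<close>

text \<open>
  \<open>F\<close> is the coordinate expression of a map, and a section of its pull-back tangent bundle is
  given by its components \<open>V\<close> with respect to the coordinate frame along \<open>F\<close>.
\<close>

definition pullback_deriv ::
  "(real^'l::finite \<Rightarrow> real^'l^'l) \<Rightarrow> (real^'n::finite \<Rightarrow> real^'l) \<Rightarrow> (real^'n \<Rightarrow> real^'n) \<Rightarrow>
   (real^'n \<Rightarrow> real^'l) \<Rightarrow> real^'n \<Rightarrow> real^'l" where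
  "pullback_deriv H F X V u =
     frechet_derivative V (at u) (X u) + Gam H (F u) (frechet_derivative F (at u) (X u)) (V u)"

definition metric_trace ::
  "(real^'n::finite \<Rightarrow> real^'n^'n) \<Rightarrow> real^'n \<Rightarrow> (real^'n \<Rightarrow> real^'n \<Rightarrow> 'b::real_vector) \<Rightarrow> 'b" where
  "metric_trace G u T =
     (\<Sum>i\<in>UNIV. \<Sum>j\<in>UNIV. (matrix_inv (G u) $ i $ j) *\<^sub>R T (axis i 1) (axis j 1))"

text \<open>\<open>(\<nabla>d\<phi>)(a,b) = \<nabla>\<^sup>\<phi>\<^sub>a (d\<phi>(b)) - d\<phi>(\<nabla>\<^sub>a b)\<close>, with \<open>a\<close>, \<open>b\<close> extended by constant coefficients.\<close>

definition second_fund_form ::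
  "(real^'n::finite \<Rightarrow> real^'n^'n) \<Rightarrow> (real^'l::finite \<Rightarrow> real^'l^'l) \<Rightarrow> (real^'n \<Rightarrow> real^'l) \<Rightarrow>
   real^'n \<Rightarrow> real^'n \<Rightarrow> real^'n \<Rightarrow> real^'l" where
  "second_fund_form G H F u a b =
     pullback_deriv H F (\<lambda>_. a) (\<lambda>v. frechet_derivative F (at v) b) u
     - frechet_derivative F (at u) (cov_deriv G (\<lambda>_. a) (\<lambda>_. b) u)"

definition tension ::
  "(real^'n::finite \<Rightarrow> real^'n^'n) \<Rightarrow> (real^'l::finite \<Rightarrow> real^'l^'l) \<Rightarrow> (real^'n \<Rightarrow> real^'l) \<Rightarrow>
   real^'n \<Rightarrow> real^'l" where
  "tension G H F u = metric_trace G u (second_fund_form G H F u)"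

definition bitension ::
  "(real^'n::finite \<Rightarrow> real^'n^'n) \<Rightarrow> (real^'l::finite \<Rightarrow> real^'l^'l) \<Rightarrow> (real^'n \<Rightarrow> real^'l) \<Rightarrow>
   real^'n \<Rightarrow> real^'l" where
  "bitension G H F u =
     metric_trace G u (\<lambda>a b.
       pullback_deriv H F (\<lambda>_. a) (pullback_deriv H F (\<lambda>_. b) (tension G H F)) u
       - pullback_deriv H F (cov_deriv G (\<lambda>_. a) (\<lambda>_. b)) (tension G H F) u)
     - metric_trace G u (\<lambda>a b.
         curv H (F u) (frechet_derivative F (at u) a) (tension G H F u) (frechet_derivative F (at u) b))"

definition harmonic ::
  "('m, 'n::finite) chart set \<Rightarrow> (('m, 'n) chart \<Rightarrow> real^'n \<Rightarrow> real^'n^'n) \<Rightarrow>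
   ('k, 'l::finite) chart set \<Rightarrow> (('k, 'l) chart \<Rightarrow> real^'l \<Rightarrow> real^'l^'l) \<Rightarrow> ('m \<Rightarrow> 'k) \<Rightarrow> bool" where
  "harmonic A g B h \<phi> \<longleftrightarrow>
     (\<forall>c\<in>A. \<forall>d\<in>B. \<forall>u\<in>local_dom c d \<phi>. tension (g c) (h d) (local_rep c d \<phi>) u = 0)"

definition biharmonic ::
  "('m, 'n::finite) chart set \<Rightarrow> (('m, 'n) chart \<Rightarrow> real^'n \<Rightarrow> real^'n^'n) \<Rightarrow>
   ('k, 'l::finite) chart set \<Rightarrow> (('k, 'l) chart \<Rightarrow> real^'l \<Rightarrow> real^'l^'l) \<Rightarrow> ('m \<Rightarrow> 'k) \<Rightarrow> bool" where
  "biharmonic A g B h \<phi> \<longleftrightarrow>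
     (\<forall>c\<in>A. \<forall>d\<in>B. \<forall>u\<in>local_dom c d \<phi>. bitension (g c) (h d) (local_rep c d \<phi>) u = 0)"

end

theory Submission
  imports Defs
begin

text \<open>
  In charts, let \<open>U\<close> be the unit vertical field, let \<open>e\<^sub>1, e\<^sub>2\<close> be the horizontal lifts of an orthonormal
  frame of the surface, and write \<open>[e\<^sub>i, U] = \<kappa>\<^sub>i U\<close> and \<open>\<sigma>\<close> for the integrability coefficient of the
  horizontal distribution.  The tension field is the projection of \<open>- \<nabla>\<^sub>U U = - (\<kappa>\<^sub>1 e\<^sub>1 + \<kappa>\<^sub>2 e\<^sub>2)\<close>.  Constant
  curvature \<open>\<kappa>\<close> gives \<open>\<nabla>\<^sub>X \<nabla>\<^sub>U U = \<langle>X, \<nabla>\<^sub>U U\<rangle> \<nabla>\<^sub>U U + (\<kappa> - \<sigma>\<^sup>2) X\<close> on horizontal parts (wherever \<open>U \<sigma> = 0\<close>),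
  \<open>e\<^sub>i \<sigma> = 2 \<kappa>\<^sub>i \<sigma>\<close> and, for the curvature of the surface, \<open>K = \<kappa> + 3 \<sigma>\<^sup>2\<close>.  With these the biharmonic
  equation becomes \<open>U U \<kappa>\<^sub>i + (k + 3 (\<kappa> - \<sigma>\<^sup>2)) \<kappa>\<^sub>i = 0\<close>, where \<open>k = \<kappa>\<^sub>1\<^sup>2 + \<kappa>\<^sub>2\<^sup>2\<close>.  Differentiating it
  horizontally is contradictory wherever \<open>k \<noteq> 0\<close>: if \<open>\<sigma> \<noteq> 0\<close> because then \<open>U \<kappa>\<^sub>i = 0\<close>, and if \<open>\<sigma> = 0\<close>
  because the commutators \<open>[e\<^sub>i, U]\<close> overdetermine \<open>U \<kappa>\<^sub>i\<close>.
\<close>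

section \<open>Calculus of smooth functions\<close>

text \<open>The obstacle is the vertical direction. The curvature identities prescribe the
  derivatives of \<open>\<kappa>\<^sub>1\<close> and \<open>\<kappa>\<^sub>2\<close> along
  \<open>e\<^sub>1\<close> and \<open>e\<^sub>2\<close> but not along \<open>U\<close>, and the
  biharmonic equation controls only the second vertical derivative. The missing information comes
  from \<open>[e\<^sub>i, U] = \<kappa>\<^sub>i U\<close>: applied to a function with known
  horizontal derivatives, it yields the horizontal derivatives of its vertical derivative, and the
  list of unknowns stays finite. Where \<open>U \<sigma> = 0\<close>, one has \<open>e\<^sub>i k = 2
  \<kappa>\<^sub>i (k + \<kappa> - \<sigma>\<^sup>2)\<close>, so a polynomial relation for
  \<open>k\<close> can be differentiated into a further one. Such relations hold only where
  \<open>\<sigma> \<noteq> 0\<close> or \<open>k \<noteq> 0\<close>; these sets are open, which is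
  what allows differentiation. The definitions extend tangent vectors by constant coefficients, the
  argument needs moving frames. The passage is made once, for a connection with arbitrary smooth
  bilinear coefficients, and then used for both manifolds and for the pull-back bundle.\<close>

abbreviation fd :: "('a::real_normed_vector \<Rightarrow> 'b::real_normed_vector) \<Rightarrow> 'a \<Rightarrow> 'a \<Rightarrow> 'b" where
  "fd f u \<equiv> frechet_derivative f (at u)"

lemma fd_eqI: "(f has_derivative f') (at u) \<Longrightarrow> fd f u = f'"
  using frechet_derivative_at by metis

lemma has_derivative_fd: "f differentiable (at u) \<Longrightarrow> (f has_derivative fd f u) (at u)"
  by (simp add: frechet_derivative_works)

lemma fd_cong_open:
  assumes "open S" "u \<in> S" "\<And>v. v \<in> S \<Longrightarrow> f v = g v" "f differentiable (at u)"
  shows "fd g u = fd f u"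
  by (rule fd_eqI, rule has_derivative_transform_within_open[OF has_derivative_fd[OF assms(4)] assms(1,2)])
     (use assms in auto)

text \<open>An identity known only on an open set may be differentiated there. In applications
  \<open>g\<close> is the explicit right-hand side of such an identity, so differentiability is
  asked of \<open>g\<close> alone.\<close>

lemma fd_eq_on:
  assumes "open W" "u \<in> W" "\<And>v. v \<in> W \<Longrightarrow> f v = g v" "g differentiable (at u)"
  shows "fd f u = fd g u"
  by (rule fd_cong_open[OF assms(1,2) _ assms(4)]) (simp add: assms(3))

lemma differentiable_cong_open:
  assumes "open S" "u \<in> S" "\<And>v. v \<in> S \<Longrightarrow> f v = g v" "f differentiable (at u)"
  shows "g differentiable (at u)"
  by (rule differentiableI, rule has_derivative_transform_within_open[OF has_derivative_fd[OF assms(4)] assms(1,2)])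
     (use assms in auto)

section \<open>Functions of class C^k\<close>

text \<open>Formulas for derivatives hold only on \<open>S\<close>, while \<open>Ck_on\<close>
  refers to total functions; this lets such a formula replace the derivative in the inductions
  below.\<close>

lemma Ck_on_cong:
  assumes "open S" "\<And>u. u \<in> S \<Longrightarrow> f u = g u" "Ck_on k S f"
  shows "Ck_on k S g"
  using assms(2,3)
proof (induction k arbitrary: f g)
  case 0
  then show ?case by (simp cong: continuous_on_cong)
next
  case (Suc k)
  have d: "f differentiable (at u)" if "u \<in> S" for u
    using Suc.prems that by simp
  have e: "fd f u = fd g u" if "u \<in> S" for u
    using fd_cong_open[OF assms(1) that Suc.prems(1) d[OF that]] by simp
  have "g differentiable (at u)" if "u \<in> S" for u
    using differentiable_cong_open[OF assms(1) that Suc.prems(1) d[OF that]] by simp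
  moreover have "Ck_on k S (\<lambda>u. fd g u v)" for v
    by (rule Suc.IH[of "\<lambda>u. fd f u v"]) (use Suc.prems e in auto)
  ultimately show ?case by simp
qed

lemma Ck_on_subset: "Ck_on k S f \<Longrightarrow> T \<subseteq> S \<Longrightarrow> Ck_on k T f"
proof (induction k arbitrary: f)
  case 0
  then show ?case using continuous_on_subset by auto
next
  case (Suc k)
  then show ?case by auto
qed

lemma Ck_on_Suc_imp: "Ck_on (Suc k) S f \<Longrightarrow> Ck_on k S f"
proof (induction k arbitrary: f)
  case 0
  then show ?case
    by (auto intro!: differentiable_imp_continuous_on differentiable_at_imp_differentiable_on)
next
  case (Suc k)
  then show ?case by (metis Ck_on.simps(2))
qed

lemma Ck_on_const: "Ck_on k S (\<lambda>_. c)"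
  by (induction k arbitrary: c) auto

lemma Ck_on_bounded_linear:
  assumes S: "open S" and L: "bounded_linear L" and "Ck_on k S f"
  shows "Ck_on k S (\<lambda>u. L (f u))"
  using assms(3)
proof (induction k arbitrary: f)
  case 0
  then show ?case using bounded_linear.continuous_on[OF L] by auto
next
  case (Suc k)
  have hd: "((\<lambda>u. L (f u)) has_derivative (\<lambda>v. L (fd f u v))) (at u)" if "u \<in> S" for u
    by (rule bounded_linear.has_derivative[OF L has_derivative_fd]) (use Suc.prems that in simp)
  have "Ck_on k S (\<lambda>u. fd (\<lambda>u. L (f u)) u v)" for v
    by (rule Ck_on_cong[OF S, of "\<lambda>u. L (fd f u v)"]) (use fd_eqI[OF hd] Suc in auto)
  then show ?case by (auto intro: differentiableI[OF hd])
qed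

lemma Ck_on_add:
  assumes S: "open S" and "Ck_on k S f" "Ck_on k S g"
  shows "Ck_on k S (\<lambda>u. f u + g u)"
  using assms(2,3)
proof (induction k arbitrary: f g)
  case 0
  then show ?case by (auto intro: continuous_intros)
next
  case (Suc k)
  have hd: "((\<lambda>u. f u + g u) has_derivative (\<lambda>v. fd f u v + fd g u v)) (at u)" if "u \<in> S" for u
    using Suc.prems that by (intro has_derivative_add has_derivative_fd) auto
  have "Ck_on k S (\<lambda>u. fd (\<lambda>u. f u + g u) u v)" for v
    by (rule Ck_on_cong[OF S, of "\<lambda>u. fd f u v + fd g u v"]) (use fd_eqI[OF hd] Suc in auto)
  then show ?case by (auto intro: differentiableI[OF hd])
qed

lemma Ck_on_bounded_bilinear:
  assumes S: "open S" and p: "bounded_bilinear p" and "Ck_on k S f" "Ck_on k S g"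
  shows "Ck_on k S (\<lambda>u. p (f u) (g u))"
  using assms(3,4)
proof (induction k arbitrary: f g)
  case 0
  then show ?case using bounded_bilinear.continuous_on[OF p] by auto
next
  case (Suc k)
  have hd: "((\<lambda>u. p (f u) (g u)) has_derivative (\<lambda>v. p (f u) (fd g u v) + p (fd f u v) (g u))) (at u)"
    if "u \<in> S" for u
    using Suc.prems that by (intro bounded_bilinear.FDERIV[OF p] has_derivative_fd) auto
  have "Ck_on k S (\<lambda>u. fd (\<lambda>u. p (f u) (g u)) u v)" for v
    by (rule Ck_on_cong[OF S, of "\<lambda>u. p (f u) (fd g u v) + p (fd f u v) (g u)"])
       (use Suc.prems Ck_on_Suc_imp[OF Suc.prems(1)] Ck_on_Suc_imp[OF Suc.prems(2)] in
        \<open>auto simp: fd_eqI[OF hd] intro!: Ck_on_add[OF S] Suc.IH\<close>)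
  then show ?case by (auto intro: differentiableI[OF hd])
qed

lemma Ck_on_sum:
  assumes S: "open S" and "\<And>i. i \<in> I \<Longrightarrow> Ck_on k S (f i)"
  shows "Ck_on k S (\<lambda>u. \<Sum>i\<in>I. f i u)"
  using assms(2)
  by (induction I rule: infinite_finite_induct) (auto intro: Ck_on_const Ck_on_add[OF S])

lemma linear_sum_Basis:
  assumes "linear (f :: 'a::euclidean_space \<Rightarrow> 'b::real_vector)"
  shows "f x = (\<Sum>b\<in>Basis. (x \<bullet> b) *\<^sub>R f b)"
proof -
  have "f x = f (\<Sum>b\<in>Basis. (x \<bullet> b) *\<^sub>R b)" by (simp only: euclidean_representation)
  then show ?thesis using assms by (simp add: linear_sum linear_scale)
qed

lemma linear_fd: "f differentiable (at u) \<Longrightarrow> linear (fd f u)"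
  by (rule linear_frechet_derivative)

lemma Ck_on_compose:
  fixes f :: "'a::euclidean_space \<Rightarrow> 'b::euclidean_space" and g :: "'b \<Rightarrow> 'c::real_normed_vector"
  assumes S: "open S" and "f ` S \<subseteq> T" and "Ck_on k S f" "Ck_on k T g"
  shows "Ck_on k S (\<lambda>u. g (f u))"
  using assms(3,4)
proof (induction k arbitrary: g)
  case 0
  then show ?case using assms(2) continuous_on_compose2[of T g S f] by auto
next
  case (Suc k)
  have hd: "((\<lambda>u. g (f u)) has_derivative (\<lambda>v. fd g (f u) (fd f u v))) (at u)" if "u \<in> S" for u
    using Suc.prems that assms(2) has_derivative_compose[OF has_derivative_fd has_derivative_fd, of f u g]
    by auto
  \<comment> \<open>In the chain rule the direction \<open>fd f u v\<close> moves with
    \<open>u\<close>, whereas \<open>Ck_on\<close> only speaks of constant directions. The basis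
    expansion reduces to those, where the induction hypothesis applies.\<close>
  have *: "fd g (f u) (fd f u v) = (\<Sum>b\<in>Basis. (fd f u v \<bullet> b) *\<^sub>R fd g (f u) b)" if "u \<in> S" for u v
    using Suc.prems that assms(2) by (intro linear_sum_Basis linear_fd) auto
  have "Ck_on k S (\<lambda>u. fd (\<lambda>u. g (f u)) u v)" for v
  proof (rule Ck_on_cong[OF S, of "\<lambda>u. \<Sum>b\<in>Basis. (fd f u v \<bullet> b) *\<^sub>R fd g (f u) b"])
    show "Ck_on k S (\<lambda>u. \<Sum>b\<in>Basis. (fd f u v \<bullet> b) *\<^sub>R fd g (f u) b)"
      using Suc.prems
      by (intro Ck_on_sum[OF S] Ck_on_bounded_bilinear[OF S bounded_bilinear_scaleR] Suc.IH
           Ck_on_bounded_linear[OF S bounded_linear_inner_left] Ck_on_Suc_imp[OF Suc.prems(1)]) auto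
  qed (use fd_eqI[OF hd] * in auto)
  then show ?case by (auto intro: differentiableI[OF hd])
qed

text \<open>The derivative is a polynomial in \<open>inverse\<close> itself, so the induction
  closes.\<close>

lemma Ck_on_inverse: "Ck_on k {x::real. x \<noteq> 0} inverse"
proof (induction k)
  case 0
  then show ?case by (auto intro!: continuous_intros)
next
  case (Suc k)
  have op: "open {x::real. x \<noteq> 0}" by (simp add: open_Collect_neq)
  have hd: "(inverse has_derivative (\<lambda>v. - (inverse u * v * inverse u))) (at u)" if "u \<noteq> 0" for u :: real
    using that by (rule has_derivative_inverse')
  have "Ck_on k {x. x \<noteq> 0} (\<lambda>u. fd inverse u v)" for v :: real
  proof (rule Ck_on_cong[OF op, of "\<lambda>u. - (inverse u * v * inverse u)"])
    show "Ck_on k {x. x \<noteq> 0} (\<lambda>u. - (inverse u * v * inverse u))"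
      by (intro Ck_on_bounded_linear[OF op bounded_linear_minus[OF bounded_linear_ident]]
           Ck_on_bounded_bilinear[OF op bounded_bilinear_mult] Ck_on_const Suc.IH)
  qed (use fd_eqI[OF hd] in auto)
  then show ?case by (auto intro: differentiableI[OF hd])
qed

text \<open>The derivative is half the reciprocal of \<open>sqrt\<close>, so composition with
  \<open>inverse\<close> carries the induction.\<close>

lemma Ck_on_sqrt: "Ck_on k {x::real. x > 0} sqrt"
proof (induction k)
  case 0
  then show ?case by (auto intro!: continuous_intros)
next
  case (Suc k)
  have op: "open {x::real. x > 0}" by (simp add: open_Collect_less)
  have hd: "(sqrt has_derivative (\<lambda>v. inverse (sqrt u) * (v / 2))) (at u)" if "u > 0" for u :: real
    by (rule has_derivative_eq_rhs[OF DERIV_real_sqrt[OF that, unfolded has_field_derivative_def]])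
       (simp add: fun_eq_iff field_simps)
  have "Ck_on k {x. x > 0} (\<lambda>u. fd sqrt u v)" for v :: real
  proof (rule Ck_on_cong[OF op, of "\<lambda>u. inverse (sqrt u) * (v / 2)"])
    show "Ck_on k {x. x > 0} (\<lambda>u. inverse (sqrt u) * (v / 2))"
      by (intro Ck_on_bounded_bilinear[OF op bounded_bilinear_mult] Ck_on_const
          Ck_on_compose[OF op _ Suc.IH Ck_on_inverse]) auto
  qed (use fd_eqI[OF hd] in auto)
  then show ?case by (auto intro: differentiableI[OF hd])
qed

section \<open>Closure properties of smoothness\<close>

lemma smooth_on_imp_differentiable: "smooth_on S f \<Longrightarrow> u \<in> S \<Longrightarrow> f differentiable (at u)"
  unfolding smooth_on_def by (metis Ck_on.simps(2))

lemma smooth_on_imp_continuous_on: "smooth_on S f \<Longrightarrow> continuous_on S f"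
  unfolding smooth_on_def by (metis Ck_on.simps(1))

lemma smooth_on_has_derivative: "smooth_on S f \<Longrightarrow> u \<in> S \<Longrightarrow> (f has_derivative fd f u) (at u)"
  by (simp add: has_derivative_fd smooth_on_imp_differentiable)

lemma smooth_on_linear_fd: "smooth_on S f \<Longrightarrow> u \<in> S \<Longrightarrow> linear (fd f u)"
  by (simp add: linear_fd smooth_on_imp_differentiable)

lemma smooth_on_cong:
  "open S \<Longrightarrow> smooth_on S f \<Longrightarrow> (\<And>u. u \<in> S \<Longrightarrow> f u = g u) \<Longrightarrow> smooth_on S g"
  unfolding smooth_on_def using Ck_on_cong by blast

lemma smooth_on_subset: "smooth_on S f \<Longrightarrow> T \<subseteq> S \<Longrightarrow> smooth_on T f"
  unfolding smooth_on_def using Ck_on_subset by blast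

lemma smooth_on_fd_const: "smooth_on S f \<Longrightarrow> smooth_on S (\<lambda>u. fd f u v)"
  unfolding smooth_on_def by (metis Ck_on.simps(2))

lemma smooth_on_const: "smooth_on S (\<lambda>_. c)"
  by (simp add: smooth_on_def Ck_on_const)

lemma smooth_on_bounded_linear:
  "open S \<Longrightarrow> bounded_linear L \<Longrightarrow> smooth_on S f \<Longrightarrow> smooth_on S (\<lambda>u. L (f u))"
  by (simp add: smooth_on_def Ck_on_bounded_linear)

lemma smooth_on_minus: "open S \<Longrightarrow> smooth_on S f \<Longrightarrow> smooth_on S (\<lambda>u. - f u)"
  by (rule smooth_on_bounded_linear[OF _ bounded_linear_minus[OF bounded_linear_ident]])

lemma smooth_on_component:
  fixes f :: "'a::euclidean_space \<Rightarrow> real^'n"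
  shows "open S \<Longrightarrow> smooth_on S f \<Longrightarrow> smooth_on S (\<lambda>u. f u $ i)"
  by (rule smooth_on_bounded_linear[OF _ bounded_linear_vec_nth])

lemma smooth_on_component2:
  fixes f :: "'a::euclidean_space \<Rightarrow> real^'n^'m"
  shows "open S \<Longrightarrow> smooth_on S f \<Longrightarrow> smooth_on S (\<lambda>u. f u $ i $ j)"
  by (intro smooth_on_component smooth_on_bounded_linear[OF _ bounded_linear_vec_nth])

lemma smooth_on_add: "open S \<Longrightarrow> smooth_on S f \<Longrightarrow> smooth_on S g \<Longrightarrow> smooth_on S (\<lambda>u. f u + g u)"
  by (simp add: smooth_on_def Ck_on_add)

lemma smooth_on_diff: "open S \<Longrightarrow> smooth_on S f \<Longrightarrow> smooth_on S g \<Longrightarrow> smooth_on S (\<lambda>u. f u - g u)"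
  using smooth_on_add[of S f "\<lambda>u. - g u"] smooth_on_minus[of S g] by simp

lemma smooth_on_bounded_bilinear:
  "open S \<Longrightarrow> bounded_bilinear p \<Longrightarrow> smooth_on S f \<Longrightarrow> smooth_on S g \<Longrightarrow> smooth_on S (\<lambda>u. p (f u) (g u))"
  by (simp add: smooth_on_def Ck_on_bounded_bilinear)

lemmas smooth_on_scaleR = smooth_on_bounded_bilinear[OF _ bounded_bilinear_scaleR]
lemmas smooth_on_inner = smooth_on_bounded_bilinear[OF _ bounded_bilinear_inner]
lemmas smooth_on_mult = smooth_on_bounded_bilinear[OF _ bounded_bilinear_mult]

lemma smooth_on_sum:
  "open S \<Longrightarrow> (\<And>i. i \<in> I \<Longrightarrow> smooth_on S (f i)) \<Longrightarrow> smooth_on S (\<lambda>u. \<Sum>i\<in>I. f i u)"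
  by (simp add: smooth_on_def Ck_on_sum)

lemma smooth_on_power:
  fixes f :: "'a::euclidean_space \<Rightarrow> real"
  shows "open S \<Longrightarrow> smooth_on S f \<Longrightarrow> smooth_on S (\<lambda>u. f u ^ k)"
  by (induction k) (auto intro: smooth_on_const smooth_on_mult)

lemma smooth_on_compose:
  fixes f :: "'a::euclidean_space \<Rightarrow> 'b::euclidean_space"
  shows "open S \<Longrightarrow> smooth_on S f \<Longrightarrow> smooth_on T g \<Longrightarrow> f ` S \<subseteq> T \<Longrightarrow> smooth_on S (\<lambda>u. g (f u))"
  unfolding smooth_on_def using Ck_on_compose by blast

lemma smooth_on_inverse:
  fixes f :: "'a::euclidean_space \<Rightarrow> real"
  shows "open S \<Longrightarrow> smooth_on S f \<Longrightarrow> (\<And>u. u \<in> S \<Longrightarrow> f u \<noteq> 0) \<Longrightarrow> smooth_on S (\<lambda>u. inverse (f u))"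
  by (rule smooth_on_compose[where T = "{x. x \<noteq> 0}"]) (auto simp: smooth_on_def Ck_on_inverse)

lemma smooth_on_divide:
  fixes f g :: "'a::euclidean_space \<Rightarrow> real"
  shows "open S \<Longrightarrow> smooth_on S f \<Longrightarrow> smooth_on S g \<Longrightarrow> (\<And>u. u \<in> S \<Longrightarrow> g u \<noteq> 0) \<Longrightarrow> smooth_on S (\<lambda>u. f u / g u)"
  unfolding divide_inverse by (intro smooth_on_mult smooth_on_inverse)

lemma smooth_on_sqrt:
  fixes f :: "'a::euclidean_space \<Rightarrow> real"
  shows "open S \<Longrightarrow> smooth_on S f \<Longrightarrow> (\<And>u. u \<in> S \<Longrightarrow> f u > 0) \<Longrightarrow> smooth_on S (\<lambda>u. sqrt (f u))"
  by (rule smooth_on_compose[where T = "{x. x > 0}"]) (auto simp: smooth_on_def Ck_on_sqrt)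

lemma smooth_on_vec:
  fixes f :: "'n::finite \<Rightarrow> 'a::euclidean_space \<Rightarrow> real"
  assumes "open S" "\<And>i. smooth_on S (f i)"
  shows "smooth_on S (\<lambda>u. \<chi> i. f i u)"
proof -
  have "(\<chi> i. f i u) = (\<Sum>i\<in>UNIV. f i u *\<^sub>R axis i 1)" for u
    by (simp add: vec_eq_iff axis_def if_distrib[of "times _"] cong: if_cong)
  moreover have "smooth_on S (\<lambda>u. \<Sum>i\<in>UNIV. f i u *\<^sub>R (axis i 1 :: real^'n))"
    by (intro smooth_on_sum smooth_on_scaleR smooth_on_const assms)
  ultimately show ?thesis by simp
qed

text \<open>Smoothness is given for constant arguments only; a basis expansion transfers it to
  arguments that depend on the point. Differentials are such families, and connection coefficients
  are their bilinear analogue.\<close>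

lemma smooth_on_linear_family:
  assumes S: "open S" and L: "\<And>u. u \<in> S \<Longrightarrow> linear (L u)" and "\<And>b. smooth_on S (\<lambda>u. L u b)" "smooth_on S X"
  shows "smooth_on S (\<lambda>u. L u (X u :: 'c::euclidean_space))"
proof (rule smooth_on_cong[OF S])
  show "smooth_on S (\<lambda>u. \<Sum>b\<in>Basis. (X u \<bullet> b) *\<^sub>R L u b)"
    by (intro smooth_on_sum smooth_on_scaleR smooth_on_inner smooth_on_const assms)
qed (use linear_sum_Basis[OF L] in metis)

lemma smooth_on_bilinear_family:
  assumes S: "open S" and L: "\<And>u. u \<in> S \<Longrightarrow> bilinear (L u)" and "\<And>a b. smooth_on S (\<lambda>u. L u a b)"
    "smooth_on S X" "smooth_on S Y"
  shows "smooth_on S (\<lambda>u. L u (X u :: 'c::euclidean_space) (Y u :: 'd::euclidean_space))"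
proof (rule smooth_on_linear_family[OF S _ _ assms(5)])
  show "linear (L u (X u))" if "u \<in> S" for u using L[OF that] by (simp add: bilinear_def)
  show "smooth_on S (\<lambda>u. L u (X u) b)" for b
    by (rule smooth_on_linear_family[where L = "\<lambda>u a. L u a b", OF S _ assms(3,4)])
       (use L in \<open>auto simp: bilinear_def\<close>)
qed

lemma smooth_on_fd: "open S \<Longrightarrow> smooth_on S f \<Longrightarrow> smooth_on S X \<Longrightarrow> smooth_on S (\<lambda>u. fd f u (X u))"
  by (rule smooth_on_linear_family) (auto intro: smooth_on_linear_fd smooth_on_fd_const)

lemma open_nonzero:
  assumes "open W" "W \<subseteq> S" "smooth_on S f"
  shows "open {u \<in> W. f u \<noteq> (0::real)}"
proof -
  have "continuous_on W f"
    using smooth_on_imp_continuous_on assms continuous_on_subset by blast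
  then have "open (W \<inter> f -` (- {0}))"
    by (rule continuous_open_preimage[OF _ assms(1)]) auto
  then show ?thesis by (simp add: Int_def vimage_def)
qed

lemmas smooth_intros = smooth_on_const smooth_on_minus smooth_on_component2 smooth_on_component
  smooth_on_add smooth_on_diff
  smooth_on_scaleR smooth_on_inner smooth_on_mult smooth_on_sum smooth_on_power smooth_on_vec smooth_on_fd

text \<open>A product rule that avoids derivatives of operator-valued maps: the first term
  differentiates \<open>L\<close> with its argument frozen at \<open>X u\<close>.\<close>

lemma fd_linear_family:
  assumes S: "open S" "u \<in> S" and L: "\<And>u. u \<in> S \<Longrightarrow> linear (L u)"
    and Ld: "\<And>b. (\<lambda>u. L u b) differentiable (at u)" and X: "X differentiable (at u)"
  shows "((\<lambda>v. L v (X v :: 'c::euclidean_space)) has_derivative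
     (\<lambda>a. fd (\<lambda>v. L v (X u)) u a + L u (fd X u a))) (at u)"
proof -
  have *: "((\<lambda>v. \<Sum>b\<in>Basis. (Y v \<bullet> b) *\<^sub>R L v b) has_derivative
        (\<lambda>a. \<Sum>b\<in>Basis. (Y u \<bullet> b) *\<^sub>R fd (\<lambda>v. L v b) u a + (fd Y u a \<bullet> b) *\<^sub>R L u b)) (at u)"
    if "Y differentiable (at u)" for Y
    by (rule has_derivative_eq_rhs,
        (rule has_derivative_sum has_derivative_scaleR has_derivative_inner_left
          has_derivative_fd that Ld)+) auto
  have **: "((\<lambda>v. L v (Y v)) has_derivative
        (\<lambda>a. \<Sum>b\<in>Basis. (Y u \<bullet> b) *\<^sub>R fd (\<lambda>v. L v b) u a + (fd Y u a \<bullet> b) *\<^sub>R L u b)) (at u)"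
    if "Y differentiable (at u)" for Y
    by (rule has_derivative_transform_within_open[OF *[OF that] S])
       (use linear_sum_Basis[OF L] in metis)
  have e: "fd (\<lambda>v. L v (X u)) u a = (\<Sum>b\<in>Basis. (X u \<bullet> b) *\<^sub>R fd (\<lambda>v. L v b) u a)" for a
    by (subst fd_eqI[OF **[of "\<lambda>_. X u"]]) auto
  have "L u (fd X u a) = (\<Sum>b\<in>Basis. (fd X u a \<bullet> b) *\<^sub>R L u b)" for a
    by (rule linear_sum_Basis[OF L[OF S(2)]])
  with e have "(\<lambda>a. fd (\<lambda>v. L v (X u)) u a + L u (fd X u a)) =
     (\<lambda>a. \<Sum>b\<in>Basis. (X u \<bullet> b) *\<^sub>R fd (\<lambda>v. L v b) u a + (fd X u a \<bullet> b) *\<^sub>R L u b)"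
    by (simp add: sum.distrib)
  with **[OF X] show ?thesis by simp
qed

lemma fd_bilinear_family:
  assumes S: "open S" "u \<in> S" and L: "\<And>u. u \<in> S \<Longrightarrow> bilinear (L u)"
    and Ld: "\<And>a b. (\<lambda>u. L u a b) differentiable (at u)"
    and X: "X differentiable (at u)" and Y: "Y differentiable (at u)"
  shows "((\<lambda>v. L v (X v :: 'c::euclidean_space) (Y v :: 'd::euclidean_space)) has_derivative
     (\<lambda>a. fd (\<lambda>v. L v (X u) (Y u)) u a + L u (fd X u a) (Y u) + L u (X u) (fd Y u a))) (at u)"
proof -
  have 1: "((\<lambda>v. L v (X v) b) has_derivative
     (\<lambda>a. fd (\<lambda>v. L v (X u) b) u a + L u (fd X u a) b)) (at u)" for b
    by (rule fd_linear_family[where L = "\<lambda>u a. L u a b", OF S _ Ld X]) (use L in \<open>auto simp: bilinear_def\<close>)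
  have 2: "((\<lambda>v. L v (X v) (Y v)) has_derivative
     (\<lambda>a. fd (\<lambda>v. L v (X v) (Y u)) u a + L u (X u) (fd Y u a))) (at u)"
    by (rule fd_linear_family[OF S, where L = "\<lambda>v. L v (X v)"])
       (use L differentiableI[OF 1] Y in \<open>auto simp: bilinear_def\<close>)
  show ?thesis
    by (rule has_derivative_eq_rhs[OF 2]) (simp add: fd_eqI[OF 1])
qed

section \<open>Symmetry of second derivatives\<close>

text \<open>The mean value theorem is applied along \<open>a\<close> and then along
  \<open>b\<close>. The second difference is symmetric in \<open>a\<close> and \<open>b\<close>, the
  mixed derivative on the right is not visibly so.\<close>

lemma double_mean_value:
  fixes f :: "'a::euclidean_space \<Rightarrow> real"
  assumes h: "h > 0" and in_S: "\<And>s t. 0 \<le> s \<Longrightarrow> s \<le> h \<Longrightarrow> 0 \<le> t \<Longrightarrow> t \<le> h \<Longrightarrow> u + s *\<^sub>R a + t *\<^sub>R b \<in> S"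
    and f: "smooth_on S f"
  shows "\<exists>s t. 0 \<le> s \<and> s \<le> h \<and> 0 \<le> t \<and> t \<le> h \<and>
     f (u + h *\<^sub>R a + h *\<^sub>R b) - f (u + h *\<^sub>R a) - f (u + h *\<^sub>R b) + f u
       = h * h * fd (\<lambda>v. fd f v a) (u + s *\<^sub>R a + t *\<^sub>R b) b"
proof -
  have line: "((\<lambda>s. F (p + s *\<^sub>R d)) has_real_derivative fd F (p + s *\<^sub>R d) d) (at s)"
    if "F differentiable (at (p + s *\<^sub>R d))" for F :: "'a \<Rightarrow> real" and p d s
  proof -
    have "((\<lambda>s. F (p + s *\<^sub>R d)) has_derivative (\<lambda>r. fd F (p + s *\<^sub>R d) (r *\<^sub>R d))) (at s)"
      by (rule has_derivative_compose[of "\<lambda>s. p + s *\<^sub>R d" _ _ _ F, OF _ has_derivative_fd[OF that]])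
         (auto intro!: derivative_eq_intros)
    then show ?thesis
      unfolding has_field_derivative_def
      by (rule has_derivative_eq_rhs) (simp add: fun_eq_iff linear_scale[OF linear_fd[OF that]])
  qed
  define \<phi> where "\<phi> s = f (u + h *\<^sub>R b + s *\<^sub>R a) - f (u + s *\<^sub>R a)" for s
  have "\<exists>s>0. s < h \<and> \<phi> h - \<phi> 0 = (h - 0) * (fd f (u + h *\<^sub>R b + s *\<^sub>R a) a - fd f (u + s *\<^sub>R a) a)"
  proof (rule MVT2[OF h])
    fix s assume s: "0 \<le> s" "s \<le> h"
    have "u + h *\<^sub>R b + s *\<^sub>R a \<in> S" "u + s *\<^sub>R a \<in> S"
      using in_S[OF s, of h] in_S[OF s, of 0] h by (auto simp: algebra_simps)
    then show "DERIV \<phi> s :> fd f (u + h *\<^sub>R b + s *\<^sub>R a) a - fd f (u + s *\<^sub>R a) a"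
      unfolding \<phi>_def by (intro DERIV_diff line smooth_on_imp_differentiable[OF f])
  qed
  then obtain s where s: "0 < s" "s < h"
    and s1: "\<phi> h - \<phi> 0 = h * (fd f (u + h *\<^sub>R b + s *\<^sub>R a) a - fd f (u + s *\<^sub>R a) a)" by auto
  define \<psi> where "\<psi> t = fd f (u + s *\<^sub>R a + t *\<^sub>R b) a" for t
  have "\<exists>t>0. t < h \<and> \<psi> h - \<psi> 0 = (h - 0) * fd (\<lambda>v. fd f v a) (u + s *\<^sub>R a + t *\<^sub>R b) b"
  proof (rule MVT2[OF h])
    fix t assume "0 \<le> t" "t \<le> h"
    then have "u + s *\<^sub>R a + t *\<^sub>R b \<in> S" using in_S s by simp
    then show "DERIV \<psi> t :> fd (\<lambda>v. fd f v a) (u + s *\<^sub>R a + t *\<^sub>R b) b"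
      unfolding \<psi>_def by (intro line smooth_on_imp_differentiable[OF smooth_on_fd_const[OF f]])
  qed
  then obtain t where t: "0 < t" "t < h"
    and t1: "\<psi> h - \<psi> 0 = h * fd (\<lambda>v. fd f v a) (u + s *\<^sub>R a + t *\<^sub>R b) b" by auto
  have "f (u + h *\<^sub>R a + h *\<^sub>R b) - f (u + h *\<^sub>R a) - f (u + h *\<^sub>R b) + f u = \<phi> h - \<phi> 0"
    by (simp add: \<phi>_def algebra_simps)
  also have "\<dots> = h * (\<psi> h - \<psi> 0)" by (simp add: s1 \<psi>_def algebra_simps)
  finally have "f (u + h *\<^sub>R a + h *\<^sub>R b) - f (u + h *\<^sub>R a) - f (u + h *\<^sub>R b) + f u
       = h * h * fd (\<lambda>v. fd f v a) (u + s *\<^sub>R a + t *\<^sub>R b) b" by (simp add: t1)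
  with s t show ?thesis by (intro exI[of _ s] exI[of _ t]) auto
qed

text \<open>Reading the same second difference in both orders gives points near \<open>u\<close> at
  which the two mixed derivatives take the same value; by continuity they cannot differ at
  \<open>u\<close>.\<close>

lemma symmetric_second_derivative_real:
  fixes f :: "'a::euclidean_space \<Rightarrow> real"
  assumes S: "open S" "u \<in> S" and f: "smooth_on S f"
  shows "fd (\<lambda>v. fd f v a) u b = fd (\<lambda>v. fd f v b) u a"
proof (rule ccontr)
  let ?p = "\<lambda>v. fd (\<lambda>v. fd f v a) v b" and ?q = "\<lambda>v. fd (\<lambda>v. fd f v b) v a"
  assume "?p u \<noteq> ?q u"
  \<comment> \<open>Half of the gap: values strictly within \<open>e\<close> of \<open>?p u\<close>
    and of \<open>?q u\<close> cannot be equal.\<close>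
  define e where "e = \<bar>?p u - ?q u\<bar> / 2"
  have e: "e > 0" using \<open>?p u \<noteq> ?q u\<close> by (simp add: e_def)
  have "continuous_on S ?p" "continuous_on S ?q"
    by (intro smooth_on_imp_continuous_on smooth_on_fd_const f)+
  then have "isCont ?p u" "isCont ?q u"
    using S continuous_on_eq_continuous_at by blast+
  then obtain d1 d2 where d: "d1 > 0" "d2 > 0" "\<And>v. dist v u < d1 \<Longrightarrow> dist (?p v) (?p u) < e"
      "\<And>v. dist v u < d2 \<Longrightarrow> dist (?q v) (?q u) < e"
    using e unfolding continuous_at_eps_delta by metis
  obtain d3 where d3: "d3 > 0" "ball u d3 \<subseteq> S" using S openE by blast
  define d where "d = min d1 (min d2 d3)"
  \<comment> \<open>Chosen so that the whole parallelogram lies within distance \<open>d\<close> of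
    \<open>u\<close>; the summand 1 avoids division by zero when \<open>a\<close> and
    \<open>b\<close> both vanish.\<close>
  define h where "h = d / (norm a + norm b + 1)"
  have d0: "d > 0" using d d3 by (simp add: d_def)
  have pos: "norm a + norm b + 1 > 0" by (simp add: add_nonneg_pos)
  have h: "h > 0" using d0 pos by (simp add: h_def)
  have near: "dist (u + s *\<^sub>R a + t *\<^sub>R b) u < d" if "0 \<le> s" "s \<le> h" "0 \<le> t" "t \<le> h" for s t
  proof -
    have "dist (u + s *\<^sub>R a + t *\<^sub>R b) u = norm (s *\<^sub>R a + t *\<^sub>R b)" by (simp add: dist_norm add.assoc)
    also have "\<dots> \<le> s * norm a + t * norm b"
      using norm_triangle_ineq[of "s *\<^sub>R a" "t *\<^sub>R b"] that by simp
    also have "\<dots> \<le> h * norm a + h * norm b" using that by (intro add_mono mult_right_mono) auto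
    also have "\<dots> < h * (norm a + norm b + 1)" using h by (simp add: algebra_simps)
    also have "\<dots> = d" using pos by (simp add: h_def)
    finally show ?thesis .
  qed
  have in_S: "u + s *\<^sub>R a + t *\<^sub>R b \<in> S" if "0 \<le> s" "s \<le> h" "0 \<le> t" "t \<le> h" for s t
    using near[OF that] d3 by (auto simp: d_def dist_commute subset_eq)
  have in_S': "u + s *\<^sub>R b + t *\<^sub>R a \<in> S" if "0 \<le> s" "s \<le> h" "0 \<le> t" "t \<le> h" for s t
    using in_S[OF that(3,4,1,2)] by (simp add: algebra_simps)
  obtain s t where st: "0 \<le> s" "s \<le> h" "0 \<le> t" "t \<le> h"
     "f (u + h *\<^sub>R a + h *\<^sub>R b) - f (u + h *\<^sub>R a) - f (u + h *\<^sub>R b) + f u = h * h * ?p (u + s *\<^sub>R a + t *\<^sub>R b)"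
    using double_mean_value[OF h in_S f] by blast
  obtain s' t' where st': "0 \<le> s'" "s' \<le> h" "0 \<le> t'" "t' \<le> h"
     "f (u + h *\<^sub>R b + h *\<^sub>R a) - f (u + h *\<^sub>R b) - f (u + h *\<^sub>R a) + f u = h * h * ?q (u + s' *\<^sub>R b + t' *\<^sub>R a)"
    using double_mean_value[OF h in_S' f] by blast
  have "f (u + h *\<^sub>R b + h *\<^sub>R a) = f (u + h *\<^sub>R a + h *\<^sub>R b)" by (simp add: algebra_simps)
  then have "h * h * ?p (u + s *\<^sub>R a + t *\<^sub>R b) = h * h * ?q (u + s' *\<^sub>R b + t' *\<^sub>R a)"
    using st(5) st'(5) by linarith
  then have "?p (u + s *\<^sub>R a + t *\<^sub>R b) = ?q (u + s' *\<^sub>R b + t' *\<^sub>R a)" using h by simp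
  moreover have "dist (?p (u + s *\<^sub>R a + t *\<^sub>R b)) (?p u) < e"
    using near[OF st(1-4)] by (intro d) (simp add: d_def)
  moreover have "dist (?q (u + s' *\<^sub>R b + t' *\<^sub>R a)) (?q u) < e"
    using near[OF st'(3,4,1,2)] by (intro d) (simp add: d_def algebra_simps)
  ultimately show False unfolding e_def dist_real_def by argo
qed

lemma symmetric_second_derivative:
  fixes f :: "'a::euclidean_space \<Rightarrow> 'b::euclidean_space"
  assumes S: "open S" "u \<in> S" and f: "smooth_on S f"
  shows "fd (\<lambda>v. fd f v a) u b = fd (\<lambda>v. fd f v b) u a"
proof (rule euclidean_eqI)
  fix i :: 'b
  have comp: "fd (\<lambda>v. g v \<bullet> i) w c = fd g w c \<bullet> i" if "w \<in> S" "smooth_on S g" for g :: "'a \<Rightarrow> 'b" and w c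
    by (subst fd_eqI[OF has_derivative_inner_left[OF smooth_on_has_derivative[OF that(2,1)]]]) simp
  have *: "fd (\<lambda>v. fd f v c) u d \<bullet> i = fd (\<lambda>v. fd (\<lambda>v. f v \<bullet> i) v c) u d" for c d
  proof -
    have "fd (\<lambda>v. fd f v c) u d \<bullet> i = fd (\<lambda>v. fd f v c \<bullet> i) u d"
      using comp S smooth_on_fd_const[OF f] by simp
    also have "fd (\<lambda>v. fd f v c \<bullet> i) u = fd (\<lambda>v. fd (\<lambda>v. f v \<bullet> i) v c) u"
      by (rule fd_cong_open[OF S])
         (auto simp: comp f intro!: smooth_on_imp_differentiable[OF _ S(2)] smooth_on_fd_const
            smooth_on_inner S smooth_on_const)
    finally show ?thesis .
  qed
  show "fd (\<lambda>v. fd f v a) u b \<bullet> i = fd (\<lambda>v. fd f v b) u a \<bullet> i"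
    unfolding * by (intro symmetric_second_derivative_real[OF S] smooth_on_inner S f smooth_on_const)
qed

section \<open>Connections on trivial bundles\<close>

text \<open>One notion for all connections that occur: directions lie in the base space, values in a
  fibre that may have another dimension. Instances are the two Levi-Civita connections and the
  pull-back connection along the submersion.\<close>

definition conn :: "('a \<Rightarrow> 'a \<Rightarrow> 'b \<Rightarrow> 'b) \<Rightarrow> ('a::euclidean_space \<Rightarrow> 'a) \<Rightarrow> ('a \<Rightarrow> 'b::euclidean_space) \<Rightarrow> 'a \<Rightarrow> 'b"
  where "conn \<Gamma> X V u = fd V u (X u) + \<Gamma> u (X u) (V u)"

definition lie :: "('a::euclidean_space \<Rightarrow> 'a) \<Rightarrow> ('a \<Rightarrow> 'a) \<Rightarrow> 'a \<Rightarrow> 'a" where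
  "lie X Y u = fd Y u (X u) - fd X u (Y u)"

definition conn_curv :: "('a \<Rightarrow> 'a \<Rightarrow> 'b \<Rightarrow> 'b) \<Rightarrow> 'a::euclidean_space \<Rightarrow> 'a \<Rightarrow> 'a \<Rightarrow> 'b::euclidean_space \<Rightarrow> 'b" where
  "conn_curv \<Gamma> u a b w =
     conn \<Gamma> (\<lambda>_. a) (conn \<Gamma> (\<lambda>_. b) (\<lambda>_. w)) u - conn \<Gamma> (\<lambda>_. b) (conn \<Gamma> (\<lambda>_. a) (\<lambda>_. w)) u"

lemma fd_field:
  fixes f :: "'a::euclidean_space \<Rightarrow> 'b::euclidean_space"
  assumes "open S" "smooth_on S f" "smooth_on S X" "u \<in> S"
  shows "fd (\<lambda>v. fd f v (X v)) u a = fd (\<lambda>v. fd f v (X u)) u a + fd f u (fd X u a)"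
  by (subst fd_eqI[OF fd_linear_family[where L = "fd f", OF assms(1,4) smooth_on_linear_fd[OF assms(2)]
        smooth_on_imp_differentiable[OF smooth_on_fd_const[OF assms(2)] assms(4)]
        smooth_on_imp_differentiable[OF assms(3,4)]]]) simp_all

text \<open>The second derivatives of \<open>f\<close> cancel by symmetry. For real \<open>f\<close>
  the bracket becomes a commutator of derivations; for the submersion itself the projection of a
  bracket becomes computable.\<close>

lemma fd_lie:
  fixes f :: "'a::euclidean_space \<Rightarrow> 'b::euclidean_space"
  assumes "open S" "smooth_on S f" "smooth_on S X" "smooth_on S Y" "u \<in> S"
  shows "fd f u (lie X Y u) = fd (\<lambda>v. fd f v (Y v)) u (X u) - fd (\<lambda>v. fd f v (X v)) u (Y u)"
  using symmetric_second_derivative[OF assms(1,5,2), of "X u" "Y u"]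
  by (simp add: fd_field[OF assms(1,2,3,5)] fd_field[OF assms(1,2,4,5)] lie_def
      linear_diff[OF smooth_on_linear_fd[OF assms(2,5)]])

lemma smooth_lie: "open S \<Longrightarrow> smooth_on S X \<Longrightarrow> smooth_on S Y \<Longrightarrow> smooth_on S (lie X Y)"
  unfolding lie_def[abs_def] by (intro smooth_on_diff smooth_on_fd)

lemma cov_deriv_conn: "cov_deriv G = conn (Gam G)"
  by (intro ext) (simp add: cov_deriv_def conn_def)

lemma curv_conn: "curv G = conn_curv (Gam G)"
  by (intro ext) (simp add: curv_def conn_curv_def cov_deriv_conn)

lemma pullback_deriv_conn: "pullback_deriv H F = conn (\<lambda>u a. Gam H (F u) (fd F u a))"
  by (intro ext) (simp add: pullback_deriv_def conn_def)

lemma bilinear_simps: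
  assumes "bilinear h"
  shows "h (a + b) c' = h a c' + h b c'" "h a (c' + d') = h a c' + h a d'"
    "h (r *\<^sub>R a) c' = r *\<^sub>R h a c'" "h a (r *\<^sub>R c') = r *\<^sub>R h a c'"
    "h (- a) c' = - h a c'" "h a (- c') = - h a c'"
    "h (a - b) c' = h a c' - h b c'" "h a (c' - d') = h a c' - h a d'"
    "h 0 c' = 0" "h a 0 = 0"
  using assms by (auto simp: bilinear_ladd bilinear_radd bilinear_lmul bilinear_rmul bilinear_lneg
      bilinear_rneg bilinear_lsub bilinear_rsub bilinear_lzero bilinear_rzero)

lemma bilinearI:
  assumes "\<And>a b c. h (a + b) c = h a c + h b c" "\<And>a b c. h c (a + b) = h c a + h c b"
    "\<And>r a c. h (r *\<^sub>R a) c = r *\<^sub>R h a c" "\<And>r a c. h a (r *\<^sub>R c) = r *\<^sub>R h a c"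
  shows "bilinear h"
  using assms by (auto simp: bilinear_def intro!: linearI)

lemma fd_add: "f differentiable (at u) \<Longrightarrow> g differentiable (at u) \<Longrightarrow> fd (\<lambda>v. f v + g v) u a = fd f u a + fd g u a"
  by (subst fd_eqI[OF has_derivative_add[OF has_derivative_fd has_derivative_fd]]) auto

lemma fd_diff: "f differentiable (at u) \<Longrightarrow> g differentiable (at u) \<Longrightarrow> fd (\<lambda>v. f v - g v) u a = fd f u a - fd g u a"
  by (subst fd_eqI[OF has_derivative_diff[OF has_derivative_fd has_derivative_fd]]) auto

lemma fd_minus: "f differentiable (at u) \<Longrightarrow> fd (\<lambda>v. - f v) u a = - fd f u a"
  by (subst fd_eqI[OF has_derivative_minus[OF has_derivative_fd]]) auto

lemma fd_scaleR:
  fixes f :: "'a::real_normed_vector \<Rightarrow> real"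
  shows "f differentiable (at u) \<Longrightarrow> g differentiable (at u) \<Longrightarrow>
    fd (\<lambda>v. f v *\<^sub>R g v) u a = f u *\<^sub>R fd g u a + fd f u a *\<^sub>R g u"
  by (subst fd_eqI[OF has_derivative_scaleR[OF has_derivative_fd has_derivative_fd]]) auto

lemma fd_mult:
  fixes f g :: "'a::real_normed_vector \<Rightarrow> real"
  shows "f differentiable (at u) \<Longrightarrow> g differentiable (at u) \<Longrightarrow>
    fd (\<lambda>v. f v * g v) u a = f u * fd g u a + fd f u a * g u"
  by (subst fd_eqI[OF has_derivative_mult[OF has_derivative_fd has_derivative_fd]]) auto

lemma fd_power2:
  fixes f :: "'x::real_normed_vector \<Rightarrow> real"
  shows "f differentiable (at u) \<Longrightarrow> fd (\<lambda>v. (f v)\<^sup>2) u a = 2 * f u * fd f u a"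
  by (simp add: power2_eq_square fd_mult)

lemma fd_bounded_linear:
  "bounded_linear L \<Longrightarrow> f differentiable (at u) \<Longrightarrow> fd (\<lambda>v. L (f v)) u a = L (fd f u a)"
  by (subst fd_eqI[OF bounded_linear.has_derivative[OF _ has_derivative_fd]]) auto

lemma fd_compose:
  "f differentiable (at u) \<Longrightarrow> g differentiable (at (f u)) \<Longrightarrow> fd (\<lambda>v. g (f v)) u a = fd g (f u) (fd f u a)"
  by (subst fd_eqI[OF has_derivative_compose[OF has_derivative_fd has_derivative_fd]]) auto

locale connection =
  fixes S :: "'a::euclidean_space set" and \<Gamma> :: "'a \<Rightarrow> 'a \<Rightarrow> 'b::euclidean_space \<Rightarrow> 'b"
  assumes open_S: "open S"
    and bilinear_coeff: "u \<in> S \<Longrightarrow> bilinear (\<Gamma> u)"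
    and smooth_coeff: "smooth_on S (\<lambda>u. \<Gamma> u a b)"
begin

lemmas coeff_simps = bilinear_simps[OF bilinear_coeff]

lemma smooth_conn:
  assumes "smooth_on S X" "smooth_on S V"
  shows "smooth_on S (conn \<Gamma> X V)"
  unfolding conn_def[abs_def]
  by (rule smooth_on_add[OF open_S smooth_on_fd[OF open_S assms(2,1)]
      smooth_on_bilinear_family[where L = \<Gamma>, OF open_S bilinear_coeff smooth_coeff assms]])

lemma conn_add:
  assumes "smooth_on S V" "smooth_on S W" "u \<in> S"
  shows "conn \<Gamma> X (\<lambda>u. V u + W u) u = conn \<Gamma> X V u + conn \<Gamma> X W u"
  using assms by (simp add: conn_def fd_add coeff_simps smooth_on_imp_differentiable)

lemma conn_scaleR:
  assumes "smooth_on S f" "smooth_on S V" "u \<in> S"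
  shows "conn \<Gamma> X (\<lambda>u. f u *\<^sub>R V u) u = fd f u (X u) *\<^sub>R V u + f u *\<^sub>R conn \<Gamma> X V u"
  using assms by (simp add: conn_def fd_scaleR coeff_simps smooth_on_imp_differentiable algebra_simps)

lemma conn_cong:
  assumes "smooth_on S V" "u \<in> S" "\<And>v. v \<in> S \<Longrightarrow> V v = W v" "X u = Y u"
  shows "conn \<Gamma> X V u = conn \<Gamma> Y W u"
  using assms fd_cong_open[OF open_S, of u V W] by (simp add: conn_def smooth_on_imp_differentiable)

lemma linear_conn:
  assumes "smooth_on S V" "u \<in> S"
  shows "linear (\<lambda>a. conn \<Gamma> (\<lambda>_. a) V u)"
  using assms smooth_on_linear_fd[OF assms] bilinear_coeff[OF assms(2)] unfolding conn_def bilinear_def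
  by (intro linear_compose_add) auto

lemma conn_pointwise: "conn \<Gamma> X V u = conn \<Gamma> (\<lambda>_. X u) V u"
  by (simp add: conn_def)

lemma conn_field_comb:
  assumes "smooth_on S V" "u \<in> S" "Z u = a *\<^sub>R X u + b *\<^sub>R Y u"
  shows "conn \<Gamma> Z V u = a *\<^sub>R conn \<Gamma> X V u + b *\<^sub>R conn \<Gamma> Y V u"
  by (simp add: conn_pointwise[of Z] conn_pointwise[of X] conn_pointwise[of Y] assms(3)
      linear_add[OF linear_conn[OF assms(1,2)]] linear_scale[OF linear_conn[OF assms(1,2)]])

lemma conn_field_comb3:
  assumes "smooth_on S V" "u \<in> S" "Z u = a *\<^sub>R X u + b *\<^sub>R Y u + c *\<^sub>R W u"
  shows "conn \<Gamma> Z V u = a *\<^sub>R conn \<Gamma> X V u + b *\<^sub>R conn \<Gamma> Y V u + c *\<^sub>R conn \<Gamma> W V u"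
  by (simp add: conn_pointwise[of Z] conn_pointwise[of X] conn_pointwise[of Y] conn_pointwise[of W]
      assms(3)
      linear_add[OF linear_conn[OF assms(1,2)]] linear_scale[OF linear_conn[OF assms(1,2)]])

text \<open>Only the last term sees the derivative of \<open>Y\<close>; the others depend on
  \<open>X\<close> and \<open>Y\<close> through their values at \<open>u\<close>. This separation
  permits passing between moving fields and constant extensions.\<close>

lemma second_conn:
  assumes "smooth_on S Y" "smooth_on S V" "u \<in> S"
  shows "conn \<Gamma> X (conn \<Gamma> Y V) u =
    fd (\<lambda>v. fd V v (Y u)) u (X u) + fd (\<lambda>v. \<Gamma> v (Y u) (V u)) u (X u)
    + \<Gamma> u (Y u) (fd V u (X u)) + \<Gamma> u (X u) (fd V u (Y u)) + \<Gamma> u (X u) (\<Gamma> u (Y u) (V u))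
    + conn \<Gamma> (\<lambda>_. fd Y u (X u)) V u"
proof -
  have 1: "((\<lambda>v. fd V v (Y v)) has_derivative
      (\<lambda>a. fd (\<lambda>v. fd V v (Y u)) u a + fd V u (fd Y u a))) (at u)"
    by (rule fd_linear_family[OF open_S assms(3)])
       (use assms smooth_on_linear_fd[OF assms(2)] in
         \<open>auto intro: smooth_on_imp_differentiable[OF smooth_on_fd_const] smooth_on_imp_differentiable\<close>)
  have 2: "((\<lambda>v. \<Gamma> v (Y v) (V v)) has_derivative
      (\<lambda>a. fd (\<lambda>v. \<Gamma> v (Y u) (V u)) u a + \<Gamma> u (fd Y u a) (V u) + \<Gamma> u (Y u) (fd V u a))) (at u)"
    by (rule fd_bilinear_family[OF open_S assms(3) bilinear_coeff])
       (use assms smooth_on_imp_differentiable[OF smooth_coeff] in \<open>auto intro: smooth_on_imp_differentiable\<close>)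
  have "fd (conn \<Gamma> Y V) u (X u) = fd (\<lambda>v. fd V v (Y u)) u (X u) + fd V u (fd Y u (X u)) +
      (fd (\<lambda>v. \<Gamma> v (Y u) (V u)) u (X u) + \<Gamma> u (fd Y u (X u)) (V u) + \<Gamma> u (Y u) (fd V u (X u)))"
    unfolding conn_def[abs_def] by (subst fd_eqI[OF has_derivative_add[OF 1 2]]) simp
  then show ?thesis
    unfolding conn_def[of \<Gamma> X "conn \<Gamma> Y V"]
    by (simp add: conn_def coeff_simps assms algebra_simps)
qed

lemma second_conn_const:
  assumes "smooth_on S Y" "smooth_on S V" "u \<in> S"
  shows "conn \<Gamma> X (conn \<Gamma> Y V) u =
    conn \<Gamma> (\<lambda>_. X u) (conn \<Gamma> (\<lambda>_. Y u) V) u + conn \<Gamma> (\<lambda>_. fd Y u (X u)) V u"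
proof -
  have "conn \<Gamma> (\<lambda>_. 0) V u = 0"
    using linear_0[OF linear_conn[OF assms(2,3)]] by simp
  then show ?thesis
    by (simp add: second_conn[OF assms] second_conn[OF smooth_on_const assms(2,3)])
qed

lemma bilinear_second_conn:
  assumes "smooth_on S V" "u \<in> S"
  shows "bilinear (\<lambda>a b. conn \<Gamma> (\<lambda>_. a) (conn \<Gamma> (\<lambda>_. b) V) u)"
proof -
  have lin: "linear (\<lambda>a. conn \<Gamma> (\<lambda>_. a) (conn \<Gamma> (\<lambda>_. b) V) u)" for b
    by (rule linear_conn[OF smooth_conn[OF smooth_on_const assms(1)] assms(2)])
  have 1: "conn \<Gamma> (\<lambda>_. a) (conn \<Gamma> (\<lambda>_. b + c) V) u =
      conn \<Gamma> (\<lambda>_. a) (conn \<Gamma> (\<lambda>_. b) V) u + conn \<Gamma> (\<lambda>_. a) (conn \<Gamma> (\<lambda>_. c) V) u" for a b c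
  proof -
    have "conn \<Gamma> (\<lambda>_. a) (conn \<Gamma> (\<lambda>_. b + c) V) u =
        conn \<Gamma> (\<lambda>_. a) (\<lambda>v. conn \<Gamma> (\<lambda>_. b) V v + conn \<Gamma> (\<lambda>_. c) V v) u"
      by (rule conn_cong[OF smooth_conn[OF smooth_on_const assms(1)] assms(2)])
         (use linear_add[OF linear_conn[OF assms(1)]] in auto)
    then show ?thesis
      by (simp add: conn_add smooth_conn smooth_on_const assms)
  qed
  have 2: "conn \<Gamma> (\<lambda>_. a) (conn \<Gamma> (\<lambda>_. r *\<^sub>R b) V) u = r *\<^sub>R conn \<Gamma> (\<lambda>_. a) (conn \<Gamma> (\<lambda>_. b) V) u" for a b r
  proof -
    have "conn \<Gamma> (\<lambda>_. a) (conn \<Gamma> (\<lambda>_. r *\<^sub>R b) V) u =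
        conn \<Gamma> (\<lambda>_. a) (\<lambda>v. r *\<^sub>R conn \<Gamma> (\<lambda>_. b) V v) u"
      by (rule conn_cong[OF smooth_conn[OF smooth_on_const assms(1)] assms(2)])
         (use linear_scale[OF linear_conn[OF assms(1)]] in auto)
    then show ?thesis
      by (simp add: conn_scaleR smooth_conn smooth_on_const assms)
  qed
  show ?thesis
    by (rule bilinearI) (use 1 2 linear_add[OF lin] linear_scale[OF lin] in auto)
qed

lemma conn_curv_eq:
  assumes "u \<in> S"
  shows "conn_curv \<Gamma> u a b w =
    fd (\<lambda>v. \<Gamma> v b w) u a + \<Gamma> u a (\<Gamma> u b w) - (fd (\<lambda>v. \<Gamma> v a w) u b + \<Gamma> u b (\<Gamma> u a w))"
  using assms by (simp add: conn_curv_def second_conn smooth_on_const coeff_simps)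

text \<open>The second derivatives of \<open>V\<close> cancel by symmetry and the first-order terms
  cancel in pairs, so the commutator depends on \<open>V u\<close> only.\<close>

lemma second_conn_commute:
  assumes "smooth_on S V" "u \<in> S"
  shows "conn \<Gamma> (\<lambda>_. a) (conn \<Gamma> (\<lambda>_. b) V) u - conn \<Gamma> (\<lambda>_. b) (conn \<Gamma> (\<lambda>_. a) V) u = conn_curv \<Gamma> u a b (V u)"
  using symmetric_second_derivative[OF open_S assms(2,1), of a b]
  by (simp add: conn_curv_eq second_conn smooth_on_const assms algebra_simps)

text \<open>Links the coordinate definition of curvature to moving frames: replacing the constant
  extensions by \<open>X\<close> and \<open>Y\<close> produces derivatives of these fields, which
  add up to the bracket term.\<close>

lemma curvature_fields:
  assumes "smooth_on S X" "smooth_on S Y" "smooth_on S V" "u \<in> S"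
  shows "conn_curv \<Gamma> u (X u) (Y u) (V u) =
    conn \<Gamma> X (conn \<Gamma> Y V) u - conn \<Gamma> Y (conn \<Gamma> X V) u - conn \<Gamma> (lie X Y) V u"
proof -
  have "conn \<Gamma> (lie X Y) V u = conn \<Gamma> (\<lambda>_. fd Y u (X u)) V u - conn \<Gamma> (\<lambda>_. fd X u (Y u)) V u"
    using linear_diff[OF linear_conn[OF assms(3,4)]] conn_pointwise[of "lie X Y"] by (simp add: lie_def)
  then show ?thesis
    using second_conn_const[OF assms(1,3,4), of Y] second_conn_const[OF assms(2,3,4), of X]
      second_conn_commute[OF assms(3,4), of "X u" "Y u"]
    by (simp add: algebra_simps)
qed

lemma bilinear_conn_curv12:
  assumes "u \<in> S"
  shows "bilinear (\<lambda>a b. conn_curv \<Gamma> u a b w)"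
  by (rule bilinearI)
     (simp_all add: conn_curv_def bilinear_simps[OF bilinear_second_conn[OF smooth_on_const assms]] algebra_simps)

lemma linear_conn_curv3:
  assumes "u \<in> S"
  shows "linear (conn_curv \<Gamma> u a b)"
proof (rule linearI)
  have d: "(\<lambda>v. \<Gamma> v a b) differentiable (at u)" for a b
    using smooth_on_imp_differentiable[OF smooth_coeff assms] .
  have add: "fd (\<lambda>v. \<Gamma> v a (x + y)) u b = fd (\<lambda>v. \<Gamma> v a x) u b + fd (\<lambda>v. \<Gamma> v a y) u b" for a b x y
    unfolding fd_add[OF d d, symmetric]
    by (subst fd_cong_open[OF open_S assms, of "\<lambda>v. \<Gamma> v a (x + y)", OF _ d]) (simp_all add: coeff_simps)
  have scale: "fd (\<lambda>v. \<Gamma> v a (r *\<^sub>R x)) u b = r *\<^sub>R fd (\<lambda>v. \<Gamma> v a x) u b" for a b x r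
    unfolding fd_bounded_linear[OF bounded_linear_scaleR_right d, symmetric]
    by (subst fd_cong_open[OF open_S assms, of "\<lambda>v. \<Gamma> v a (r *\<^sub>R x)", OF _ d]) (simp_all add: coeff_simps)
  show "conn_curv \<Gamma> u a b (x + y) = conn_curv \<Gamma> u a b x + conn_curv \<Gamma> u a b y" for x y
    by (simp add: conn_curv_eq assms coeff_simps add)
  show "conn_curv \<Gamma> u a b (r *\<^sub>R x) = r *\<^sub>R conn_curv \<Gamma> u a b x" for r x
    by (simp add: conn_curv_eq assms coeff_simps scale algebra_simps)
qed

end

section \<open>The Levi-Civita connection\<close>

lemma matrix_inv_works:
  fixes A :: "real^'n^'n"
  assumes "invertible A"
  shows "A ** matrix_inv A = mat 1" "matrix_inv A ** A = mat 1"
  using assms someI_ex[of "\<lambda>A'. A ** A' = mat 1 \<and> A' ** A = mat 1"]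
  unfolding invertible_def matrix_inv_def by auto

lemma matrix_inv_unique:
  fixes A :: "real^'n^'n"
  assumes "A ** B = mat 1"
  shows "matrix_inv A = B"
proof -
  have "B ** A = mat 1" using assms matrix_left_right_inverse by blast
  then have "invertible A" using assms invertible_def by blast
  then have "matrix_inv A = matrix_inv A ** (A ** B)" by (simp add: assms)
  also have "\<dots> = B" using matrix_inv_works[OF \<open>invertible A\<close>] by (simp add: matrix_mul_assoc)
  finally show ?thesis .
qed

lemma smooth_on_prod:
  fixes f :: "'i \<Rightarrow> 'a::euclidean_space \<Rightarrow> real"
  shows "open S \<Longrightarrow> (\<And>i. i \<in> I \<Longrightarrow> smooth_on S (f i)) \<Longrightarrow> smooth_on S (\<lambda>u. \<Prod>i\<in>I. f i u)"
  by (induction I rule: infinite_finite_induct) (auto intro: smooth_on_const smooth_on_mult)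

lemma smooth_on_det:
  fixes A :: "'a::euclidean_space \<Rightarrow> real^'n^'n"
  assumes "open S" "\<And>i j. smooth_on S (\<lambda>u. A u $ i $ j)"
  shows "smooth_on S (\<lambda>u. det (A u))"
  unfolding det_def by (intro smooth_on_sum smooth_on_mult smooth_on_const smooth_on_prod assms)

text \<open>By Cramer's rule the entries are quotients of determinants, the numerator having column
  \<open>k\<close> replaced by the unit vector \<open>axis l 1\<close>.\<close>

lemma smooth_on_matrix_inv:
  fixes A :: "'a::euclidean_space \<Rightarrow> real^'n^'n"
  assumes S: "open S" and A: "smooth_on S A" and inv: "\<And>u. u \<in> S \<Longrightarrow> invertible (A u)"
  shows "smooth_on S (\<lambda>u. matrix_inv (A u) $ k $ l)"
proof (rule smooth_on_cong[OF S])
  show "smooth_on S (\<lambda>u. det (\<chi> i j. if j = k then axis l 1 $ i else A u $ i $ j) / det (A u))"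
  proof (intro smooth_on_divide smooth_on_det S)
    show "smooth_on S (\<lambda>u. (\<chi> i j. if j = k then axis l 1 $ i else A u $ i $ j) $ i $ j)" for i j
      by (cases "j = k") (simp_all add: smooth_on_const smooth_on_component2[OF S A])
  qed (use inv invertible_det_nz in \<open>auto intro: smooth_on_component2[OF S A]\<close>)
  fix u assume "u \<in> S"
  have "A u *v (matrix_inv (A u) *v axis l 1) = axis l 1"
    by (simp add: matrix_vector_mul_assoc matrix_inv_works inv \<open>u \<in> S\<close>)
  then have "matrix_inv (A u) *v axis l 1 = (\<chi> k. det (\<chi> i j. if j = k then axis l 1 $ i else A u $ i $ j) / det (A u))"
    using cramer[of "A u"] inv[OF \<open>u \<in> S\<close>] invertible_det_nz by blast
  then show "det (\<chi> i j. if j = k then axis l 1 $ i else A u $ i $ j) / det (A u) = matrix_inv (A u) $ k $ l"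
    by (simp add: matrix_vector_mul_component inner_axis vec_eq_iff)
qed

lemma sum_rotate3:
  "(\<Sum>i\<in>A. \<Sum>j\<in>B. \<Sum>k\<in>C. f i j k) = (\<Sum>k\<in>C. \<Sum>i\<in>A. \<Sum>j\<in>B. f i j k)"
proof -
  have "(\<Sum>i\<in>A. \<Sum>j\<in>B. \<Sum>k\<in>C. f i j k) = (\<Sum>i\<in>A. \<Sum>k\<in>C. \<Sum>j\<in>B. f i j k)"
    by (intro sum.cong refl sum.swap)
  also have "\<dots> = (\<Sum>k\<in>C. \<Sum>i\<in>A. \<Sum>j\<in>B. f i j k)" by (rule sum.swap)
  finally show ?thesis .
qed

lemma gram_sum: "gram G u a b = (\<Sum>i\<in>UNIV. \<Sum>j\<in>UNIV. a $ i * b $ j * G u $ i $ j)"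
  by (simp add: gram_def inner_vec_def matrix_vector_mult_def sum_distrib_left mult_ac)

lemma bilinear_gram: "bilinear (gram G u)"
  by (rule bilinearI) (simp_all add: gram_sum algebra_simps sum.distrib sum_distrib_left)

lemmas gram_simps = bilinear_simps[OF bilinear_gram]

lemma bilinear_Gam: "bilinear (Gam G u)"
  by (rule bilinearI) (simp_all add: Gam_def vec_eq_iff algebra_simps sum.distrib sum_distrib_left)

locale metric_chart =
  fixes S :: "(real^'n::finite) set" and G :: "real^'n \<Rightarrow> real^'n^'n"
  assumes open_S: "open S"
    and smooth_G: "smooth_on S G"
    and transpose_G: "u \<in> S \<Longrightarrow> transpose (G u) = G u"
    and gram_pos: "u \<in> S \<Longrightarrow> a \<noteq> 0 \<Longrightarrow> gram G u a a > 0"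
begin

lemma gram_sym: "u \<in> S \<Longrightarrow> gram G u a b = gram G u b a"
  unfolding gram_def using transpose_G dot_lmul_matrix[of a "G u" b]
  by (metis inner_commute transpose_matrix_vector)

lemma gram_eqI: "u \<in> S \<Longrightarrow> (\<And>c. gram G u a c = gram G u b c) \<Longrightarrow> a = b"
  using gram_pos[of u "a - b"] by (auto simp: gram_simps)

lemma invertible_G:
  assumes "u \<in> S"
  shows "invertible (G u)"
proof -
  have "x = 0" if "G u *v x = 0" for x
    using gram_pos[OF assms, of x] that by (auto simp: gram_def)
  then show ?thesis
    using matrix_left_invertible_ker invertible_left_inverse by blast
qed

lemma smooth_gram_const: "smooth_on S (\<lambda>u. gram G u a b)"
  unfolding gram_sum by (intro smooth_intros open_S smooth_G)

lemma smooth_gram: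
  "smooth_on S X \<Longrightarrow> smooth_on S Y \<Longrightarrow> smooth_on S (\<lambda>u. gram G u (X u) (Y u))"
  by (rule smooth_on_bilinear_family[where L = "gram G", OF open_S bilinear_gram smooth_gram_const])

lemma smooth_Gam: "smooth_on S (\<lambda>u. Gam G u a b)"
  unfolding Gam_def christoffel_def divide_inverse
  by (intro smooth_intros open_S smooth_on_matrix_inv smooth_G invertible_G)

sublocale connection S "Gam G"
  by unfold_locales (simp_all add: open_S bilinear_Gam smooth_Gam)

lemma fd_gram:
  assumes "u \<in> S"
  shows "fd (\<lambda>v. gram G v a b) u c =
    (\<Sum>i\<in>UNIV. \<Sum>j\<in>UNIV. \<Sum>k\<in>UNIV. a $ i * b $ j * c $ k * fd (\<lambda>v. G v $ i $ j) u (axis k 1))"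
proof -
  have d: "(\<lambda>v. G v $ i $ j) differentiable (at u)" for i j
    by (rule smooth_on_imp_differentiable[OF _ assms]) (intro smooth_on_component2 open_S smooth_G)
  have l: "fd (\<lambda>v. G v $ i $ j) u c = (\<Sum>k\<in>UNIV. c $ k * fd (\<lambda>v. G v $ i $ j) u (axis k 1))" for i j
  proof -
    have "fd (\<lambda>v. G v $ i $ j) u c = fd (\<lambda>v. G v $ i $ j) u (\<Sum>k\<in>UNIV. c $ k *\<^sub>R axis k 1)"
      using basis_expansion[of c] by (simp add: scalar_mult_eq_scaleR)
    then show ?thesis
      by (simp add: linear_sum[OF linear_fd[OF d]] linear_scale[OF linear_fd[OF d]])
  qed
  have "((\<lambda>v. gram G v a b) has_derivative (\<lambda>c. \<Sum>i\<in>UNIV. \<Sum>j\<in>UNIV. a $ i * b $ j * fd (\<lambda>v. G v $ i $ j) u c)) (at u)"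
    unfolding gram_sum by (intro has_derivative_sum has_derivative_mult_right has_derivative_fd d)
  from fd_eqI[OF this] have "fd (\<lambda>v. gram G v a b) u c =
      (\<Sum>i\<in>UNIV. \<Sum>j\<in>UNIV. a $ i * b $ j * fd (\<lambda>v. G v $ i $ j) u c)" by simp
  then show ?thesis
    by (simp only: l) (simp add: sum_distrib_left mult.assoc)
qed

lemma Gam_sym:
  assumes "u \<in> S"
  shows "Gam G u a b = Gam G u b a"
proof -
  have "fd (\<lambda>v. G v $ i $ j) u = fd (\<lambda>v. G v $ j $ i) u" for i j
  proof (rule fd_cong_open[OF open_S assms])
    show "G v $ j $ i = G v $ i $ j" if "v \<in> S" for v
    proof -
      have "transpose (G v) $ j $ i = G v $ i $ j" by (simp add: transpose_def)
      then show ?thesis by (simp add: transpose_G that)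
    qed
  qed (intro smooth_on_imp_differentiable[OF _ assms] smooth_on_component2 open_S smooth_G)
  then have "christoffel G u k i j = christoffel G u k j i" for k i j
    unfolding christoffel_def by (simp add: add.commute)
  then show ?thesis
    unfolding Gam_def vec_eq_iff
    by (subst sum.swap) (simp add: mult_ac)
qed

text \<open>The Koszul formula for fields with constant coefficients, whose brackets vanish.
  Contraction with \<open>G\<close> cancels the inverse matrix in the Christoffel symbols.\<close>

lemma koszul_const:
  assumes "u \<in> S"
  shows "gram G u (Gam G u a b) c =
     (fd (\<lambda>v. gram G v b c) u a + fd (\<lambda>v. gram G v a c) u b - fd (\<lambda>v. gram G v a b) u c) / 2"
proof -
  \<comment> \<open>The Christoffel symbols of the first kind, contracted with \<open>a\<close> and
    \<open>b\<close>; raising the index \<open>l\<close> gives \<open>Gam G u a b\<close>.\<close>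
  define E where "E l = (\<Sum>i\<in>UNIV. \<Sum>j\<in>UNIV. a $ i * b $ j * (fd (\<lambda>v. G v $ j $ l) u (axis i 1)
         + fd (\<lambda>v. G v $ i $ l) u (axis j 1) - fd (\<lambda>v. G v $ i $ j) u (axis l 1))) / 2" for l
  have "Gam G u a b = matrix_inv (G u) *v (\<chi> l. E l)"
    unfolding Gam_def E_def christoffel_def vec_eq_iff matrix_vector_mult_def
    by (simp add: sum_divide_distrib sum_distrib_left sum_distrib_right, subst sum_rotate3) (simp add: mult_ac)
  then have "G u *v Gam G u a b = (\<chi> l. E l)"
    by (simp add: matrix_vector_mul_assoc matrix_inv_works invertible_G assms)
  then have "gram G u (Gam G u a b) c = (\<Sum>l\<in>UNIV. c $ l * E l)"
    by (subst gram_sym[OF assms]) (simp add: gram_def inner_vec_def)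
  moreover have "fd (\<lambda>v. gram G v b c) u a =
     (\<Sum>l\<in>UNIV. \<Sum>i\<in>UNIV. \<Sum>j\<in>UNIV. c $ l * (a $ i * b $ j * fd (\<lambda>v. G v $ j $ l) u (axis i 1)))"
    unfolding fd_gram[OF assms]
    by (subst sum.swap, rule sum.cong[OF refl], subst sum.swap, intro sum.cong refl) (simp add: mult_ac)
  moreover have "fd (\<lambda>v. gram G v a c) u b =
     (\<Sum>l\<in>UNIV. \<Sum>i\<in>UNIV. \<Sum>j\<in>UNIV. c $ l * (a $ i * b $ j * fd (\<lambda>v. G v $ i $ l) u (axis j 1)))"
    unfolding fd_gram[OF assms]
    by (subst sum.swap, intro sum.cong refl) (simp add: mult_ac)
  moreover have "fd (\<lambda>v. gram G v a b) u c =
     (\<Sum>l\<in>UNIV. \<Sum>i\<in>UNIV. \<Sum>j\<in>UNIV. c $ l * (a $ i * b $ j * fd (\<lambda>v. G v $ i $ j) u (axis l 1)))"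
  proof -
    have "fd (\<lambda>v. gram G v a b) u c =
       (\<Sum>i\<in>UNIV. \<Sum>l\<in>UNIV. \<Sum>j\<in>UNIV. a $ i * b $ j * c $ l * fd (\<lambda>v. G v $ i $ j) u (axis l 1))"
      unfolding fd_gram[OF assms] by (rule sum.cong[OF refl], rule sum.swap)
    then show ?thesis by (subst (asm) sum.swap) (simp add: mult_ac)
  qed
  ultimately show ?thesis
    unfolding E_def by (simp add: sum_distrib_left sum.distrib sum_subtractf algebra_simps sum_divide_distrib[symmetric])
qed

lemma fd_gram_compat:
  assumes "u \<in> S"
  shows "fd (\<lambda>v. gram G v a b) u c = gram G u (Gam G u c a) b + gram G u a (Gam G u c b)"
proof -
  have "fd (\<lambda>v. gram G v a b) u = fd (\<lambda>v. gram G v b a) u" for a b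
    by (rule fd_cong_open[OF open_S assms gram_sym smooth_on_imp_differentiable[OF smooth_gram_const assms]])
  then show ?thesis
    by (simp add: gram_sym[OF assms, of a] koszul_const[OF assms]) argo
qed

lemma metric_compat:
  assumes "smooth_on S X" "smooth_on S Y" "u \<in> S"
  shows "fd (\<lambda>v. gram G v (X v) (Y v)) u c =
    gram G u (conn (Gam G) (\<lambda>_. c) X u) (Y u) + gram G u (X u) (conn (Gam G) (\<lambda>_. c) Y u)"
proof -
  have "fd (\<lambda>v. gram G v (X v) (Y v)) u =
    (\<lambda>a. fd (\<lambda>v. gram G v (X u) (Y u)) u a + gram G u (fd X u a) (Y u) + gram G u (X u) (fd Y u a))"
    by (rule fd_eqI, rule fd_bilinear_family[where L = "gram G", OF open_S assms(3) bilinear_gram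
       smooth_on_imp_differentiable[OF smooth_gram_const assms(3)]
       smooth_on_imp_differentiable[OF assms(1,3)] smooth_on_imp_differentiable[OF assms(2,3)]])
  then show ?thesis
    by (simp add: fd_gram_compat[OF assms(3)] conn_def gram_simps)
qed

lemma torsion_free:
  assumes "u \<in> S"
  shows "conn (Gam G) X Y u - conn (Gam G) Y X u = lie X Y u"
  by (simp add: conn_def lie_def Gam_sym[OF assms, of "X u"])

section \<open>Symmetries of the curvature tensor and constant sectional curvature\<close>

lemma curv_antisym: "conn_curv (Gam G) u a b w = - conn_curv (Gam G) u b a w"
  by (simp add: conn_curv_def)

lemma bianchi:
  assumes "u \<in> S"
  shows "conn_curv (Gam G) u a b w + conn_curv (Gam G) u b w a + conn_curv (Gam G) u w a b = 0"
proof -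
  have "fd (\<lambda>v. Gam G v a b) u = fd (\<lambda>v. Gam G v b a) u" for a b
    by (rule fd_cong_open[OF open_S assms Gam_sym smooth_on_imp_differentiable[OF smooth_Gam assms]])
  then show ?thesis
    by (simp add: conn_curv_eq[OF assms] Gam_sym[OF assms, of a w] Gam_sym[OF assms, of b w] Gam_sym[OF assms, of a b])
qed

text \<open>The second derivatives of the squared length of a constant field \<open>w\<close> are
  symmetric in the two directions. By metric compatibility their antisymmetric part is twice the
  left-hand side.\<close>

lemma gram_curv_self:
  assumes "u \<in> S"
  shows "gram G u (conn_curv (Gam G) u a b w) w = 0"
proof -
  define \<phi> where "\<phi> v = gram G v w w" for v
  have sc: "smooth_on S (conn (Gam G) (\<lambda>_. a) (\<lambda>_. w))" for a
    by (intro smooth_conn smooth_on_const)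
  have 1: "fd \<phi> v a = 2 * gram G v (conn (Gam G) (\<lambda>_. a) (\<lambda>_. w) v) w" if "v \<in> S" for v a
    unfolding \<phi>_def using metric_compat[OF smooth_on_const smooth_on_const that] gram_sym[OF that]
    by simp
  have 2: "fd (\<lambda>v. fd \<phi> v a) u b =
     2 * gram G u (conn (Gam G) (\<lambda>_. b) (conn (Gam G) (\<lambda>_. a) (\<lambda>_. w)) u) w
     + 2 * gram G u (conn (Gam G) (\<lambda>_. a) (\<lambda>_. w) u) (conn (Gam G) (\<lambda>_. b) (\<lambda>_. w) u)" for a b
  proof -
    have sm: "(\<lambda>v. gram G v (conn (Gam G) (\<lambda>_. a) (\<lambda>_. w) v) w) differentiable (at u)"
      by (rule smooth_on_imp_differentiable[OF smooth_gram[OF sc smooth_on_const] assms])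
    have "fd (\<lambda>v. fd \<phi> v a) u b = fd (\<lambda>v. 2 * gram G v (conn (Gam G) (\<lambda>_. a) (\<lambda>_. w) v) w) u b"
      by (subst fd_cong_open[OF open_S assms 1[symmetric]]) (use sm in auto)
    also have "\<dots> = 2 * fd (\<lambda>v. gram G v (conn (Gam G) (\<lambda>_. a) (\<lambda>_. w) v) w) u b"
      using fd_bounded_linear[OF bounded_linear_mult_right sm, of 2] .
    finally show ?thesis
      by (simp add: metric_compat[OF sc smooth_on_const assms])
  qed
  have "smooth_on S \<phi>" unfolding \<phi>_def by (rule smooth_gram_const)
  from symmetric_second_derivative[OF open_S assms this, of a b]
  show ?thesis
    unfolding 2 conn_curv_def using gram_sym[OF assms] by (simp add: gram_simps)
qed

lemma gram_curv_skew:
  assumes "u \<in> S"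
  shows "gram G u (conn_curv (Gam G) u a b w) z = - gram G u (conn_curv (Gam G) u a b z) w"
  using gram_curv_self[OF assms, of a b "w + z"] gram_curv_self[OF assms, of a b w] gram_curv_self[OF assms, of a b z]
  by (simp add: gram_simps linear_add[OF linear_conn_curv3[OF assms]])

text \<open>Polarisation: the difference \<open>T\<close> between the curvature and the model tensor
  has all curvature symmetries and vanishes on \<open>T a b b a\<close>; such a tensor is
  zero.\<close>

lemma const_curv_tensor:
  assumes "u \<in> S"
    and K: "\<And>a b. a \<noteq> b \<Longrightarrow> independent {a, b} \<Longrightarrow> sectional_curv G u a b = \<kappa>"
  shows "conn_curv (Gam G) u a b w = \<kappa> *\<^sub>R (gram G u b w *\<^sub>R a - gram G u a w *\<^sub>R b)"
proof -
  let ?R = "conn_curv (Gam G) u" and ?g = "gram G u"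
  note [simp] = gram_simps bilinear_simps[OF bilinear_conn_curv12[OF assms(1)]]
    linear_add[OF linear_conn_curv3[OF assms(1)]] linear_scale[OF linear_conn_curv3[OF assms(1)]]
    linear_0[OF linear_conn_curv3[OF assms(1)]]
  note sym = gram_sym[OF assms(1)]
  define T where "T a b w z = ?g (?R a b w) z - \<kappa> * (?g b w * ?g a z - ?g a w * ?g b z)" for a b w z
  have Rself: "?R b b w = 0" for b w by (simp add: conn_curv_def)
  \<comment> \<open>Sectional curvature is prescribed for independent pairs only, where
    \<open>a \<noteq> b\<close> keeps \<open>{a, b}\<close> from collapsing to a singleton. For
    dependent pairs both parts of \<open>T\<close> vanish directly.\<close>
  have diag: "T a b b a = 0" for a b
  proof (cases "a \<noteq> b \<and> independent {a, b}")
    case True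
    have "a \<noteq> 0" "b \<noteq> 0" using True dependent_zero by auto
    have gb: "?g b b > 0" using gram_pos[OF assms(1) \<open>b \<noteq> 0\<close>] .
    have "a - (?g a b / ?g b b) *\<^sub>R b \<noteq> 0"
    proof
      assume "a - (?g a b / ?g b b) *\<^sub>R b = 0"
      then have "a \<in> span {b}" by (auto simp: span_singleton)
      then have "dependent {a, b}" using True dependent_def[of "{a,b}"] by (auto simp: insert_Diff_if)
      then show False using True by simp
    qed
    from gram_pos[OF assms(1) this]
    have "?g a a * ?g b b - (?g a b)\<^sup>2 > 0"
      using gb by (simp add: sym[of b a] field_simps power2_eq_square)
    then show ?thesis
      using K[of a b] True sym[of b a]
      by (simp add: T_def sectional_curv_def curv_conn field_simps power2_eq_square)
  next
    case False
    have "b = 0 \<or> (\<exists>t. a = t *\<^sub>R b)"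
    proof (rule ccontr)
      assume *: "\<not> (b = 0 \<or> (\<exists>t. a = t *\<^sub>R b))"
      then have "a \<notin> span {b}" "a \<noteq> b" by (auto simp: span_singleton) (metis scaleR_one)
      then show False using False * independent_insert[of a "{b}"] by auto
    qed
    then show ?thesis by (auto simp: T_def Rself)
  qed
  have lin: "T (a + a') b w z = T a b w z + T a' b w z" "T a (b + b') w z = T a b w z + T a b' w z"
    "T a b (w + w') z = T a b w z + T a b w' z" "T a b w (z + z') = T a b w z + T a b w z'"
    for a a' b b' w w' z z'
    by (simp_all add: T_def algebra_simps)
  have s1: "T a b w z = - T b a w z" for a b w z
    using curv_antisym[of u a b w] by (simp add: T_def algebra_simps)
  have s2: "T a b w z = - T a b z w" for a b w z
    using gram_curv_skew[OF assms(1), of a b w z] by (simp add: T_def algebra_simps)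
  have s3: "T a b w z + T b w a z + T w a b z = 0" for a b w z
  proof -
    have "?g (?R a b w + ?R b w a + ?R w a b) z = 0" by (simp add: bianchi[OF assms(1)])
    then show ?thesis using sym[of a b] sym[of a w] sym[of b w] by (simp add: T_def algebra_simps)
  qed
  \<comment> \<open>Pair symmetry, from the classical combination of four Bianchi
    identities.\<close>
  have s4: "T a b w z = T w z a b" for a b w z
    using s3[of a b w z] s3[of b w z a] s3[of w z a b] s3[of z a b w]
      s1[of a b w z] s2[of a b w z] s1[of b w a z] s2[of b w a z] s1[of w a b z] s2[of w a b z]
      s1[of b w z a] s1[of w z b a] s2[of w z b a] s1[of z b w a] s2[of z b w a]
      s1[of w z a b] s2[of w z a b] s1[of z a w b] s2[of z a w b] s1[of a w z b] s2[of a w z b]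
      s1[of z a b w] s2[of z a b w] s1[of a b z w] s2[of a b z w] s1[of b z a w] s2[of b z a w] s2[of z b a w]
    by argo
  \<comment> \<open>Polarising in the inner arguments and then in the outer ones shows that
    \<open>T\<close> is alternating in its first and last argument.\<close>
  have p1: "T a b d a = 0" for a b d
    using diag[of a "b + d"] diag[of a b] diag[of a d] s4[of a b d a] s1[of d a a b] s2[of a d a b]
    by (simp add: lin)
  have p2: "T a b d e = - T e b d a" for a b d e
    using p1[of "a + e" b d] p1[of a b d] p1[of e b d] by (simp add: lin)
  \<comment> \<open>Now \<open>T\<close> changes sign under every transposition of its arguments, so
    the three terms of the Bianchi identity are equal.\<close>
  have "T a b w z = 0" for a b w z
    using s3[of a b w z] p2[of a b w z] s1[of z b w a] s2[of b z w a] p2[of b z a w] p2[of b w a z]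
     s1[of a b w z] s2[of a b w z] s4[of a b w z] s1[of b w a z] s2[of b w a z] s4[of b w a z]
     s1[of w a b z] s2[of w a b z] s4[of w a b z] p2[of w a b z]
     s1[of z w a b] s2[of w z a b] s1[of z a b w] s2[of z a b w] s4[of z a b w] s1[of z b w a] s2[of z b a w] s4[of z b w a]
    by argo
  then have "?g (?R a b w) z = ?g (\<kappa> *\<^sub>R (?g b w *\<^sub>R a - ?g a w *\<^sub>R b)) z" for z
    by (simp add: T_def algebra_simps)
  then show ?thesis by (rule gram_eqI[OF assms(1)])
qed

end

section \<open>Orthonormal frames and metric traces\<close>

text \<open>With the frame as columns of \<open>P\<close>, orthonormality reads
  \<open>P\<^sup>T G P = 1\<close>. For square matrices the factors may be permuted cyclically, so
  \<open>P P\<^sup>T\<close> is the inverse of \<open>G\<close>.\<close>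

lemma orthonormal_matrix:
  fixes e :: "'n::finite \<Rightarrow> real^'n"
  assumes "\<And>i j. gram G u (e i) (e j) = (if i = j then 1 else 0)"
  defines "P \<equiv> (\<chi> i j. e j $ i)"
  shows "P ** (transpose P ** G u) = mat 1" "G u ** (P ** transpose P) = mat 1"
proof -
  have "(transpose P ** (G u ** P)) $ i $ j = gram G u (e i) (e j)" for i j
    by (simp add: gram_def inner_vec_def matrix_matrix_mult_def transpose_def P_def matrix_vector_mult_def)
  then have "transpose P ** (G u ** P) = mat 1" by (simp add: assms vec_eq_iff mat_def)
  then show "P ** (transpose P ** G u) = mat 1" "G u ** (P ** transpose P) = mat 1"
    using matrix_left_right_inverse by (metis matrix_mul_assoc)+
qed

lemma orthonormal_matrix_inv:
  fixes e :: "'n::finite \<Rightarrow> real^'n"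
  assumes "\<And>i j. gram G u (e i) (e j) = (if i = j then 1 else 0)"
  shows "matrix_inv (G u) $ i $ j = (\<Sum>k\<in>UNIV. e k $ i * e k $ j)"
  using matrix_inv_unique[OF orthonormal_matrix(2)[OF assms]]
  by (simp add: matrix_matrix_mult_def transpose_def)

text \<open>The inverse Gram matrix is the sum of the products \<open>e k $ i * e k $ j\<close>,
  which turns the coordinate trace into a sum over any orthonormal frame.\<close>

lemma metric_trace_orthonormal:
  fixes e :: "'n::finite \<Rightarrow> real^'n"
  assumes "\<And>i j. gram G u (e i) (e j) = (if i = j then 1 else 0)" and T: "bilinear T"
  shows "metric_trace G u T = (\<Sum>k\<in>UNIV. T (e k) (e k))"
proof -
  have lin: "linear (T a)" "linear (\<lambda>a. T a b)" for a b using T by (auto simp: bilinear_def)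
  have "T (e k) (e k) = (\<Sum>i\<in>UNIV. \<Sum>j\<in>UNIV. (e k $ i * e k $ j) *\<^sub>R T (axis i 1) (axis j 1))" for k
  proof -
    have ex: "e k = (\<Sum>i\<in>UNIV. e k $ i *\<^sub>R axis i 1)"
      using basis_expansion[of "e k"] by (simp add: scalar_mult_eq_scaleR)
    have "T (e k) (e k) = T (\<Sum>i\<in>UNIV. e k $ i *\<^sub>R axis i 1) (\<Sum>j\<in>UNIV. e k $ j *\<^sub>R axis j 1)"
      using ex by simp
    also have "\<dots> = (\<Sum>i\<in>UNIV. \<Sum>j\<in>UNIV. (e k $ i * e k $ j) *\<^sub>R T (axis i 1) (axis j 1))"
      by (simp add: linear_sum[OF lin(1)] linear_sum[OF lin(2)] linear_scale[OF lin(1)] linear_scale[OF lin(2)]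
           scaleR_sum_right) (subst sum.swap, simp add: mult.commute)
    finally show ?thesis .
  qed
  then show ?thesis
    unfolding metric_trace_def orthonormal_matrix_inv[OF assms(1)]
    by (simp add: scaleR_sum_left, subst sum_rotate3) simp
qed

lemma orthonormal_expansion:
  fixes e :: "'n::finite \<Rightarrow> real^'n"
  assumes "\<And>i j. gram G u (e i) (e j) = (if i = j then 1 else 0)"
  shows "x = (\<Sum>k\<in>UNIV. gram G u (e k) x *\<^sub>R e k)"
proof -
  define P where "P = (\<chi> i j. e j $ i)"
  have *: "P *v (transpose P *v y) = (\<Sum>k\<in>UNIV. (e k \<bullet> y) *\<^sub>R e k)" for y
    by (simp add: vec_eq_iff matrix_vector_mult_def P_def transpose_def inner_vec_def mult.commute)
  have "x = P *v (transpose P *v (G u *v x))"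
    using orthonormal_matrix(1)[OF assms] by (simp add: matrix_vector_mul_assoc P_def)
  then show ?thesis unfolding * gram_def .
qed

section \<open>Riemannian submersions onto surfaces in a chart\<close>

locale submersion_chart = M: metric_chart S G + N: metric_chart V H
  for S :: "(real^3) set" and G :: "real^3 \<Rightarrow> real^3^3" and V :: "(real^2) set" and H :: "real^2 \<Rightarrow> real^2^2" +
  fixes F :: "real^3 \<Rightarrow> real^2" and \<kappa> :: real
  assumes smooth_F: "smooth_on S F" and F_S: "F ` S \<subseteq> V"
    and surj_F: "u \<in> S \<Longrightarrow> surj (fd F u)"
    and isometric: "u \<in> S \<Longrightarrow> (\<And>v. fd F u v = 0 \<Longrightarrow> gram G u a v = 0 \<and> gram G u b v = 0) \<Longrightarrow>
      gram H (F u) (fd F u a) (fd F u b) = gram G u a b"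
    and const_curv: "u \<in> S \<Longrightarrow> a \<noteq> b \<Longrightarrow> independent {a, b} \<Longrightarrow> sectional_curv G u a b = \<kappa>"
begin

lemma F_V: "u \<in> S \<Longrightarrow> F u \<in> V"
  using F_S by blast

lemma linear_F: "u \<in> S \<Longrightarrow> linear (fd F u)"
  by (rule smooth_on_linear_fd[OF smooth_F])

lemmas F_simps = linear_add[OF linear_F] linear_scale[OF linear_F] linear_diff[OF linear_F] linear_0[OF linear_F]
  linear_neg[OF linear_F]

lemma smooth_comp_F: "smooth_on V f \<Longrightarrow> smooth_on S (\<lambda>u. f (F u))"
  by (rule smooth_on_compose[OF M.open_S smooth_F _ F_S])

abbreviation \<Gamma>F :: "real^3 \<Rightarrow> real^3 \<Rightarrow> real^2 \<Rightarrow> real^2" where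
  "\<Gamma>F u a \<equiv> Gam H (F u) (fd F u a)"

sublocale E: connection S \<Gamma>F
proof
  show "open S" by (rule M.open_S)
  show "bilinear (\<Gamma>F u)" if "u \<in> S" for u
    using that by (intro bilinearI) (simp_all add: F_simps bilinear_simps[OF bilinear_Gam])
  show "smooth_on S (\<lambda>u. \<Gamma>F u a b)" for a b
    by (rule smooth_on_bilinear_family[where L = "\<lambda>u. Gam H (F u)", OF M.open_S bilinear_Gam
         smooth_comp_F[OF N.smooth_Gam] smooth_on_fd_const[OF smooth_F] smooth_on_const])
qed

lemma conn_pullback:
  assumes "smooth_on V W" "u \<in> S"
  shows "conn \<Gamma>F X (\<lambda>v. W (F v)) u = conn (Gam H) (\<lambda>_. fd F u (X u)) W (F u)"
  using assms F_V
  by (simp add: conn_def fd_compose smooth_on_imp_differentiable[OF smooth_F] smooth_on_imp_differentiable[OF assms(1)])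

text \<open>The derivative of \<open>X\<close> enters both terms and cancels, so the constant
  extensions of the definition may be replaced by frame fields.\<close>

lemma second_fund_form_field:
  assumes "smooth_on S X" "u \<in> S"
  shows "second_fund_form G H F u (X u) (X u) =
    conn \<Gamma>F X (\<lambda>v. fd F v (X v)) u - fd F u (conn (Gam G) X X u)"
  using assms
  by (simp add: second_fund_form_def pullback_deriv_conn cov_deriv_conn)
     (simp add: conn_def fd_field[OF M.open_S smooth_F] F_simps algebra_simps)

lemma bilinear_second_fund_form:
  assumes "u \<in> S"
  shows "bilinear (second_fund_form G H F u)"
proof -
  have 1: "linear (\<lambda>a. conn \<Gamma>F (\<lambda>_. a) (\<lambda>v. fd F v b) u)" for b
    by (rule E.linear_conn[OF smooth_on_fd_const[OF smooth_F] assms])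
  have 2: "conn \<Gamma>F (\<lambda>_. a) (\<lambda>v. fd F v (b + c)) u =
      conn \<Gamma>F (\<lambda>_. a) (\<lambda>v. fd F v b) u + conn \<Gamma>F (\<lambda>_. a) (\<lambda>v. fd F v c) u" for a b c
    unfolding E.conn_add[OF smooth_on_fd_const[OF smooth_F] smooth_on_fd_const[OF smooth_F] assms, symmetric]
    by (rule E.conn_cong[OF smooth_on_fd_const[OF smooth_F] assms]) (simp_all add: F_simps)
  have 3: "conn \<Gamma>F (\<lambda>_. a) (\<lambda>v. fd F v (r *\<^sub>R c)) u = r *\<^sub>R conn \<Gamma>F (\<lambda>_. a) (\<lambda>v. fd F v c) u" for a c r
  proof -
    have "conn \<Gamma>F (\<lambda>_. a) (\<lambda>v. fd F v (r *\<^sub>R c)) u = conn \<Gamma>F (\<lambda>_. a) (\<lambda>v. r *\<^sub>R fd F v c) u"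
      by (rule E.conn_cong[OF smooth_on_fd_const[OF smooth_F] assms]) (simp_all add: F_simps)
    then show ?thesis
      by (simp add: E.conn_scaleR smooth_on_const smooth_on_fd_const[OF smooth_F] assms)
  qed
  have 4: "second_fund_form G H F u a b = conn \<Gamma>F (\<lambda>_. a) (\<lambda>v. fd F v b) u - fd F u (Gam G u a b)" for a b
    by (simp add: second_fund_form_def pullback_deriv_conn cov_deriv_conn conn_def[of "Gam G"])
  show ?thesis
    by (rule bilinearI)
       (simp_all add: 4 linear_add[OF 1] linear_scale[OF 1] 2 3 bilinear_simps[OF bilinear_Gam] F_simps assms algebra_simps)
qed

text \<open>The invariant second covariant derivative of a section of the pull-back bundle; its
  trace is the rough Laplacian in the bitension field.\<close>

definition hess :: "(real^3 \<Rightarrow> real^2) \<Rightarrow> real^3 \<Rightarrow> real^3 \<Rightarrow> real^3 \<Rightarrow> real^2" where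
  "hess W u a b = conn \<Gamma>F (\<lambda>_. a) (conn \<Gamma>F (\<lambda>_. b) W) u - conn \<Gamma>F (conn (Gam G) (\<lambda>_. a) (\<lambda>_. b)) W u"

lemma hess_field:
  assumes "smooth_on S X" "smooth_on S W" "u \<in> S"
  shows "hess W u (X u) (X u) = conn \<Gamma>F X (conn \<Gamma>F X W) u - conn \<Gamma>F (conn (Gam G) X X) W u"
  unfolding hess_def E.second_conn_const[OF assms]
    E.conn_pointwise[of "conn (Gam G) (\<lambda>_. X u) (\<lambda>_. X u)"] E.conn_pointwise[of "conn (Gam G) X X"]
  by (simp add: conn_def[of "Gam G"] linear_add[OF E.linear_conn[OF assms(2,3)]])

lemma bilinear_hess:
  assumes "smooth_on S W" "u \<in> S"
  shows "bilinear (hess W u)"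
  unfolding hess_def[abs_def] E.conn_pointwise[of "conn (Gam G) _ _"]
  by (rule bilinearI)
     (simp_all add: bilinear_simps[OF E.bilinear_second_conn[OF assms]] conn_def[of "Gam G"] bilinear_simps[OF bilinear_Gam]
       linear_add[OF E.linear_conn[OF assms]] linear_scale[OF E.linear_conn[OF assms]] algebra_simps)

text \<open>The tension field occurs under two derivatives and may be replaced by any smooth section
  that agrees with it on \<open>S\<close>. Applied to its frame expression and to the zero
  section.\<close>

lemma bitension_hess:
  assumes "smooth_on S W" "\<And>v. v \<in> S \<Longrightarrow> tension G H F v = W v" "u \<in> S"
  shows "bitension G H F u = metric_trace G u (hess W u)
     - metric_trace G u (\<lambda>a b. conn_curv (Gam H) (F u) (fd F u a) (W u) (fd F u b))"
proof -
  have cong: "conn \<Gamma>F X (tension G H F) v = conn \<Gamma>F X W v" if "v \<in> S" for X v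
    by (rule E.conn_cong[OF assms(1) that, symmetric]) (simp_all add: assms)
  have "conn \<Gamma>F (\<lambda>_. a) (conn \<Gamma>F (\<lambda>_. b) (tension G H F)) u = conn \<Gamma>F (\<lambda>_. a) (conn \<Gamma>F (\<lambda>_. b) W) u" for a b
    by (rule E.conn_cong[OF E.smooth_conn[OF smooth_on_const assms(1)] assms(3), symmetric])
       (simp_all add: cong)
  then show ?thesis
    unfolding bitension_def pullback_deriv_conn cov_deriv_conn curv_conn hess_def[abs_def]
    by (simp add: cong assms)
qed

end

section \<open>Connection coefficients in an adapted frame\<close>

locale adapted_frame = submersion_chart +
  fixes \<epsilon>\<^sub>1 \<epsilon>\<^sub>2 :: "real^2 \<Rightarrow> real^2" and e\<^sub>1 e\<^sub>2 e\<^sub>3 :: "real^3 \<Rightarrow> real^3"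
  assumes smooth_\<epsilon>: "smooth_on V \<epsilon>\<^sub>1" "smooth_on V \<epsilon>\<^sub>2"
    and smooth_e: "smooth_on S e\<^sub>1" "smooth_on S e\<^sub>2" "smooth_on S e\<^sub>3"
    and F_e: "u \<in> S \<Longrightarrow> fd F u (e\<^sub>1 u) = \<epsilon>\<^sub>1 (F u)" "u \<in> S \<Longrightarrow> fd F u (e\<^sub>2 u) = \<epsilon>\<^sub>2 (F u)"
      "u \<in> S \<Longrightarrow> fd F u (e\<^sub>3 u) = 0"
    and \<epsilon>_on: "v \<in> V \<Longrightarrow> gram H v (\<epsilon>\<^sub>1 v) (\<epsilon>\<^sub>1 v) = 1" "v \<in> V \<Longrightarrow> gram H v (\<epsilon>\<^sub>2 v) (\<epsilon>\<^sub>2 v) = 1"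
      "v \<in> V \<Longrightarrow> gram H v (\<epsilon>\<^sub>1 v) (\<epsilon>\<^sub>2 v) = 0"
    and e_on: "u \<in> S \<Longrightarrow> gram G u (e\<^sub>1 u) (e\<^sub>1 u) = 1" "u \<in> S \<Longrightarrow> gram G u (e\<^sub>2 u) (e\<^sub>2 u) = 1"
      "u \<in> S \<Longrightarrow> gram G u (e\<^sub>3 u) (e\<^sub>3 u) = 1" "u \<in> S \<Longrightarrow> gram G u (e\<^sub>1 u) (e\<^sub>2 u) = 0"
      "u \<in> S \<Longrightarrow> gram G u (e\<^sub>1 u) (e\<^sub>3 u) = 0" "u \<in> S \<Longrightarrow> gram G u (e\<^sub>2 u) (e\<^sub>3 u) = 0"
begin

lemma \<epsilon>_on': "v \<in> V \<Longrightarrow> gram H v (\<epsilon>\<^sub>2 v) (\<epsilon>\<^sub>1 v) = 0"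
  using N.gram_sym \<epsilon>_on by metis

lemma e_on': "u \<in> S \<Longrightarrow> gram G u (e\<^sub>2 u) (e\<^sub>1 u) = 0" "u \<in> S \<Longrightarrow> gram G u (e\<^sub>3 u) (e\<^sub>1 u) = 0"
  "u \<in> S \<Longrightarrow> gram G u (e\<^sub>3 u) (e\<^sub>2 u) = 0"
  using M.gram_sym e_on by metis+

lemmas e_ons = e_on e_on'
lemmas \<epsilon>_ons = \<epsilon>_on \<epsilon>_on'

lemma e_family:
  assumes "u \<in> S"
  defines "e \<equiv> (\<lambda>i::3. if i = 1 then e\<^sub>1 u else if i = 2 then e\<^sub>2 u else e\<^sub>3 u)"
  shows "gram G u (e i) (e j) = (if i = j then 1 else 0)"
  using e_ons[OF assms(1)] exhaust_3[of i] exhaust_3[of j] by (auto simp: e_def)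

lemma e_expansion:
  assumes "u \<in> S"
  shows "x = gram G u (e\<^sub>1 u) x *\<^sub>R e\<^sub>1 u + gram G u (e\<^sub>2 u) x *\<^sub>R e\<^sub>2 u + gram G u (e\<^sub>3 u) x *\<^sub>R e\<^sub>3 u"
  using orthonormal_expansion[OF e_family[OF assms], of x] by (simp add: sum_3)

lemma e_trace:
  assumes "u \<in> S" "bilinear T"
  shows "metric_trace G u T = T (e\<^sub>1 u) (e\<^sub>1 u) + T (e\<^sub>2 u) (e\<^sub>2 u) + T (e\<^sub>3 u) (e\<^sub>3 u)"
  using metric_trace_orthonormal[OF e_family[OF assms(1)] assms(2)] by (simp add: sum_3)

lemma \<epsilon>_expansion:
  assumes "v \<in> V"
  shows "x = gram H v (\<epsilon>\<^sub>1 v) x *\<^sub>R \<epsilon>\<^sub>1 v + gram H v (\<epsilon>\<^sub>2 v) x *\<^sub>R \<epsilon>\<^sub>2 v"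
proof -
  define e where "e = (\<lambda>i::2. if i = 1 then \<epsilon>\<^sub>1 v else \<epsilon>\<^sub>2 v)"
  have "gram H v (e i) (e j) = (if i = j then 1 else 0)" for i j
    using \<epsilon>_ons[OF assms(1)] exhaust_2[of i] exhaust_2[of j] by (auto simp: e_def)
  from orthonormal_expansion[OF this, of x] show ?thesis by (simp add: sum_2 e_def)
qed

text \<open>\<open>s\<close> and \<open>t\<close> are the values of the connection form of the
  surface on \<open>\<epsilon>\<^sub>1\<close> and \<open>\<epsilon>\<^sub>2\<close>; together they
  determine its Levi-Civita connection.\<close>

definition s :: "real^2 \<Rightarrow> real" where "s v = gram H v (conn (Gam H) \<epsilon>\<^sub>1 \<epsilon>\<^sub>1 v) (\<epsilon>\<^sub>2 v)"
definition t :: "real^2 \<Rightarrow> real" where "t v = gram H v (conn (Gam H) \<epsilon>\<^sub>2 \<epsilon>\<^sub>1 v) (\<epsilon>\<^sub>2 v)"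

lemma smooth_st: "smooth_on V s" "smooth_on V t"
  unfolding s_def[abs_def] t_def[abs_def] by (intro N.smooth_gram N.smooth_conn smooth_\<epsilon>)+

lemma N_conn_const:
  assumes "smooth_on V X" "smooth_on V Y" "v \<in> V" "\<And>v. v \<in> V \<Longrightarrow> gram H v (X v) (Y v) = r"
  shows "gram H v (conn (Gam H) Z X v) (Y v) = - gram H v (X v) (conn (Gam H) Z Y v)"
proof -
  have "fd (\<lambda>v. gram H v (X v) (Y v)) v (Z v) = 0"
    using fd_cong_open[OF N.open_S assms(3), of "\<lambda>_. r" "\<lambda>v. gram H v (X v) (Y v)"] assms(4) by simp
  then show ?thesis
    using N.metric_compat[OF assms(1-3), of "Z v"] N.conn_pointwise[of Z] by (simp add: eq_neg_iff_add_eq_0)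
qed

lemma M_conn_const:
  assumes "smooth_on S X" "smooth_on S Y" "u \<in> S" "\<And>u. u \<in> S \<Longrightarrow> gram G u (X u) (Y u) = r"
  shows "gram G u (conn (Gam G) Z X u) (Y u) = - gram G u (X u) (conn (Gam G) Z Y u)"
proof -
  have "fd (\<lambda>v. gram G v (X v) (Y v)) u (Z u) = 0"
    using fd_cong_open[OF M.open_S assms(3), of "\<lambda>_. r" "\<lambda>v. gram G v (X v) (Y v)"] assms(4) by simp
  then show ?thesis
    using M.metric_compat[OF assms(1-3), of "Z u"] M.conn_pointwise[of Z] by (simp add: eq_neg_iff_add_eq_0)
qed

lemma N_conn:
  assumes "v \<in> V"
  shows "conn (Gam H) \<epsilon>\<^sub>1 \<epsilon>\<^sub>1 v = s v *\<^sub>R \<epsilon>\<^sub>2 v" "conn (Gam H) \<epsilon>\<^sub>1 \<epsilon>\<^sub>2 v = - s v *\<^sub>R \<epsilon>\<^sub>1 v"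
    "conn (Gam H) \<epsilon>\<^sub>2 \<epsilon>\<^sub>1 v = t v *\<^sub>R \<epsilon>\<^sub>2 v" "conn (Gam H) \<epsilon>\<^sub>2 \<epsilon>\<^sub>2 v = - t v *\<^sub>R \<epsilon>\<^sub>1 v"
proof -
  have 1: "gram H v (\<epsilon>\<^sub>1 v) (conn (Gam H) Z \<epsilon>\<^sub>1 v) = 0" "gram H v (\<epsilon>\<^sub>2 v) (conn (Gam H) Z \<epsilon>\<^sub>2 v) = 0"
    "gram H v (\<epsilon>\<^sub>1 v) (conn (Gam H) Z \<epsilon>\<^sub>2 v) = - gram H v (\<epsilon>\<^sub>2 v) (conn (Gam H) Z \<epsilon>\<^sub>1 v)" for Z
    using N_conn_const[OF smooth_\<epsilon>(1) smooth_\<epsilon>(1) assms \<epsilon>_on(1), of Z]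
      N_conn_const[OF smooth_\<epsilon>(2) smooth_\<epsilon>(2) assms \<epsilon>_on(2), of Z]
      N_conn_const[OF smooth_\<epsilon>(1) smooth_\<epsilon>(2) assms \<epsilon>_on(3), of Z]
      N.gram_sym[OF assms, of "conn (Gam H) Z _ v"] by auto
  have 2: "conn (Gam H) Z \<epsilon>\<^sub>1 v = gram H v (\<epsilon>\<^sub>2 v) (conn (Gam H) Z \<epsilon>\<^sub>1 v) *\<^sub>R \<epsilon>\<^sub>2 v"
    "conn (Gam H) Z \<epsilon>\<^sub>2 v = - gram H v (\<epsilon>\<^sub>2 v) (conn (Gam H) Z \<epsilon>\<^sub>1 v) *\<^sub>R \<epsilon>\<^sub>1 v" for Z
    using \<epsilon>_expansion[OF assms, of "conn (Gam H) Z \<epsilon>\<^sub>1 v"] \<epsilon>_expansion[OF assms, of "conn (Gam H) Z \<epsilon>\<^sub>2 v"] 1[of Z]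
    by simp_all
  show "conn (Gam H) \<epsilon>\<^sub>1 \<epsilon>\<^sub>1 v = s v *\<^sub>R \<epsilon>\<^sub>2 v" "conn (Gam H) \<epsilon>\<^sub>1 \<epsilon>\<^sub>2 v = - s v *\<^sub>R \<epsilon>\<^sub>1 v"
    "conn (Gam H) \<epsilon>\<^sub>2 \<epsilon>\<^sub>1 v = t v *\<^sub>R \<epsilon>\<^sub>2 v" "conn (Gam H) \<epsilon>\<^sub>2 \<epsilon>\<^sub>2 v = - t v *\<^sub>R \<epsilon>\<^sub>1 v"
    using 2[of \<epsilon>\<^sub>1] 2[of \<epsilon>\<^sub>2] N.gram_sym[OF assms, of "\<epsilon>\<^sub>2 v"] by (simp_all add: s_def t_def)
qed

lemma N_lie: "v \<in> V \<Longrightarrow> lie \<epsilon>\<^sub>1 \<epsilon>\<^sub>2 v = - s v *\<^sub>R \<epsilon>\<^sub>1 v - t v *\<^sub>R \<epsilon>\<^sub>2 v"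
  using N.torsion_free[of v \<epsilon>\<^sub>1 \<epsilon>\<^sub>2] by (simp add: N_conn)

text \<open>The Gaussian curvature of the surface, in terms of the connection form.\<close>

definition K :: "real^2 \<Rightarrow> real" where
  "K v = fd s v (\<epsilon>\<^sub>2 v) - fd t v (\<epsilon>\<^sub>1 v) - (s v)\<^sup>2 - (t v)\<^sup>2"

lemma N_curv:
  assumes "v \<in> V"
  shows "conn_curv (Gam H) v (\<epsilon>\<^sub>1 v) (\<epsilon>\<^sub>2 v) (\<epsilon>\<^sub>2 v) = K v *\<^sub>R \<epsilon>\<^sub>1 v"
    "conn_curv (Gam H) v (\<epsilon>\<^sub>1 v) (\<epsilon>\<^sub>2 v) (\<epsilon>\<^sub>1 v) = - K v *\<^sub>R \<epsilon>\<^sub>2 v"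
proof -
  have ms: "smooth_on V (\<lambda>v. - s v)" "smooth_on V (\<lambda>v. - t v)"
    by (intro smooth_on_minus smooth_st N.open_S)+
  have 1: "conn (Gam H) \<epsilon>\<^sub>1 (conn (Gam H) \<epsilon>\<^sub>2 \<epsilon>\<^sub>2) v = conn (Gam H) \<epsilon>\<^sub>1 (\<lambda>v. - t v *\<^sub>R \<epsilon>\<^sub>1 v) v"
    "conn (Gam H) \<epsilon>\<^sub>2 (conn (Gam H) \<epsilon>\<^sub>1 \<epsilon>\<^sub>2) v = conn (Gam H) \<epsilon>\<^sub>2 (\<lambda>v. - s v *\<^sub>R \<epsilon>\<^sub>1 v) v"
    by (rule N.conn_cong[OF N.smooth_conn assms]; simp add: smooth_\<epsilon> N_conn)+
  have 2: "conn (Gam H) (lie \<epsilon>\<^sub>1 \<epsilon>\<^sub>2) \<epsilon>\<^sub>2 v = ((s v)\<^sup>2 + (t v)\<^sup>2) *\<^sub>R \<epsilon>\<^sub>1 v"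
    using N.conn_field_comb[OF smooth_\<epsilon>(2) assms, of "lie \<epsilon>\<^sub>1 \<epsilon>\<^sub>2" "- s v" \<epsilon>\<^sub>1 "- t v" \<epsilon>\<^sub>2]
    by (simp add: N_lie N_conn assms power2_eq_square algebra_simps)
  show R: "conn_curv (Gam H) v (\<epsilon>\<^sub>1 v) (\<epsilon>\<^sub>2 v) (\<epsilon>\<^sub>2 v) = K v *\<^sub>R \<epsilon>\<^sub>1 v"
    unfolding N.curvature_fields[OF smooth_\<epsilon> smooth_\<epsilon>(2) assms] 1 2
      N.conn_scaleR[OF ms(1) smooth_\<epsilon>(1) assms] N.conn_scaleR[OF ms(2) smooth_\<epsilon>(1) assms]
    by (simp add: N_conn assms fd_minus smooth_on_imp_differentiable[OF smooth_st(1)]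
        smooth_on_imp_differentiable[OF smooth_st(2)] K_def algebra_simps)
  let ?R = "conn_curv (Gam H) v (\<epsilon>\<^sub>1 v) (\<epsilon>\<^sub>2 v) (\<epsilon>\<^sub>1 v)"
  have "gram H v ?R (\<epsilon>\<^sub>1 v) = 0" "gram H v ?R (\<epsilon>\<^sub>2 v) = - K v"
    using N.gram_curv_self[OF assms, of "\<epsilon>\<^sub>1 v" "\<epsilon>\<^sub>2 v" "\<epsilon>\<^sub>1 v"]
      N.gram_curv_skew[OF assms, of "\<epsilon>\<^sub>1 v" "\<epsilon>\<^sub>2 v" "\<epsilon>\<^sub>1 v" "\<epsilon>\<^sub>2 v"]
    by (simp_all add: R gram_simps \<epsilon>_ons assms)
  then show "?R = - K v *\<^sub>R \<epsilon>\<^sub>2 v"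
    using \<epsilon>_expansion[OF assms, of ?R] N.gram_sym[OF assms, of ?R] by simp
qed

definition \<kappa>\<^sub>1 :: "real^3 \<Rightarrow> real" where "\<kappa>\<^sub>1 u = gram G u (lie e\<^sub>1 e\<^sub>3 u) (e\<^sub>3 u)"
definition \<kappa>\<^sub>2 :: "real^3 \<Rightarrow> real" where "\<kappa>\<^sub>2 u = gram G u (lie e\<^sub>2 e\<^sub>3 u) (e\<^sub>3 u)"
text \<open>O'Neill's integrability tensor in this frame; sign and factor are chosen so that the
  covariant derivative of \<open>e\<^sub>3\<close> along \<open>e\<^sub>1\<close> is
  \<open>\<sigma> e\<^sub>2\<close>.\<close>

definition \<sigma> :: "real^3 \<Rightarrow> real" where "\<sigma> u = - gram G u (lie e\<^sub>1 e\<^sub>2 u) (e\<^sub>3 u) / 2"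

lemma smooth_\<kappa>: "smooth_on S \<kappa>\<^sub>1" "smooth_on S \<kappa>\<^sub>2" "smooth_on S \<sigma>"
  unfolding \<kappa>\<^sub>1_def[abs_def] \<kappa>\<^sub>2_def[abs_def] \<sigma>_def[abs_def] divide_inverse
  by (intro smooth_on_mult smooth_on_const smooth_on_minus M.smooth_gram smooth_lie M.open_S smooth_e)+

text \<open>Horizontal components can be read off after projection, since \<open>e\<^sub>1\<close>
  and \<open>e\<^sub>2\<close> lift an orthonormal frame and \<open>e\<^sub>3\<close> projects to
  zero.\<close>

lemma gram_e_F:
  assumes "u \<in> S"
  shows "gram G u (e\<^sub>1 u) x = gram H (F u) (\<epsilon>\<^sub>1 (F u)) (fd F u x)" "gram G u (e\<^sub>2 u) x = gram H (F u) (\<epsilon>\<^sub>2 (F u)) (fd F u x)"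
  by (subst (2) e_expansion[OF assms, of x], simp add: F_simps assms F_e gram_simps \<epsilon>_ons F_V)+

text \<open>Brackets of projectable fields project to the brackets of their images. As
  \<open>e\<^sub>3\<close> projects to zero, its brackets with \<open>e\<^sub>1\<close> and
  \<open>e\<^sub>2\<close> are vertical.\<close>

lemma F_lie:
  assumes "u \<in> S"
  shows "fd F u (lie e\<^sub>1 e\<^sub>2 u) = - s (F u) *\<^sub>R \<epsilon>\<^sub>1 (F u) - t (F u) *\<^sub>R \<epsilon>\<^sub>2 (F u)"
    "fd F u (lie e\<^sub>1 e\<^sub>3 u) = 0" "fd F u (lie e\<^sub>2 e\<^sub>3 u) = 0"
proof -
  have d: "fd (\<lambda>v. fd F v (e\<^sub>1 v)) u x = fd \<epsilon>\<^sub>1 (F u) (fd F u x)"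
     "fd (\<lambda>v. fd F v (e\<^sub>2 v)) u x = fd \<epsilon>\<^sub>2 (F u) (fd F u x)"
     "fd (\<lambda>v. fd F v (e\<^sub>3 v)) u x = 0" for x
  proof -
    have "fd (\<lambda>v. fd F v (e\<^sub>1 v)) u = fd (\<lambda>v. \<epsilon>\<^sub>1 (F v)) u" "fd (\<lambda>v. fd F v (e\<^sub>2 v)) u = fd (\<lambda>v. \<epsilon>\<^sub>2 (F v)) u"
      "fd (\<lambda>v. fd F v (e\<^sub>3 v)) u = fd (\<lambda>_. 0) u"
      by (rule fd_cong_open[OF M.open_S assms];
          simp add: F_e smooth_on_imp_differentiable[OF smooth_comp_F assms] smooth_\<epsilon>)+
    then show "fd (\<lambda>v. fd F v (e\<^sub>1 v)) u x = fd \<epsilon>\<^sub>1 (F u) (fd F u x)"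
      "fd (\<lambda>v. fd F v (e\<^sub>2 v)) u x = fd \<epsilon>\<^sub>2 (F u) (fd F u x)" "fd (\<lambda>v. fd F v (e\<^sub>3 v)) u x = 0"
      using fd_compose[OF smooth_on_imp_differentiable[OF smooth_F assms]
          smooth_on_imp_differentiable[OF smooth_\<epsilon>(1) F_V[OF assms]]]
        fd_compose[OF smooth_on_imp_differentiable[OF smooth_F assms]
          smooth_on_imp_differentiable[OF smooth_\<epsilon>(2) F_V[OF assms]]] by simp_all
  qed
  have z: "fd \<epsilon>\<^sub>1 (F u) 0 = 0" "fd \<epsilon>\<^sub>2 (F u) 0 = 0"
    using linear_0 smooth_on_linear_fd smooth_\<epsilon> F_V[OF assms] by blast+
  show "fd F u (lie e\<^sub>1 e\<^sub>2 u) = - s (F u) *\<^sub>R \<epsilon>\<^sub>1 (F u) - t (F u) *\<^sub>R \<epsilon>\<^sub>2 (F u)"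
    using N_lie[OF F_V[OF assms], unfolded lie_def] by (simp add: fd_lie[OF M.open_S smooth_F] smooth_e assms d F_e)
  show "fd F u (lie e\<^sub>1 e\<^sub>3 u) = 0" "fd F u (lie e\<^sub>2 e\<^sub>3 u) = 0"
    by (simp_all add: fd_lie[OF M.open_S smooth_F] smooth_e assms d F_e z)
qed

lemma M_lie:
  assumes "u \<in> S"
  shows "lie e\<^sub>1 e\<^sub>2 u = - s (F u) *\<^sub>R e\<^sub>1 u - t (F u) *\<^sub>R e\<^sub>2 u - (2 * \<sigma> u) *\<^sub>R e\<^sub>3 u"
    "lie e\<^sub>1 e\<^sub>3 u = \<kappa>\<^sub>1 u *\<^sub>R e\<^sub>3 u" "lie e\<^sub>2 e\<^sub>3 u = \<kappa>\<^sub>2 u *\<^sub>R e\<^sub>3 u"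
  by (subst e_expansion[OF assms, of "lie _ _ u"];
      simp add: gram_e_F[OF assms] F_lie[OF assms] gram_simps \<epsilon>_ons F_V assms;
      simp add: \<sigma>_def \<kappa>\<^sub>1_def \<kappa>\<^sub>2_def M.gram_sym[OF assms, of "e\<^sub>3 u"])+

text \<open>Metric compatibility makes the coefficients skew and leaves nine unknowns.
  Torsion-freeness, applied to three brackets with three components each, gives nine linear
  equations for them.\<close>

lemma M_conn:
  assumes "u \<in> S"
  shows "conn (Gam G) e\<^sub>1 e\<^sub>1 u = s (F u) *\<^sub>R e\<^sub>2 u"
    "conn (Gam G) e\<^sub>1 e\<^sub>2 u = - s (F u) *\<^sub>R e\<^sub>1 u - \<sigma> u *\<^sub>R e\<^sub>3 u"
    "conn (Gam G) e\<^sub>1 e\<^sub>3 u = \<sigma> u *\<^sub>R e\<^sub>2 u"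
    "conn (Gam G) e\<^sub>2 e\<^sub>1 u = t (F u) *\<^sub>R e\<^sub>2 u + \<sigma> u *\<^sub>R e\<^sub>3 u"
    "conn (Gam G) e\<^sub>2 e\<^sub>2 u = - t (F u) *\<^sub>R e\<^sub>1 u"
    "conn (Gam G) e\<^sub>2 e\<^sub>3 u = - \<sigma> u *\<^sub>R e\<^sub>1 u"
    "conn (Gam G) e\<^sub>3 e\<^sub>1 u = \<sigma> u *\<^sub>R e\<^sub>2 u - \<kappa>\<^sub>1 u *\<^sub>R e\<^sub>3 u"
    "conn (Gam G) e\<^sub>3 e\<^sub>2 u = - \<sigma> u *\<^sub>R e\<^sub>1 u - \<kappa>\<^sub>2 u *\<^sub>R e\<^sub>3 u"
    "conn (Gam G) e\<^sub>3 e\<^sub>3 u = \<kappa>\<^sub>1 u *\<^sub>R e\<^sub>1 u + \<kappa>\<^sub>2 u *\<^sub>R e\<^sub>2 u"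
proof -
  have skew: "gram G u (e\<^sub>1 u) (conn (Gam G) Z e\<^sub>1 u) = 0" "gram G u (e\<^sub>2 u) (conn (Gam G) Z e\<^sub>2 u) = 0"
    "gram G u (e\<^sub>3 u) (conn (Gam G) Z e\<^sub>3 u) = 0"
    "gram G u (e\<^sub>1 u) (conn (Gam G) Z e\<^sub>2 u) = - gram G u (e\<^sub>2 u) (conn (Gam G) Z e\<^sub>1 u)"
    "gram G u (e\<^sub>1 u) (conn (Gam G) Z e\<^sub>3 u) = - gram G u (e\<^sub>3 u) (conn (Gam G) Z e\<^sub>1 u)"
    "gram G u (e\<^sub>2 u) (conn (Gam G) Z e\<^sub>3 u) = - gram G u (e\<^sub>3 u) (conn (Gam G) Z e\<^sub>2 u)" for Z
    using M_conn_const[OF smooth_e(1) smooth_e(1) assms e_on(1), of Z]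
      M_conn_const[OF smooth_e(2) smooth_e(2) assms e_on(2), of Z]
      M_conn_const[OF smooth_e(3) smooth_e(3) assms e_on(3), of Z]
      M_conn_const[OF smooth_e(1) smooth_e(2) assms e_on(4), of Z]
      M_conn_const[OF smooth_e(1) smooth_e(3) assms e_on(5), of Z]
      M_conn_const[OF smooth_e(2) smooth_e(3) assms e_on(6), of Z]
      M.gram_sym[OF assms, of "conn (Gam G) Z _ u"] by auto
  have tor: "gram G u x (conn (Gam G) X Y u) - gram G u x (conn (Gam G) Y X u) = gram G u x (lie X Y u)" for x X Y
    using M.torsion_free[OF assms, of X Y] by (simp flip: gram_simps)
  note t12 = tor[of _ e\<^sub>1 e\<^sub>2] and t13 = tor[of _ e\<^sub>1 e\<^sub>3] and t23 = tor[of _ e\<^sub>2 e\<^sub>3]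
  note ts = t12[of "e\<^sub>1 u"] t12[of "e\<^sub>2 u"] t12[of "e\<^sub>3 u"] t13[of "e\<^sub>1 u"] t13[of "e\<^sub>2 u"] t13[of "e\<^sub>3 u"]
     t23[of "e\<^sub>1 u"] t23[of "e\<^sub>2 u"] t23[of "e\<^sub>3 u"]
  note ts' = ts[unfolded M_lie[OF assms] gram_simps e_ons[OF assms]]
  note sk = skew[of e\<^sub>1] skew[of e\<^sub>2] skew[of e\<^sub>3]
  have co: "gram G u (e\<^sub>2 u) (conn (Gam G) e\<^sub>1 e\<^sub>1 u) = s (F u)"
    "gram G u (e\<^sub>3 u) (conn (Gam G) e\<^sub>1 e\<^sub>1 u) = 0"
    "gram G u (e\<^sub>3 u) (conn (Gam G) e\<^sub>1 e\<^sub>2 u) = - \<sigma> u"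
    "gram G u (e\<^sub>2 u) (conn (Gam G) e\<^sub>2 e\<^sub>1 u) = t (F u)"
    "gram G u (e\<^sub>3 u) (conn (Gam G) e\<^sub>2 e\<^sub>1 u) = \<sigma> u"
    "gram G u (e\<^sub>3 u) (conn (Gam G) e\<^sub>2 e\<^sub>2 u) = 0"
    "gram G u (e\<^sub>2 u) (conn (Gam G) e\<^sub>3 e\<^sub>1 u) = \<sigma> u"
    "gram G u (e\<^sub>3 u) (conn (Gam G) e\<^sub>3 e\<^sub>1 u) = - \<kappa>\<^sub>1 u"
    "gram G u (e\<^sub>3 u) (conn (Gam G) e\<^sub>3 e\<^sub>2 u) = - \<kappa>\<^sub>2 u"
    using ts' sk by simp_all
  show "conn (Gam G) e\<^sub>1 e\<^sub>1 u = s (F u) *\<^sub>R e\<^sub>2 u"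
    "conn (Gam G) e\<^sub>1 e\<^sub>2 u = - s (F u) *\<^sub>R e\<^sub>1 u - \<sigma> u *\<^sub>R e\<^sub>3 u"
    "conn (Gam G) e\<^sub>1 e\<^sub>3 u = \<sigma> u *\<^sub>R e\<^sub>2 u"
    "conn (Gam G) e\<^sub>2 e\<^sub>1 u = t (F u) *\<^sub>R e\<^sub>2 u + \<sigma> u *\<^sub>R e\<^sub>3 u"
    "conn (Gam G) e\<^sub>2 e\<^sub>2 u = - t (F u) *\<^sub>R e\<^sub>1 u"
    "conn (Gam G) e\<^sub>2 e\<^sub>3 u = - \<sigma> u *\<^sub>R e\<^sub>1 u"
    "conn (Gam G) e\<^sub>3 e\<^sub>1 u = \<sigma> u *\<^sub>R e\<^sub>2 u - \<kappa>\<^sub>1 u *\<^sub>R e\<^sub>3 u"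
    "conn (Gam G) e\<^sub>3 e\<^sub>2 u = - \<sigma> u *\<^sub>R e\<^sub>1 u - \<kappa>\<^sub>2 u *\<^sub>R e\<^sub>3 u"
    "conn (Gam G) e\<^sub>3 e\<^sub>3 u = \<kappa>\<^sub>1 u *\<^sub>R e\<^sub>1 u + \<kappa>\<^sub>2 u *\<^sub>R e\<^sub>2 u"
    by (subst e_expansion[OF assms, of "conn _ _ _ u"]; simp add: sk co)+
qed

end

section \<open>Structure equations from constant curvature\<close>

context adapted_frame
begin

lemma commutators:
  fixes f :: "real^3 \<Rightarrow> real"
  assumes "smooth_on S f" "u \<in> S"
  shows "fd (\<lambda>v. fd f v (e\<^sub>2 v)) u (e\<^sub>1 u) - fd (\<lambda>v. fd f v (e\<^sub>1 v)) u (e\<^sub>2 u) =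
      - s (F u) * fd f u (e\<^sub>1 u) - t (F u) * fd f u (e\<^sub>2 u) - 2 * \<sigma> u * fd f u (e\<^sub>3 u)"
    "fd (\<lambda>v. fd f v (e\<^sub>3 v)) u (e\<^sub>1 u) - fd (\<lambda>v. fd f v (e\<^sub>1 v)) u (e\<^sub>3 u) = \<kappa>\<^sub>1 u * fd f u (e\<^sub>3 u)"
    "fd (\<lambda>v. fd f v (e\<^sub>3 v)) u (e\<^sub>2 u) - fd (\<lambda>v. fd f v (e\<^sub>2 v)) u (e\<^sub>3 u) = \<kappa>\<^sub>2 u * fd f u (e\<^sub>3 u)"
  using smooth_on_linear_fd[OF assms] fd_lie[OF M.open_S assms(1) smooth_e(1,2) assms(2)]
    fd_lie[OF M.open_S assms(1) smooth_e(1,3) assms(2)] fd_lie[OF M.open_S assms(1) smooth_e(2,3) assms(2)]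
  by (simp_all add: assms M_lie linear_diff linear_scale linear_neg)

lemma fd_basic:
  fixes f :: "real^2 \<Rightarrow> real"
  assumes "smooth_on V f" "u \<in> S"
  shows "fd (\<lambda>v. f (F v)) u a = fd f (F u) (fd F u a)"
  by (rule fd_compose[OF smooth_on_imp_differentiable[OF smooth_F assms(2)]
      smooth_on_imp_differentiable[OF assms(1) F_V[OF assms(2)]]])

lemma fd_basic_vertical:
  fixes f :: "real^2 \<Rightarrow> real"
  assumes "smooth_on V f" "u \<in> S"
  shows "fd (\<lambda>v. f (F v)) u (e\<^sub>3 u) = 0"
  by (simp add: fd_basic assms F_e linear_0[OF smooth_on_linear_fd[OF assms(1) F_V[OF assms(2)]]])

lemmas smooth_sF = smooth_comp_F[OF smooth_st(1)] and smooth_tF = smooth_comp_F[OF smooth_st(2)]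

lemma M_conn_comb:
  assumes "smooth_on S a" "smooth_on S b" "smooth_on S c" "u \<in> S"
    "\<And>v. v \<in> S \<Longrightarrow> W v = a v *\<^sub>R e\<^sub>1 v + b v *\<^sub>R e\<^sub>2 v + c v *\<^sub>R e\<^sub>3 v"
  shows "conn (Gam G) X W u = fd a u (X u) *\<^sub>R e\<^sub>1 u + a u *\<^sub>R conn (Gam G) X e\<^sub>1 u
     + fd b u (X u) *\<^sub>R e\<^sub>2 u + b u *\<^sub>R conn (Gam G) X e\<^sub>2 u + fd c u (X u) *\<^sub>R e\<^sub>3 u + c u *\<^sub>R conn (Gam G) X e\<^sub>3 u"
proof -
  note sm = smooth_on_scaleR[OF M.open_S assms(1) smooth_e(1)] smooth_on_scaleR[OF M.open_S assms(2) smooth_e(2)]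
    smooth_on_scaleR[OF M.open_S assms(3) smooth_e(3)]
  note sm' = smooth_on_add[OF M.open_S sm(1,2)]
  have "conn (Gam G) X W u = conn (Gam G) X (\<lambda>v. a v *\<^sub>R e\<^sub>1 v + b v *\<^sub>R e\<^sub>2 v + c v *\<^sub>R e\<^sub>3 v) u"
    by (rule M.conn_cong[OF smooth_on_add[OF M.open_S sm' sm(3)] assms(4), symmetric]) (simp_all add: assms(5))
  then show ?thesis
    by (simp add: M.conn_add[OF sm' sm(3) assms(4)] M.conn_add[OF sm(1,2) assms(4)] M.conn_scaleR assms smooth_e)
qed

lemma smooth_neg: "smooth_on S f \<Longrightarrow> smooth_on S (\<lambda>v. - f v)"
  by (rule smooth_on_minus[OF M.open_S])

lemma differentiable_S: "smooth_on S f \<Longrightarrow> u \<in> S \<Longrightarrow> f differentiable (at u)"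
  by (rule smooth_on_imp_differentiable)

lemmas zero = smooth_on_const[where c = "0::real"]

lemma M_curv:
  assumes "u \<in> S"
  shows "conn_curv (Gam G) u a b w = \<kappa> *\<^sub>R (gram G u b w *\<^sub>R a - gram G u a w *\<^sub>R b)"
  by (rule M.const_curv_tensor[OF assms const_curv[OF assms]])

text \<open>The components of \<open>R(e\<^sub>1, e\<^sub>3) e\<^sub>3 = \<kappa> e\<^sub>1\<close>
  along \<open>e\<^sub>1\<close> and \<open>e\<^sub>2\<close>, with the connection coefficients
  inserted.\<close>

lemma structure_13:
  assumes "u \<in> S"
  shows "fd \<kappa>\<^sub>1 u (e\<^sub>1 u) = s (F u) * \<kappa>\<^sub>2 u + (\<kappa>\<^sub>1 u)\<^sup>2 + \<kappa> - (\<sigma> u)\<^sup>2"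
    "fd \<kappa>\<^sub>2 u (e\<^sub>1 u) = - s (F u) * \<kappa>\<^sub>1 u + \<kappa>\<^sub>1 u * \<kappa>\<^sub>2 u + fd \<sigma> u (e\<^sub>3 u)"
proof -
  have 1: "conn (Gam G) e\<^sub>1 (conn (Gam G) e\<^sub>3 e\<^sub>3) u =
      fd \<kappa>\<^sub>1 u (e\<^sub>1 u) *\<^sub>R e\<^sub>1 u + \<kappa>\<^sub>1 u *\<^sub>R conn (Gam G) e\<^sub>1 e\<^sub>1 u + fd \<kappa>\<^sub>2 u (e\<^sub>1 u) *\<^sub>R e\<^sub>2 u + \<kappa>\<^sub>2 u *\<^sub>R conn (Gam G) e\<^sub>1 e\<^sub>2 u"
    by (subst M_conn_comb[OF smooth_\<kappa>(1,2) zero assms]) (simp_all add: M_conn)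
  have 2: "conn (Gam G) e\<^sub>3 (conn (Gam G) e\<^sub>1 e\<^sub>3) u = fd \<sigma> u (e\<^sub>3 u) *\<^sub>R e\<^sub>2 u + \<sigma> u *\<^sub>R conn (Gam G) e\<^sub>3 e\<^sub>2 u"
    by (subst M_conn_comb[OF zero smooth_\<kappa>(3) zero assms]) (simp_all add: M_conn)
  have 3: "conn (Gam G) (lie e\<^sub>1 e\<^sub>3) e\<^sub>3 u = \<kappa>\<^sub>1 u *\<^sub>R conn (Gam G) e\<^sub>3 e\<^sub>3 u"
    using M.conn_field_comb[OF smooth_e(3) assms, of "lie e\<^sub>1 e\<^sub>3" "\<kappa>\<^sub>1 u" e\<^sub>3 0 e\<^sub>3] by (simp add: M_lie assms)
  note eq = M.curvature_fields[OF smooth_e(1,3,3) assms, unfolded M_curv[OF assms] 1 2 3]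
  show "fd \<kappa>\<^sub>1 u (e\<^sub>1 u) = s (F u) * \<kappa>\<^sub>2 u + (\<kappa>\<^sub>1 u)\<^sup>2 + \<kappa> - (\<sigma> u)\<^sup>2"
    using arg_cong[OF eq, of "gram G u (e\<^sub>1 u)"]
    by (simp add: gram_simps e_ons M_conn assms power2_eq_square algebra_simps)
  show "fd \<kappa>\<^sub>2 u (e\<^sub>1 u) = - s (F u) * \<kappa>\<^sub>1 u + \<kappa>\<^sub>1 u * \<kappa>\<^sub>2 u + fd \<sigma> u (e\<^sub>3 u)"
    using arg_cong[OF eq, of "gram G u (e\<^sub>2 u)"]
    by (simp add: gram_simps e_ons M_conn assms power2_eq_square algebra_simps)
qed

text \<open>The same for \<open>R(e\<^sub>2, e\<^sub>3) e\<^sub>3 = \<kappa> e\<^sub>2\<close>. The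
  vertical derivative of \<open>\<sigma>\<close> changes sign because the horizontal map given by
  differentiating \<open>e\<^sub>3\<close> is skew.\<close>

lemma structure_23:
  assumes "u \<in> S"
  shows "fd \<kappa>\<^sub>1 u (e\<^sub>2 u) = t (F u) * \<kappa>\<^sub>2 u + \<kappa>\<^sub>1 u * \<kappa>\<^sub>2 u - fd \<sigma> u (e\<^sub>3 u)"
    "fd \<kappa>\<^sub>2 u (e\<^sub>2 u) = - t (F u) * \<kappa>\<^sub>1 u + (\<kappa>\<^sub>2 u)\<^sup>2 + \<kappa> - (\<sigma> u)\<^sup>2"
proof -
  have 1: "conn (Gam G) e\<^sub>2 (conn (Gam G) e\<^sub>3 e\<^sub>3) u =
      fd \<kappa>\<^sub>1 u (e\<^sub>2 u) *\<^sub>R e\<^sub>1 u + \<kappa>\<^sub>1 u *\<^sub>R conn (Gam G) e\<^sub>2 e\<^sub>1 u + fd \<kappa>\<^sub>2 u (e\<^sub>2 u) *\<^sub>R e\<^sub>2 u + \<kappa>\<^sub>2 u *\<^sub>R conn (Gam G) e\<^sub>2 e\<^sub>2 u"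
    by (subst M_conn_comb[OF smooth_\<kappa>(1,2) zero assms]) (simp_all add: M_conn)
  have 2: "conn (Gam G) e\<^sub>3 (conn (Gam G) e\<^sub>2 e\<^sub>3) u = - fd \<sigma> u (e\<^sub>3 u) *\<^sub>R e\<^sub>1 u - \<sigma> u *\<^sub>R conn (Gam G) e\<^sub>3 e\<^sub>1 u"
    by (subst M_conn_comb[OF smooth_neg[OF smooth_\<kappa>(3)] zero zero assms])
       (simp_all add: M_conn fd_minus differentiable_S[OF smooth_\<kappa>(3)] assms)
  have 3: "conn (Gam G) (lie e\<^sub>2 e\<^sub>3) e\<^sub>3 u = \<kappa>\<^sub>2 u *\<^sub>R conn (Gam G) e\<^sub>3 e\<^sub>3 u"
    using M.conn_field_comb[OF smooth_e(3) assms, of "lie e\<^sub>2 e\<^sub>3" "\<kappa>\<^sub>2 u" e\<^sub>3 0 e\<^sub>3] by (simp add: M_lie assms)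
  note eq = M.curvature_fields[OF smooth_e(2,3,3) assms, unfolded M_curv[OF assms] 1 2 3]
  show "fd \<kappa>\<^sub>1 u (e\<^sub>2 u) = t (F u) * \<kappa>\<^sub>2 u + \<kappa>\<^sub>1 u * \<kappa>\<^sub>2 u - fd \<sigma> u (e\<^sub>3 u)"
    using arg_cong[OF eq, of "gram G u (e\<^sub>1 u)"]
    by (simp add: gram_simps e_ons M_conn assms power2_eq_square algebra_simps)
  show "fd \<kappa>\<^sub>2 u (e\<^sub>2 u) = - t (F u) * \<kappa>\<^sub>1 u + (\<kappa>\<^sub>2 u)\<^sup>2 + \<kappa> - (\<sigma> u)\<^sup>2"
    using arg_cong[OF eq, of "gram G u (e\<^sub>2 u)"]
    by (simp add: gram_simps e_ons M_conn assms power2_eq_square algebra_simps)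
qed

lemma conn_lie_12:
  assumes "u \<in> S" "smooth_on S W"
  shows "conn (Gam G) (lie e\<^sub>1 e\<^sub>2) W u = - s (F u) *\<^sub>R conn (Gam G) e\<^sub>1 W u
    + - t (F u) *\<^sub>R conn (Gam G) e\<^sub>2 W u + - (2 * \<sigma> u) *\<^sub>R conn (Gam G) e\<^sub>3 W u"
  by (rule M.conn_field_comb3[OF assms(2,1)]) (simp add: M_lie assms)

text \<open>From \<open>R(e\<^sub>1, e\<^sub>2) e\<^sub>3 = 0\<close>: the right-hand sides come
  from the vertical part \<open>- 2 \<sigma> e\<^sub>3\<close> of the bracket, along which
  \<open>e\<^sub>3\<close> has derivative
  \<open>\<kappa>\<^sub>1 e\<^sub>1 + \<kappa>\<^sub>2 e\<^sub>2\<close> up to that factor.\<close>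

lemma codazzi:
  assumes "u \<in> S"
  shows "fd \<sigma> u (e\<^sub>1 u) = 2 * \<kappa>\<^sub>1 u * \<sigma> u" "fd \<sigma> u (e\<^sub>2 u) = 2 * \<kappa>\<^sub>2 u * \<sigma> u"
proof -
  have 1: "conn (Gam G) e\<^sub>1 (conn (Gam G) e\<^sub>2 e\<^sub>3) u = - fd \<sigma> u (e\<^sub>1 u) *\<^sub>R e\<^sub>1 u - \<sigma> u *\<^sub>R conn (Gam G) e\<^sub>1 e\<^sub>1 u"
    by (subst M_conn_comb[OF smooth_neg[OF smooth_\<kappa>(3)] zero zero assms])
       (simp_all add: M_conn fd_minus differentiable_S[OF smooth_\<kappa>(3)] assms)
  have 2: "conn (Gam G) e\<^sub>2 (conn (Gam G) e\<^sub>1 e\<^sub>3) u = fd \<sigma> u (e\<^sub>2 u) *\<^sub>R e\<^sub>2 u + \<sigma> u *\<^sub>R conn (Gam G) e\<^sub>2 e\<^sub>2 u"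
    by (subst M_conn_comb[OF zero smooth_\<kappa>(3) zero assms]) (simp_all add: M_conn)
  note eq = M.curvature_fields[OF smooth_e(1,2,3) assms, unfolded M_curv[OF assms] 1 2 conn_lie_12[OF assms smooth_e(3)]]
  show "fd \<sigma> u (e\<^sub>1 u) = 2 * \<kappa>\<^sub>1 u * \<sigma> u"
    using arg_cong[OF eq, of "gram G u (e\<^sub>1 u)"]
    by (simp add: gram_simps e_ons M_conn assms power2_eq_square algebra_simps)
  show "fd \<sigma> u (e\<^sub>2 u) = 2 * \<kappa>\<^sub>2 u * \<sigma> u"
    using arg_cong[OF eq, of "gram G u (e\<^sub>2 u)"]
    by (simp add: gram_simps e_ons M_conn assms power2_eq_square algebra_simps)
qed

text \<open>O'Neill's formula, read off as the \<open>e\<^sub>1\<close>-component of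
  \<open>R(e\<^sub>1, e\<^sub>2) e\<^sub>2 = \<kappa> e\<^sub>1\<close>; the terms in
  \<open>s\<close>, \<open>t\<close> and their derivatives assemble to \<open>K\<close>.\<close>

lemma curvature_base:
  assumes "u \<in> S"
  shows "K (F u) = \<kappa> + 3 * (\<sigma> u)\<^sup>2"
proof -
  have 1: "conn (Gam G) e\<^sub>1 (conn (Gam G) e\<^sub>2 e\<^sub>2) u =
      - fd t (F u) (\<epsilon>\<^sub>1 (F u)) *\<^sub>R e\<^sub>1 u - t (F u) *\<^sub>R conn (Gam G) e\<^sub>1 e\<^sub>1 u"
    by (subst M_conn_comb[OF smooth_neg[OF smooth_tF] zero zero assms])
       (simp_all add: M_conn fd_minus differentiable_S[OF smooth_tF] fd_basic smooth_st F_e assms)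
  have 2: "conn (Gam G) e\<^sub>2 (conn (Gam G) e\<^sub>1 e\<^sub>2) u =
      - fd s (F u) (\<epsilon>\<^sub>2 (F u)) *\<^sub>R e\<^sub>1 u - s (F u) *\<^sub>R conn (Gam G) e\<^sub>2 e\<^sub>1 u
      - fd \<sigma> u (e\<^sub>2 u) *\<^sub>R e\<^sub>3 u - \<sigma> u *\<^sub>R conn (Gam G) e\<^sub>2 e\<^sub>3 u"
    by (subst M_conn_comb[OF smooth_neg[OF smooth_sF] zero smooth_neg[OF smooth_\<kappa>(3)] assms])
       (simp_all add: M_conn fd_minus differentiable_S[OF smooth_sF] differentiable_S[OF smooth_\<kappa>(3)]
         fd_basic smooth_st F_e assms)
  note eq = M.curvature_fields[OF smooth_e(1,2,2) assms, unfolded M_curv[OF assms] 1 2 conn_lie_12[OF assms smooth_e(2)]]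
  show ?thesis
    using arg_cong[OF eq, of "gram G u (e\<^sub>1 u)"]
    by (simp add: gram_simps e_ons M_conn assms K_def power2_eq_square algebra_simps)
qed

section \<open>Tension and bitension fields in the adapted frame\<close>

lemma smooth_E: "smooth_on S (\<lambda>u. \<epsilon>\<^sub>1 (F u))" "smooth_on S (\<lambda>u. \<epsilon>\<^sub>2 (F u))"
  by (intro smooth_comp_F smooth_\<epsilon>)+

text \<open>The pulled-back frame is parallel along the fibres and rotates horizontally as on the
  surface.\<close>

lemma E_conn:
  assumes "u \<in> S"
  shows "conn \<Gamma>F e\<^sub>1 (\<lambda>u. \<epsilon>\<^sub>1 (F u)) u = s (F u) *\<^sub>R \<epsilon>\<^sub>2 (F u)" "conn \<Gamma>F e\<^sub>1 (\<lambda>u. \<epsilon>\<^sub>2 (F u)) u = - s (F u) *\<^sub>R \<epsilon>\<^sub>1 (F u)"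
    "conn \<Gamma>F e\<^sub>2 (\<lambda>u. \<epsilon>\<^sub>1 (F u)) u = t (F u) *\<^sub>R \<epsilon>\<^sub>2 (F u)" "conn \<Gamma>F e\<^sub>2 (\<lambda>u. \<epsilon>\<^sub>2 (F u)) u = - t (F u) *\<^sub>R \<epsilon>\<^sub>1 (F u)"
    "conn \<Gamma>F e\<^sub>3 (\<lambda>u. \<epsilon>\<^sub>1 (F u)) u = 0" "conn \<Gamma>F e\<^sub>3 (\<lambda>u. \<epsilon>\<^sub>2 (F u)) u = 0"
  using N_conn[OF F_V[OF assms], unfolded N.conn_pointwise[of \<epsilon>\<^sub>1] N.conn_pointwise[of \<epsilon>\<^sub>2]]
    linear_0[OF N.linear_conn[OF smooth_\<epsilon>(1) F_V[OF assms]]] linear_0[OF N.linear_conn[OF smooth_\<epsilon>(2) F_V[OF assms]]]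
  by (simp_all add: conn_pullback smooth_\<epsilon> assms F_e)

lemma E_conn_comb:
  assumes "smooth_on S a" "smooth_on S b" "u \<in> S"
    "\<And>v. v \<in> S \<Longrightarrow> W v = a v *\<^sub>R \<epsilon>\<^sub>1 (F v) + b v *\<^sub>R \<epsilon>\<^sub>2 (F v)"
  shows "conn \<Gamma>F X W u = fd a u (X u) *\<^sub>R \<epsilon>\<^sub>1 (F u) + a u *\<^sub>R conn \<Gamma>F X (\<lambda>u. \<epsilon>\<^sub>1 (F u)) u
     + fd b u (X u) *\<^sub>R \<epsilon>\<^sub>2 (F u) + b u *\<^sub>R conn \<Gamma>F X (\<lambda>u. \<epsilon>\<^sub>2 (F u)) u"
proof -
  note sm = smooth_on_scaleR[OF M.open_S assms(1) smooth_E(1)] smooth_on_scaleR[OF M.open_S assms(2) smooth_E(2)]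
  have "conn \<Gamma>F X W u = conn \<Gamma>F X (\<lambda>v. a v *\<^sub>R \<epsilon>\<^sub>1 (F v) + b v *\<^sub>R \<epsilon>\<^sub>2 (F v)) u"
    by (rule E.conn_cong[OF smooth_on_add[OF M.open_S sm] assms(3), symmetric]) (simp_all add: assms(4))
  then show ?thesis
    by (simp add: E.conn_add[OF sm assms(3)] E.conn_scaleR assms smooth_E)
qed

definition \<tau> :: "real^3 \<Rightarrow> real^2" where "\<tau> u = - \<kappa>\<^sub>1 u *\<^sub>R \<epsilon>\<^sub>1 (F u) + - \<kappa>\<^sub>2 u *\<^sub>R \<epsilon>\<^sub>2 (F u)"

text \<open>The horizontal directions contribute nothing, since their covariant derivatives project
  to those of the surface frame. What remains is minus the projection of the derivative of
  \<open>e\<^sub>3\<close> along itself.\<close>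

lemma tension_frame:
  assumes "u \<in> S"
  shows "tension G H F u = \<tau> u"
proof -
  have "conn \<Gamma>F e\<^sub>1 (\<lambda>v. fd F v (e\<^sub>1 v)) u = conn \<Gamma>F e\<^sub>1 (\<lambda>u. \<epsilon>\<^sub>1 (F u)) u"
    "conn \<Gamma>F e\<^sub>2 (\<lambda>v. fd F v (e\<^sub>2 v)) u = conn \<Gamma>F e\<^sub>2 (\<lambda>u. \<epsilon>\<^sub>2 (F u)) u"
    by (rule E.conn_cong[symmetric, OF _ assms]; simp add: smooth_E F_e)+
  moreover have "conn \<Gamma>F e\<^sub>3 (\<lambda>v. fd F v (e\<^sub>3 v)) u = 0"
    using E_conn_comb[OF zero zero assms, of "\<lambda>v. fd F v (e\<^sub>3 v)" e\<^sub>3] by (simp add: F_e)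
  ultimately show ?thesis
    unfolding tension_def e_trace[OF assms bilinear_second_fund_form[OF assms]]
    by (simp add: second_fund_form_field smooth_e assms E_conn M_conn F_simps F_e \<tau>_def)
qed

text \<open>The functions \<open>A\<close>, \<open>B\<close>, \<open>C\<close> are the components of
  the covariant derivatives of \<open>W\<close> along \<open>e\<^sub>1\<close>,
  \<open>e\<^sub>2\<close>, \<open>e\<^sub>3\<close>; the hypotheses split off the rotation of the
  frame by \<open>s\<close> and \<open>t\<close>. The last four terms of each coefficient come from
  the derivatives of the \<open>e\<^sub>i\<close> along themselves.\<close>

lemma hess_trace:
  assumes P: "smooth_on S P" and Q: "smooth_on S Q" and u: "u \<in> S"
    and sm: "smooth_on S A1" "smooth_on S A2" "smooth_on S B1" "smooth_on S B2" "smooth_on S C1" "smooth_on S C2"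
    and A: "\<And>v. v \<in> S \<Longrightarrow> fd P v (e\<^sub>1 v) = A1 v + s (F v) * Q v"
      "\<And>v. v \<in> S \<Longrightarrow> fd Q v (e\<^sub>1 v) = A2 v - s (F v) * P v"
    and B: "\<And>v. v \<in> S \<Longrightarrow> fd P v (e\<^sub>2 v) = B1 v + t (F v) * Q v"
      "\<And>v. v \<in> S \<Longrightarrow> fd Q v (e\<^sub>2 v) = B2 v - t (F v) * P v"
    and C: "\<And>v. v \<in> S \<Longrightarrow> fd P v (e\<^sub>3 v) = C1 v" "\<And>v. v \<in> S \<Longrightarrow> fd Q v (e\<^sub>3 v) = C2 v"
  defines "W \<equiv> \<lambda>v. P v *\<^sub>R \<epsilon>\<^sub>1 (F v) + Q v *\<^sub>R \<epsilon>\<^sub>2 (F v)"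
  shows "metric_trace G u (hess W u) =
    (fd A1 u (e\<^sub>1 u) - s (F u) * A2 u + fd B1 u (e\<^sub>2 u) - t (F u) * B2 u + fd C1 u (e\<^sub>3 u)
      - s (F u) * B1 u + t (F u) * A1 u - \<kappa>\<^sub>1 u * A1 u - \<kappa>\<^sub>2 u * B1 u) *\<^sub>R \<epsilon>\<^sub>1 (F u) +
    (fd A2 u (e\<^sub>1 u) + s (F u) * A1 u + fd B2 u (e\<^sub>2 u) + t (F u) * B1 u + fd C2 u (e\<^sub>3 u)
      - s (F u) * B2 u + t (F u) * A2 u - \<kappa>\<^sub>1 u * A2 u - \<kappa>\<^sub>2 u * B2 u) *\<^sub>R \<epsilon>\<^sub>2 (F u)"
proof -
  have sW: "smooth_on S W" unfolding W_def
    by (intro smooth_on_add smooth_on_scaleR M.open_S P Q smooth_E)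
  have 1: "conn \<Gamma>F e\<^sub>1 W v = A1 v *\<^sub>R \<epsilon>\<^sub>1 (F v) + A2 v *\<^sub>R \<epsilon>\<^sub>2 (F v)"
    "conn \<Gamma>F e\<^sub>2 W v = B1 v *\<^sub>R \<epsilon>\<^sub>1 (F v) + B2 v *\<^sub>R \<epsilon>\<^sub>2 (F v)"
    "conn \<Gamma>F e\<^sub>3 W v = C1 v *\<^sub>R \<epsilon>\<^sub>1 (F v) + C2 v *\<^sub>R \<epsilon>\<^sub>2 (F v)" if "v \<in> S" for v
    by (subst E_conn_comb[OF P Q that]; simp add: W_def E_conn A B C that algebra_simps)+
  have 2: "conn \<Gamma>F (conn (Gam G) e\<^sub>1 e\<^sub>1) W u = s (F u) *\<^sub>R conn \<Gamma>F e\<^sub>2 W u"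
    "conn \<Gamma>F (conn (Gam G) e\<^sub>2 e\<^sub>2) W u = - t (F u) *\<^sub>R conn \<Gamma>F e\<^sub>1 W u"
    "conn \<Gamma>F (conn (Gam G) e\<^sub>3 e\<^sub>3) W u = \<kappa>\<^sub>1 u *\<^sub>R conn \<Gamma>F e\<^sub>1 W u + \<kappa>\<^sub>2 u *\<^sub>R conn \<Gamma>F e\<^sub>2 W u"
    using E.conn_field_comb[OF sW u, of "conn (Gam G) e\<^sub>1 e\<^sub>1" "s (F u)" e\<^sub>2 0 e\<^sub>2]
      E.conn_field_comb[OF sW u, of "conn (Gam G) e\<^sub>2 e\<^sub>2" "- t (F u)" e\<^sub>1 0 e\<^sub>2]
      E.conn_field_comb[OF sW u, of "conn (Gam G) e\<^sub>3 e\<^sub>3" "\<kappa>\<^sub>1 u" e\<^sub>1 "\<kappa>\<^sub>2 u" e\<^sub>2]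
    by (simp_all add: M_conn u)
  show ?thesis
    unfolding e_trace[OF u bilinear_hess[OF sW u]] hess_field[OF smooth_e(1) sW u] hess_field[OF smooth_e(2) sW u]
      hess_field[OF smooth_e(3) sW u] 2
    by (simp add: E_conn_comb[where W = "conn \<Gamma>F e\<^sub>1 W", OF sm(1,2) u 1(1)]
        E_conn_comb[where W = "conn \<Gamma>F e\<^sub>2 W", OF sm(3,4) u 1(2)]
        E_conn_comb[where W = "conn \<Gamma>F e\<^sub>3 W", OF sm(5,6) u 1(3)] E_conn 1 u algebra_simps)
qed

text \<open>Only \<open>e\<^sub>1\<close> and \<open>e\<^sub>2\<close> contribute, and the Ricci
  tensor of a surface is \<open>K\<close> times the metric; the sign comes from the order of the
  arguments of the curvature.\<close>

lemma curv_trace: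
  assumes u: "u \<in> S"
  shows "metric_trace G u (\<lambda>a b. conn_curv (Gam H) (F u) (fd F u a) (p *\<^sub>R \<epsilon>\<^sub>1 (F u) + q *\<^sub>R \<epsilon>\<^sub>2 (F u)) (fd F u b)) =
    - (K (F u) * p) *\<^sub>R \<epsilon>\<^sub>1 (F u) - (K (F u) * q) *\<^sub>R \<epsilon>\<^sub>2 (F u)"
proof -
  let ?R = "conn_curv (Gam H) (F u)"
  note lin = bilinear_simps[OF N.bilinear_conn_curv12[OF F_V[OF u]]]
    linear_add[OF N.linear_conn_curv3[OF F_V[OF u]]] linear_scale[OF N.linear_conn_curv3[OF F_V[OF u]]]
    linear_0[OF N.linear_conn_curv3[OF F_V[OF u]]]
  have "bilinear (\<lambda>a b. ?R (fd F u a) w (fd F u b))" for w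
    by (rule bilinearI) (simp_all add: lin F_simps u)
  moreover have "?R a a w = 0" for a w by (simp add: conn_curv_def)
  ultimately show ?thesis
    using N.curv_antisym[of "F u" "\<epsilon>\<^sub>2 (F u)" "\<epsilon>\<^sub>1 (F u)"]
    by (subst e_trace[OF u], blast) (simp add: u F_e lin N_curv F_V mult.commute)
qed

text \<open>The components of \<open>- \<tau>\<^sup>2\<close> along \<open>\<epsilon>\<^sub>1\<close> and \<open>\<epsilon>\<^sub>2\<close>; the structure equations turn the horizontal
  covariant derivatives of \<open>\<nabla>\<^sub>U U\<close> into polynomials in \<open>\<kappa>\<^sub>1\<close>, \<open>\<kappa>\<^sub>2\<close>, \<open>\<sigma>\<close> and the vertical derivative of \<open>\<sigma>\<close>.\<close>

lemma bitension_frame: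
  assumes u: "u \<in> S" and b: "bitension G H F u = 0"
  defines "A1 \<equiv> \<lambda>v. (\<kappa>\<^sub>1 v)\<^sup>2 + \<kappa> - (\<sigma> v)\<^sup>2" and "A2 \<equiv> \<lambda>v. \<kappa>\<^sub>1 v * \<kappa>\<^sub>2 v + fd \<sigma> v (e\<^sub>3 v)"
    and "B1 \<equiv> \<lambda>v. \<kappa>\<^sub>1 v * \<kappa>\<^sub>2 v - fd \<sigma> v (e\<^sub>3 v)" and "B2 \<equiv> \<lambda>v. (\<kappa>\<^sub>2 v)\<^sup>2 + \<kappa> - (\<sigma> v)\<^sup>2"
  shows "fd A1 u (e\<^sub>1 u) - s (F u) * A2 u + fd B1 u (e\<^sub>2 u) - t (F u) * B2 u + fd (\<lambda>v. fd \<kappa>\<^sub>1 v (e\<^sub>3 v)) u (e\<^sub>3 u)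
      - s (F u) * B1 u + t (F u) * A1 u - \<kappa>\<^sub>1 u * A1 u - \<kappa>\<^sub>2 u * B1 u + (\<kappa> + 3 * (\<sigma> u)\<^sup>2) * \<kappa>\<^sub>1 u = 0"
    "fd A2 u (e\<^sub>1 u) + s (F u) * A1 u + fd B2 u (e\<^sub>2 u) + t (F u) * B1 u + fd (\<lambda>v. fd \<kappa>\<^sub>2 v (e\<^sub>3 v)) u (e\<^sub>3 u)
      - s (F u) * B2 u + t (F u) * A2 u - \<kappa>\<^sub>1 u * A2 u - \<kappa>\<^sub>2 u * B2 u + (\<kappa> + 3 * (\<sigma> u)\<^sup>2) * \<kappa>\<^sub>2 u = 0"
proof -
  have sm: "smooth_on S A1" "smooth_on S A2" "smooth_on S B1" "smooth_on S B2"
    "smooth_on S (\<lambda>v. fd \<kappa>\<^sub>1 v (e\<^sub>3 v))" "smooth_on S (\<lambda>v. fd \<kappa>\<^sub>2 v (e\<^sub>3 v))"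
    unfolding A1_def A2_def B1_def B2_def
    by (intro smooth_intros M.open_S smooth_\<kappa> smooth_e)+
  have m: "fd (\<lambda>v. - \<kappa>\<^sub>1 v) v a = - fd \<kappa>\<^sub>1 v a" "fd (\<lambda>v. - \<kappa>\<^sub>2 v) v a = - fd \<kappa>\<^sub>2 v a" if "v \<in> S" for v a
    by (simp_all add: fd_minus differentiable_S smooth_\<kappa> that)
  have s\<tau>: "smooth_on S \<tau>" unfolding \<tau>_def[abs_def]
    by (intro smooth_on_add smooth_on_scaleR M.open_S smooth_neg smooth_\<kappa> smooth_E)
  have "bitension G H F u = metric_trace G u (hess \<tau> u)
     - metric_trace G u (\<lambda>a b. conn_curv (Gam H) (F u) (fd F u a) (\<tau> u) (fd F u b))"
    by (rule bitension_hess[OF s\<tau> tension_frame u])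
  note bt = this[unfolded b, unfolded \<tau>_def[abs_def] curv_trace[OF u]]
  note ht = hess_trace[OF smooth_neg[OF smooth_\<kappa>(1)] smooth_neg[OF smooth_\<kappa>(2)] u smooth_neg[OF sm(1)]
      smooth_neg[OF sm(2)] smooth_neg[OF sm(3)] smooth_neg[OF sm(4)] smooth_neg[OF sm(5)] smooth_neg[OF sm(6)]]
  define X where "X = fd A1 u (e\<^sub>1 u) - s (F u) * A2 u + fd B1 u (e\<^sub>2 u) - t (F u) * B2 u + fd (\<lambda>v. fd \<kappa>\<^sub>1 v (e\<^sub>3 v)) u (e\<^sub>3 u)
      - s (F u) * B1 u + t (F u) * A1 u - \<kappa>\<^sub>1 u * A1 u - \<kappa>\<^sub>2 u * B1 u + (\<kappa> + 3 * (\<sigma> u)\<^sup>2) * \<kappa>\<^sub>1 u"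
  define Y where "Y = fd A2 u (e\<^sub>1 u) + s (F u) * A1 u + fd B2 u (e\<^sub>2 u) + t (F u) * B1 u + fd (\<lambda>v. fd \<kappa>\<^sub>2 v (e\<^sub>3 v)) u (e\<^sub>3 u)
      - s (F u) * B2 u + t (F u) * A2 u - \<kappa>\<^sub>1 u * A2 u - \<kappa>\<^sub>2 u * B2 u + (\<kappa> + 3 * (\<sigma> u)\<^sup>2) * \<kappa>\<^sub>2 u"
  have "0 = - X *\<^sub>R \<epsilon>\<^sub>1 (F u) - Y *\<^sub>R \<epsilon>\<^sub>2 (F u)"
    unfolding X_def Y_def
    by (subst bt, subst ht)
       (simp_all add: m fd_minus differentiable_S[OF _ u] sm structure_13 structure_23 u curvature_base[OF u],
        simp_all add: A1_def A2_def B1_def B2_def algebra_simps, simp add: vec_eq_iff)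
  from arg_cong[OF this, of "gram H (F u) (\<epsilon>\<^sub>1 (F u))"] arg_cong[OF this, of "gram H (F u) (\<epsilon>\<^sub>2 (F u))"]
  have "X = 0" "Y = 0" by (simp_all add: gram_simps \<epsilon>_ons F_V[OF u])
  then show "fd A1 u (e\<^sub>1 u) - s (F u) * A2 u + fd B1 u (e\<^sub>2 u) - t (F u) * B2 u + fd (\<lambda>v. fd \<kappa>\<^sub>1 v (e\<^sub>3 v)) u (e\<^sub>3 u)
      - s (F u) * B1 u + t (F u) * A1 u - \<kappa>\<^sub>1 u * A1 u - \<kappa>\<^sub>2 u * B1 u + (\<kappa> + 3 * (\<sigma> u)\<^sup>2) * \<kappa>\<^sub>1 u = 0"
    "fd A2 u (e\<^sub>1 u) + s (F u) * A1 u + fd B2 u (e\<^sub>2 u) + t (F u) * B1 u + fd (\<lambda>v. fd \<kappa>\<^sub>2 v (e\<^sub>3 v)) u (e\<^sub>3 u)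
      - s (F u) * B2 u + t (F u) * A2 u - \<kappa>\<^sub>1 u * A2 u - \<kappa>\<^sub>2 u * B2 u + (\<kappa> + 3 * (\<sigma> u)\<^sup>2) * \<kappa>\<^sub>2 u = 0"
    by (simp_all add: X_def Y_def)
qed

end

section \<open>Vanishing of the mean curvature of the fibres\<close>

context adapted_frame
begin

lemmas fd_poly = fd_add fd_diff fd_minus fd_mult fd_power2
lemmas differentiable_atoms = differentiable_S[OF smooth_\<kappa>(1)] differentiable_S[OF smooth_\<kappa>(2)]
  differentiable_S[OF smooth_\<kappa>(3)] differentiable_S[OF smooth_sF] differentiable_S[OF smooth_tF]

lemma smooth_vertical: "smooth_on S f \<Longrightarrow> smooth_on S (\<lambda>v. fd f v (e\<^sub>3 v))"
  by (rule smooth_on_fd[OF M.open_S _ smooth_e(3)])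

lemmas differentiable_vertical = differentiable_S[OF smooth_vertical[OF smooth_\<kappa>(1)]]
  differentiable_S[OF smooth_vertical[OF smooth_\<kappa>(2)]] differentiable_S[OF smooth_vertical[OF smooth_\<kappa>(3)]]

lemmas diffs = differentiable_atoms differentiable_vertical

text \<open>Apply \<open>[e\<^sub>1, e\<^sub>2]\<close> to \<open>\<sigma>\<close>: computed from
  \<open>e\<^sub>i \<sigma>\<close> it contains \<open>4 \<sigma> U \<sigma>\<close>, computed from
  the bracket \<open>- 2 \<sigma> U \<sigma>\<close>, and the remaining terms agree.\<close>

lemma sigma_vertical:
  assumes u: "u \<in> S"
  shows "\<sigma> u * fd \<sigma> u (e\<^sub>3 u) = 0"
proof -
  have 1: "fd (\<lambda>v. fd \<sigma> v (e\<^sub>1 v)) u = fd (\<lambda>v. 2 * \<kappa>\<^sub>1 v * \<sigma> v) u"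
    "fd (\<lambda>v. fd \<sigma> v (e\<^sub>2 v)) u = fd (\<lambda>v. 2 * \<kappa>\<^sub>2 v * \<sigma> v) u"
    by (rule fd_eq_on[OF M.open_S u]; simp add: codazzi diffs u)+
  show ?thesis
    using commutators(1)[OF smooth_\<kappa>(3) u]
    by (simp add: 1 fd_poly diffs u codazzi structure_13 structure_23 algebra_simps)
qed

definition k :: "real^3 \<Rightarrow> real" where "k u = (\<kappa>\<^sub>1 u)\<^sup>2 + (\<kappa>\<^sub>2 u)\<^sup>2"
definition f :: "real^3 \<Rightarrow> real" where "f u = \<kappa> - (\<sigma> u)\<^sup>2"

text \<open>The vertical derivative of \<open>\<sigma>\<close> is itself differentiated in the
  bitension field, hence the open set. The horizontal part of the Laplacian contributes
  \<open>(k + 2 f - 4 \<sigma>\<^sup>2) \<kappa>\<^sub>i\<close> and the surface curvature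
  \<open>(f + 4 \<sigma>\<^sup>2) \<kappa>\<^sub>i\<close>; the terms in \<open>s\<close> and
  \<open>t\<close> cancel.\<close>

lemma bitension_reduced:
  assumes W: "open W" "W \<subseteq> S" "\<And>v. v \<in> W \<Longrightarrow> fd \<sigma> v (e\<^sub>3 v) = 0" and u: "u \<in> W"
    and b: "bitension G H F u = 0"
  shows "fd (\<lambda>v. fd \<kappa>\<^sub>1 v (e\<^sub>3 v)) u (e\<^sub>3 u) = - (k u + 3 * f u) * \<kappa>\<^sub>1 u"
    "fd (\<lambda>v. fd \<kappa>\<^sub>2 v (e\<^sub>3 v)) u (e\<^sub>3 u) = - (k u + 3 * f u) * \<kappa>\<^sub>2 u"
proof -
  have uS: "u \<in> S" using W u by blast
  have z: "fd \<sigma> u (e\<^sub>3 u) = 0" "fd (\<lambda>v. fd \<sigma> v (e\<^sub>3 v)) u a = 0" for a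
    using W(3)[OF u] fd_eq_on[OF W(1) u, of "\<lambda>v. fd \<sigma> v (e\<^sub>3 v)" "\<lambda>_. 0"] by (simp_all add: W(3))
  note simps = fd_poly diffs uS z structure_13 structure_23 codazzi k_def f_def power2_eq_square
  show "fd (\<lambda>v. fd \<kappa>\<^sub>1 v (e\<^sub>3 v)) u (e\<^sub>3 u) = - (k u + 3 * f u) * \<kappa>\<^sub>1 u"
    using bitension_frame(1)[OF uS b] by (simp add: simps) (simp add: algebra_simps)
  show "fd (\<lambda>v. fd \<kappa>\<^sub>2 v (e\<^sub>3 v)) u (e\<^sub>3 u) = - (k u + 3 * f u) * \<kappa>\<^sub>2 u"
    using bitension_frame(2)[OF uS b] by (simp add: simps) (simp add: algebra_simps)
qed

text \<open>Where \<open>\<sigma>\<close> does not vanish, \<open>\<nabla>\<^sub>U U\<close> is basic, so its vertical derivatives drop out of the biharmonic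
  equation.\<close>

lemma sigma_mean_curvature:
  assumes b: "\<And>u. u \<in> S \<Longrightarrow> bitension G H F u = 0" and uS: "u \<in> S"
  shows "\<sigma> u = 0 \<or> (\<kappa>\<^sub>1 u = 0 \<and> \<kappa>\<^sub>2 u = 0)"
proof (rule ccontr)
  assume contra: "\<not> ?thesis"
  define W where "W = {u \<in> S. \<sigma> u \<noteq> 0}"
  have W: "open W" "W \<subseteq> S" using open_nonzero[OF M.open_S _ smooth_\<kappa>(3)] by (auto simp: W_def)
  have g: "fd \<sigma> v (e\<^sub>3 v) = 0" if "v \<in> W" for v
    using sigma_vertical[of v] that by (auto simp: W_def)
  \<comment> \<open>As \<open>U \<sigma>\<close> vanishes on the open set \<open>W\<close>, the
    bracket \<open>[e\<^sub>i, U]\<close> applied to \<open>\<sigma>\<close> reduces to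
    \<open>2 \<sigma> U \<kappa>\<^sub>i = 0\<close>.\<close>
  have kv: "fd \<kappa>\<^sub>1 v (e\<^sub>3 v) = 0" "fd \<kappa>\<^sub>2 v (e\<^sub>3 v) = 0" if v: "v \<in> W" for v
  proof -
    have vS: "v \<in> S" using v W by blast
    have 1: "fd (\<lambda>v. fd \<sigma> v (e\<^sub>1 v)) v = fd (\<lambda>v. 2 * \<kappa>\<^sub>1 v * \<sigma> v) v"
      "fd (\<lambda>v. fd \<sigma> v (e\<^sub>2 v)) v = fd (\<lambda>v. 2 * \<kappa>\<^sub>2 v * \<sigma> v) v"
      by (rule fd_eq_on[OF M.open_S vS]; simp add: codazzi diffs vS)+
    have 2: "fd (\<lambda>v. fd \<sigma> v (e\<^sub>3 v)) v a = 0" for a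
      using fd_eq_on[OF W(1) v, of "\<lambda>v. fd \<sigma> v (e\<^sub>3 v)" "\<lambda>_. 0"] by (simp add: g)
    have "\<sigma> v \<noteq> 0" using v by (simp add: W_def)
    then show "fd \<kappa>\<^sub>1 v (e\<^sub>3 v) = 0" "fd \<kappa>\<^sub>2 v (e\<^sub>3 v) = 0"
      using commutators(2,3)[OF smooth_\<kappa>(3) vS] by (simp_all add: 1 2 fd_poly diffs vS g v)
  qed
  define W' where "W' = {u \<in> W. k u \<noteq> 0}"
  have "smooth_on S k" unfolding k_def[abs_def]
    by (intro smooth_on_add smooth_on_power M.open_S smooth_\<kappa>)
  then have W': "open W'" "W' \<subseteq> S"
    unfolding W'_def using open_nonzero[OF W] W(2) by auto
  have uW: "u \<in> W'" using contra uS by (simp add: W'_def W_def k_def sum_power2_eq_zero_iff)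
  have e1: "k v = - 3 * f v" if v: "v \<in> W'" for v
  proof -
    have vW: "v \<in> W" using v by (simp add: W'_def)
    have "fd (\<lambda>v. fd \<kappa>\<^sub>1 v (e\<^sub>3 v)) v a = 0" "fd (\<lambda>v. fd \<kappa>\<^sub>2 v (e\<^sub>3 v)) v a = 0" for a
      using fd_eq_on[OF W(1) vW, of "\<lambda>v. fd \<kappa>\<^sub>1 v (e\<^sub>3 v)" "\<lambda>_. 0"]
        fd_eq_on[OF W(1) vW, of "\<lambda>v. fd \<kappa>\<^sub>2 v (e\<^sub>3 v)" "\<lambda>_. 0"] by (simp_all add: kv)
    then have "(k v + 3 * f v) * \<kappa>\<^sub>1 v = 0" "(k v + 3 * f v) * \<kappa>\<^sub>2 v = 0"
      using bitension_reduced[OF W g vW b] vW W(2) by auto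
    then show ?thesis using v by (auto simp: W'_def k_def)
  qed
  \<comment> \<open>The derivative of \<open>k + 3 f = 0\<close> along \<open>e\<^sub>i\<close> is
    \<open>2 \<kappa>\<^sub>i (k + f - 6 \<sigma>\<^sup>2) = 0\<close>; eliminating \<open>k\<close>
    leaves \<open>f = - 3 \<sigma>\<^sup>2\<close>.\<close>
  have e2: "\<kappa> = - 2 * (\<sigma> v)\<^sup>2" if v: "v \<in> W'" for v
  proof -
    have vS: "v \<in> S" "v \<in> W" using v W' by (auto simp: W'_def)
    have "fd (\<lambda>v. (\<kappa>\<^sub>1 v)\<^sup>2 + (\<kappa>\<^sub>2 v)\<^sup>2 + 3 * \<kappa> - 3 * (\<sigma> v)\<^sup>2) v = fd (\<lambda>_. 0) v"
      using e1 by (intro fd_eq_on[OF W'(1) v]) (auto simp: k_def f_def)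
    then have "fd (\<lambda>v. (\<kappa>\<^sub>1 v)\<^sup>2 + (\<kappa>\<^sub>2 v)\<^sup>2 + 3 * \<kappa> - 3 * (\<sigma> v)\<^sup>2) v a = 0" for a by simp
    moreover have "fd (\<lambda>v. (\<kappa>\<^sub>1 v)\<^sup>2 + (\<kappa>\<^sub>2 v)\<^sup>2 + 3 * \<kappa> - 3 * (\<sigma> v)\<^sup>2) v (e\<^sub>1 v)
        = 2 * \<kappa>\<^sub>1 v * (k v + f v - 6 * (\<sigma> v)\<^sup>2)"
      "fd (\<lambda>v. (\<kappa>\<^sub>1 v)\<^sup>2 + (\<kappa>\<^sub>2 v)\<^sup>2 + 3 * \<kappa> - 3 * (\<sigma> v)\<^sup>2) v (e\<^sub>2 v)
        = 2 * \<kappa>\<^sub>2 v * (k v + f v - 6 * (\<sigma> v)\<^sup>2)"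
      by (simp_all add: fd_poly diffs vS structure_13 structure_23 codazzi g k_def f_def)
         (simp_all add: power2_eq_square algebra_simps)
    ultimately have "\<kappa>\<^sub>1 v * (k v + f v - 6 * (\<sigma> v)\<^sup>2) = 0" "\<kappa>\<^sub>2 v * (k v + f v - 6 * (\<sigma> v)\<^sup>2) = 0"
      by simp_all
    then have "k v + f v - 6 * (\<sigma> v)\<^sup>2 = 0" using v by (auto simp: W'_def k_def)
    then show ?thesis using e1[OF v] by (simp add: f_def)
  qed
  \<comment> \<open>So \<open>\<sigma>\<^sup>2\<close> is constant on \<open>W'\<close>, whereas its
    derivative along \<open>e\<^sub>i\<close> is
    \<open>4 \<kappa>\<^sub>i \<sigma>\<^sup>2\<close>.\<close>
  have "fd (\<lambda>v. (\<sigma> v)\<^sup>2) u = fd (\<lambda>_. - \<kappa> / 2) u"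
    using e2 by (intro fd_eq_on[OF W'(1) uW]) auto
  then have "fd (\<lambda>v. (\<sigma> v)\<^sup>2) u a = 0" for a by simp
  from this[of "e\<^sub>1 u"] this[of "e\<^sub>2 u"]
  have "\<sigma> u = 0 \<or> (\<kappa>\<^sub>1 u = 0 \<and> \<kappa>\<^sub>2 u = 0)"
    by (auto simp: fd_poly diffs uS codazzi)
  then show False using contra by blast
qed

text \<open>Where \<open>\<nabla>\<^sub>U U \<noteq> 0\<close> the horizontal distribution is integrable, and the compatibility of the biharmonic
  equation with the commutators \<open>[e\<^sub>i, U]\<close> determines the products \<open>U \<kappa>\<^sub>i \<cdot> U \<kappa>\<^sub>j\<close>.  Their horizontal
  derivatives leave two incompatible quadratic equations for \<open>k\<close>.\<close>

lemma mean_curvature_zero: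
  assumes b: "\<And>u. u \<in> S \<Longrightarrow> bitension G H F u = 0" and uS: "u \<in> S"
  shows "\<kappa>\<^sub>1 u = 0 \<and> \<kappa>\<^sub>2 u = 0"
proof (rule ccontr)
  assume contra: "\<not> ?thesis"
  define W where "W = {u \<in> S. k u \<noteq> 0}"
  have "smooth_on S k" unfolding k_def[abs_def]
    by (intro smooth_on_add smooth_on_power M.open_S smooth_\<kappa>)
  then have W: "open W" "W \<subseteq> S" using open_nonzero[OF M.open_S] by (auto simp: W_def)
  have uW: "u \<in> W" using contra uS by (simp add: W_def k_def sum_power2_eq_zero_iff)
  have WS: "v \<in> S" if "v \<in> W" for v using that W by blast
  have sg: "\<sigma> v = 0" if "v \<in> W" for v
    using sigma_mean_curvature[OF b WS[OF that]] that by (auto simp: W_def k_def)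
  have g: "fd \<sigma> v a = 0" if "v \<in> W" for v a
    using fd_eq_on[OF W(1) that, of \<sigma> "\<lambda>_. 0"] sg by simp
  define p where "p v = fd \<kappa>\<^sub>1 v (e\<^sub>3 v)" for v
  define q where "q v = fd \<kappa>\<^sub>2 v (e\<^sub>3 v)" for v
  have spq: "smooth_on S p" "smooth_on S q"
    unfolding p_def[abs_def] q_def[abs_def] by (intro smooth_vertical smooth_\<kappa>)+
  note ds = differentiable_atoms differentiable_S[OF spq(1)] differentiable_S[OF spq(2)] WS
  have sv: "fd (\<lambda>v. s (F v)) v (e\<^sub>3 v) = 0" "fd (\<lambda>v. t (F v)) v (e\<^sub>3 v) = 0" if "v \<in> W" for v
    using fd_basic_vertical[OF smooth_st(1) WS[OF that]] fd_basic_vertical[OF smooth_st(2) WS[OF that]] by simp_all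
  have K1: "fd \<kappa>\<^sub>1 v (e\<^sub>1 v) = s (F v) * \<kappa>\<^sub>2 v + (\<kappa>\<^sub>1 v)\<^sup>2 + \<kappa>"
    "fd \<kappa>\<^sub>2 v (e\<^sub>1 v) = - s (F v) * \<kappa>\<^sub>1 v + \<kappa>\<^sub>1 v * \<kappa>\<^sub>2 v"
    "fd \<kappa>\<^sub>1 v (e\<^sub>2 v) = t (F v) * \<kappa>\<^sub>2 v + \<kappa>\<^sub>1 v * \<kappa>\<^sub>2 v"
    "fd \<kappa>\<^sub>2 v (e\<^sub>2 v) = - t (F v) * \<kappa>\<^sub>1 v + (\<kappa>\<^sub>2 v)\<^sup>2 + \<kappa>"
    "fd \<kappa>\<^sub>1 v (e\<^sub>3 v) = p v" "fd \<kappa>\<^sub>2 v (e\<^sub>3 v) = q v" if "v \<in> W" for v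
    by (simp_all add: structure_13 structure_23 WS that sg g p_def q_def)
  \<comment> \<open>The commutators in the form \<open>e\<^sub>i (U \<kappa>\<^sub>j) = U (e\<^sub>i
    \<kappa>\<^sub>j) + \<kappa>\<^sub>i U \<kappa>\<^sub>j\<close>; on the right, \<open>s\<close>
    and \<open>t\<close> are constant along the fibres.\<close>
  have P1: "fd p v (e\<^sub>1 v) = s (F v) * q v + 3 * \<kappa>\<^sub>1 v * p v"
    "fd q v (e\<^sub>1 v) = - s (F v) * p v + \<kappa>\<^sub>2 v * p v + 2 * \<kappa>\<^sub>1 v * q v"
    "fd p v (e\<^sub>2 v) = t (F v) * q v + \<kappa>\<^sub>1 v * q v + 2 * \<kappa>\<^sub>2 v * p v"
    "fd q v (e\<^sub>2 v) = - t (F v) * p v + 3 * \<kappa>\<^sub>2 v * q v" if v: "v \<in> W" for v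
  proof -
    have *: "fd (\<lambda>v. fd \<kappa>\<^sub>1 v (e\<^sub>1 v)) v = fd (\<lambda>v. s (F v) * \<kappa>\<^sub>2 v + (\<kappa>\<^sub>1 v)\<^sup>2 + \<kappa>) v"
      "fd (\<lambda>v. fd \<kappa>\<^sub>2 v (e\<^sub>1 v)) v = fd (\<lambda>v. - s (F v) * \<kappa>\<^sub>1 v + \<kappa>\<^sub>1 v * \<kappa>\<^sub>2 v) v"
      "fd (\<lambda>v. fd \<kappa>\<^sub>1 v (e\<^sub>2 v)) v = fd (\<lambda>v. t (F v) * \<kappa>\<^sub>2 v + \<kappa>\<^sub>1 v * \<kappa>\<^sub>2 v) v"
      "fd (\<lambda>v. fd \<kappa>\<^sub>2 v (e\<^sub>2 v)) v = fd (\<lambda>v. - t (F v) * \<kappa>\<^sub>1 v + (\<kappa>\<^sub>2 v)\<^sup>2 + \<kappa>) v"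
      by (rule fd_eq_on[OF W(1) v]; simp add: K1 ds v)+
    note c = commutators(2,3)[OF smooth_\<kappa>(1) WS[OF v], folded p_def[abs_def]]
      commutators(2,3)[OF smooth_\<kappa>(2) WS[OF v], folded q_def[abs_def]]
    show "fd p v (e\<^sub>1 v) = s (F v) * q v + 3 * \<kappa>\<^sub>1 v * p v"
      "fd q v (e\<^sub>1 v) = - s (F v) * p v + \<kappa>\<^sub>2 v * p v + 2 * \<kappa>\<^sub>1 v * q v"
      "fd p v (e\<^sub>2 v) = t (F v) * q v + \<kappa>\<^sub>1 v * q v + 2 * \<kappa>\<^sub>2 v * p v"
      "fd q v (e\<^sub>2 v) = - t (F v) * p v + 3 * \<kappa>\<^sub>2 v * q v"
      using c by (simp_all add: * fd_poly ds v K1 sv algebra_simps)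
  qed
  have R: "fd p v (e\<^sub>3 v) = - ((\<kappa>\<^sub>1 v)\<^sup>2 + (\<kappa>\<^sub>2 v)\<^sup>2 + 3 * \<kappa>) * \<kappa>\<^sub>1 v"
     "fd q v (e\<^sub>3 v) = - ((\<kappa>\<^sub>1 v)\<^sup>2 + (\<kappa>\<^sub>2 v)\<^sup>2 + 3 * \<kappa>) * \<kappa>\<^sub>2 v" if v: "v \<in> W" for v
    using bitension_reduced[OF W g v b[OF WS[OF v]]] sg[OF v]
    unfolding p_def[abs_def] q_def[abs_def] by (simp_all add: k_def f_def)
  \<comment> \<open>The same commutators applied to \<open>p\<close> and \<open>q\<close>, all of
    whose frame derivatives are now known. The products arise when \<open>U\<close> differentiates
    terms such as \<open>3 \<kappa>\<^sub>1 p\<close>.\<close>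
  have Q: "3 * (p v)\<^sup>2 = (k v + 7 * \<kappa>) * (\<kappa>\<^sub>1 v)\<^sup>2 - (k v + 3 * \<kappa>) * \<kappa>"
    "3 * (p v * q v) = (k v + 7 * \<kappa>) * (\<kappa>\<^sub>1 v * \<kappa>\<^sub>2 v)"
    "3 * (q v)\<^sup>2 = (k v + 7 * \<kappa>) * (\<kappa>\<^sub>2 v)\<^sup>2 - (k v + 3 * \<kappa>) * \<kappa>" if v: "v \<in> W" for v
  proof -
    have *: "fd (\<lambda>v. fd p v (e\<^sub>1 v)) v = fd (\<lambda>v. s (F v) * q v + 3 * \<kappa>\<^sub>1 v * p v) v"
      "fd (\<lambda>v. fd q v (e\<^sub>1 v)) v = fd (\<lambda>v. - s (F v) * p v + \<kappa>\<^sub>2 v * p v + 2 * \<kappa>\<^sub>1 v * q v) v"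
      "fd (\<lambda>v. fd q v (e\<^sub>2 v)) v = fd (\<lambda>v. - t (F v) * p v + 3 * \<kappa>\<^sub>2 v * q v) v"
      "fd (\<lambda>v. fd p v (e\<^sub>3 v)) v = fd (\<lambda>v. - ((\<kappa>\<^sub>1 v)\<^sup>2 + (\<kappa>\<^sub>2 v)\<^sup>2 + 3 * \<kappa>) * \<kappa>\<^sub>1 v) v"
      "fd (\<lambda>v. fd q v (e\<^sub>3 v)) v = fd (\<lambda>v. - ((\<kappa>\<^sub>1 v)\<^sup>2 + (\<kappa>\<^sub>2 v)\<^sup>2 + 3 * \<kappa>) * \<kappa>\<^sub>2 v) v"
      by (rule fd_eq_on[OF W(1) v]; simp add: P1 R ds v)+
    show "3 * (p v)\<^sup>2 = (k v + 7 * \<kappa>) * (\<kappa>\<^sub>1 v)\<^sup>2 - (k v + 3 * \<kappa>) * \<kappa>"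
      using commutators(2)[OF spq(1) WS[OF v]]
      by (simp add: * fd_poly ds v K1 sv R k_def) (simp add: power2_eq_square algebra_simps)
    show "3 * (p v * q v) = (k v + 7 * \<kappa>) * (\<kappa>\<^sub>1 v * \<kappa>\<^sub>2 v)"
      using commutators(2)[OF spq(2) WS[OF v]]
      by (simp add: * fd_poly ds v K1 sv R k_def) (simp add: power2_eq_square algebra_simps)
    show "3 * (q v)\<^sup>2 = (k v + 7 * \<kappa>) * (\<kappa>\<^sub>2 v)\<^sup>2 - (k v + 3 * \<kappa>) * \<kappa>"
      using commutators(3)[OF spq(2) WS[OF v]]
      by (simp add: * fd_poly ds v K1 sv R k_def) (simp add: power2_eq_square algebra_simps)
  qed
  have dk: "fd k v (e\<^sub>1 v) = 2 * \<kappa>\<^sub>1 v * (k v + \<kappa>)" "fd k v (e\<^sub>2 v) = 2 * \<kappa>\<^sub>2 v * (k v + \<kappa>)"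
    "k differentiable (at v)" if v: "v \<in> W" for v
    unfolding k_def[abs_def]
    by (simp_all add: fd_poly ds v K1) (simp_all add: power2_eq_square algebra_simps)
  \<comment> \<open>The outer two equations of \<open>Q\<close> express
    \<open>p\<^sup>2 + q\<^sup>2\<close> through \<open>k\<close> alone. Differentiating along
    \<open>e\<^sub>i\<close> and inserting \<open>Q\<close> again leaves
    \<open>\<kappa>\<^sub>i\<close> times a quadratic in \<open>k\<close>.\<close>
  have E: "(k v)\<^sup>2 + 9 * \<kappa> * k v - 20 * \<kappa>\<^sup>2 = 0" if v: "v \<in> W" for v
  proof -
    have eq: "3 * ((p v)\<^sup>2 + (q v)\<^sup>2) = (k v)\<^sup>2 + 5 * \<kappa> * k v - 6 * \<kappa>\<^sup>2" if "v \<in> W" for v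
      using Q(1,3)[OF that] by (simp add: k_def power2_eq_square algebra_simps)
    have "fd (\<lambda>v. 3 * ((p v)\<^sup>2 + (q v)\<^sup>2)) v = fd (\<lambda>v. (k v)\<^sup>2 + 5 * \<kappa> * k v - 6 * \<kappa>\<^sup>2) v"
      by (rule fd_eq_on[OF W(1) v eq]) (simp_all add: dk v)
    then have "fd (\<lambda>v. 3 * ((p v)\<^sup>2 + (q v)\<^sup>2)) v a = fd (\<lambda>v. (k v)\<^sup>2 + 5 * \<kappa> * k v - 6 * \<kappa>\<^sup>2) v a" for a by simp
    from this[of "e\<^sub>1 v"] this[of "e\<^sub>2 v"]
    have d: "6 * \<kappa>\<^sub>1 v * (3 * (p v)\<^sup>2) + 2 * \<kappa>\<^sub>2 v * (3 * (p v * q v)) + 4 * \<kappa>\<^sub>1 v * (3 * (q v)\<^sup>2)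
        = 2 * (2 * k v + 5 * \<kappa>) * (k v + \<kappa>) * \<kappa>\<^sub>1 v"
      "6 * \<kappa>\<^sub>2 v * (3 * (q v)\<^sup>2) + 2 * \<kappa>\<^sub>1 v * (3 * (p v * q v)) + 4 * \<kappa>\<^sub>2 v * (3 * (p v)\<^sup>2)
        = 2 * (2 * k v + 5 * \<kappa>) * (k v + \<kappa>) * \<kappa>\<^sub>2 v"
      by (simp_all add: fd_poly ds dk v P1) (simp_all add: power2_eq_square algebra_simps)
    have "\<kappa>\<^sub>1 v * ((k v)\<^sup>2 + 9 * \<kappa> * k v - 20 * \<kappa>\<^sup>2) = 0" "\<kappa>\<^sub>2 v * ((k v)\<^sup>2 + 9 * \<kappa> * k v - 20 * \<kappa>\<^sup>2) = 0"
      using d unfolding Q[OF v] k_def by algebra+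
    then show ?thesis using v by (auto simp: W_def k_def)
  qed
  \<comment> \<open>A second relation for \<open>k\<close> by differentiating the quadratic; it
    factors because \<open>e\<^sub>i k = 2 \<kappa>\<^sub>i (k + \<kappa>)\<close>.\<close>
  have "fd (\<lambda>v. (k v)\<^sup>2 + 9 * \<kappa> * k v - 20 * \<kappa>\<^sup>2) u = fd (\<lambda>_. 0) u"
    by (rule fd_eq_on[OF W(1) uW E]) simp_all
  then have "fd (\<lambda>v. (k v)\<^sup>2 + 9 * \<kappa> * k v - 20 * \<kappa>\<^sup>2) u a = 0" for a by simp
  moreover have "fd (\<lambda>v. (k v)\<^sup>2 + 9 * \<kappa> * k v - 20 * \<kappa>\<^sup>2) u (e\<^sub>1 u) = 2 * \<kappa>\<^sub>1 u * ((k u + \<kappa>) * (2 * k u + 9 * \<kappa>))"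
    "fd (\<lambda>v. (k v)\<^sup>2 + 9 * \<kappa> * k v - 20 * \<kappa>\<^sup>2) u (e\<^sub>2 u) = 2 * \<kappa>\<^sub>2 u * ((k u + \<kappa>) * (2 * k u + 9 * \<kappa>))"
    by (simp_all add: fd_poly dk uW) (simp_all add: algebra_simps)
  ultimately have "\<kappa>\<^sub>1 u * ((k u + \<kappa>) * (2 * k u + 9 * \<kappa>)) = 0" "\<kappa>\<^sub>2 u * ((k u + \<kappa>) * (2 * k u + 9 * \<kappa>)) = 0"
    by simp_all
  then have D: "(k u + \<kappa>) * (2 * k u + 9 * \<kappa>) = 0" using uW by (auto simp: W_def k_def)
  \<comment> \<open>At the roots \<open>- \<kappa>\<close> and \<open>- 9 \<kappa> / 2\<close> of
    the second relation the quadratic takes the values \<open>- 28 \<kappa>\<^sup>2\<close> and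
    \<open>- 161 \<kappa>\<^sup>2 / 4\<close>. Hence \<open>\<kappa> = 0\<close>, and the quadratic
    becomes \<open>k\<^sup>2 = 0\<close>.\<close>
  have "28 * \<kappa>\<^sup>2 = 0 \<or> 161 * \<kappa>\<^sup>2 = 0"
  proof (cases "k u = - \<kappa>")
    case True
    then show ?thesis using E[OF uW] by (simp add: power2_eq_square)
  next
    case False
    then have *: "k u = - (9 * \<kappa>) / 2" using D by simp
    show ?thesis using E[OF uW] unfolding * by (simp add: power2_eq_square)
  qed
  then have "k u = 0" using E[OF uW] by auto
  then show False using uW by (simp add: W_def)
qed

lemma tension_zero:
  assumes "\<And>u. u \<in> S \<Longrightarrow> bitension G H F u = 0" "u \<in> S"
  shows "tension G H F u = 0"
  using mean_curvature_zero[OF assms] by (simp add: tension_frame[OF assms(2)] \<tau>_def)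

end

section \<open>Existence of adapted frames\<close>

lemma (in metric_chart) normalize:
  assumes X: "smooth_on S X" and nz: "\<And>u. u \<in> S \<Longrightarrow> X u \<noteq> 0"
  defines "N \<equiv> \<lambda>u. (1 / sqrt (gram G u (X u) (X u))) *\<^sub>R X u"
  shows "smooth_on S N" "u \<in> S \<Longrightarrow> gram G u (N u) (N u) = 1"
proof -
  have pos: "gram G u (X u) (X u) > 0" if "u \<in> S" for u
    using gram_pos[OF that nz[OF that]] .
  show "smooth_on S N" unfolding N_def
    by (intro smooth_on_scaleR smooth_on_divide smooth_on_const smooth_on_sqrt smooth_gram X open_S)
       (use pos in force)+
  show "gram G u (N u) (N u) = 1" if "u \<in> S"
    using pos[OF that] by (simp add: N_def gram_simps flip: power2_eq_square)
qed

text \<open>Gram-Schmidt on the coordinate frame, which exists on the whole chart.\<close>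

lemma exists_orthonormal_frame_surface:
  fixes V :: "(real^2) set"
  assumes "metric_chart V H"
  obtains \<epsilon>\<^sub>1 \<epsilon>\<^sub>2 where "smooth_on V \<epsilon>\<^sub>1" "smooth_on V \<epsilon>\<^sub>2"
    "\<And>v. v \<in> V \<Longrightarrow> gram H v (\<epsilon>\<^sub>1 v) (\<epsilon>\<^sub>1 v) = 1" "\<And>v. v \<in> V \<Longrightarrow> gram H v (\<epsilon>\<^sub>2 v) (\<epsilon>\<^sub>2 v) = 1"
    "\<And>v. v \<in> V \<Longrightarrow> gram H v (\<epsilon>\<^sub>1 v) (\<epsilon>\<^sub>2 v) = 0"
proof -
  interpret metric_chart V H by fact
  define \<epsilon>\<^sub>1 where "\<epsilon>\<^sub>1 v = (1 / sqrt (gram H v (axis 1 1) (axis 1 1))) *\<^sub>R (axis 1 1 :: real^2)" for v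
  define w where "w v = axis 2 1 - gram H v (\<epsilon>\<^sub>1 v) (axis 2 1) *\<^sub>R \<epsilon>\<^sub>1 v" for v
  define \<epsilon>\<^sub>2 where "\<epsilon>\<^sub>2 v = (1 / sqrt (gram H v (w v) (w v))) *\<^sub>R w v" for v
  have 1: "smooth_on V \<epsilon>\<^sub>1" "\<And>v. v \<in> V \<Longrightarrow> gram H v (\<epsilon>\<^sub>1 v) (\<epsilon>\<^sub>1 v) = 1"
    using normalize[OF smooth_on_const, of "axis 1 1"] by (simp_all add: \<epsilon>\<^sub>1_def[abs_def] axis_eq_0_iff)
  have sw: "smooth_on V w" unfolding w_def[abs_def]
    by (intro smooth_on_diff smooth_on_scaleR smooth_gram smooth_on_const open_S 1)
  \<comment> \<open>Subtracting a multiple of the first coordinate vector leaves the second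
    coordinate unchanged, so \<open>w\<close> has no zeros.\<close>
  have "w v $ 2 = 1" for v by (simp add: w_def \<epsilon>\<^sub>1_def axis_def)
  then have nz: "w v \<noteq> 0" for v by (metis zero_index zero_neq_one)
  have 2: "smooth_on V \<epsilon>\<^sub>2" "\<And>v. v \<in> V \<Longrightarrow> gram H v (\<epsilon>\<^sub>2 v) (\<epsilon>\<^sub>2 v) = 1"
    using normalize[OF sw nz] by (simp_all add: \<epsilon>\<^sub>2_def[abs_def])
  have "gram H v (\<epsilon>\<^sub>1 v) (\<epsilon>\<^sub>2 v) = 0" if "v \<in> V" for v
    by (simp add: \<epsilon>\<^sub>2_def w_def gram_simps 1 that)
  with 1 2 that show thesis by blast
qed

context submersion_chart
begin

text \<open>In dimension three the cross product of the two rows of the Jacobian matrix spans the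
  kernel, which gives a vertical field without zeros on all of \<open>S\<close>.\<close>

lemma exists_adapted_frame:
  obtains \<epsilon>\<^sub>1 \<epsilon>\<^sub>2 e\<^sub>1 e\<^sub>2 e\<^sub>3 where "adapted_frame S G V H F \<kappa> \<epsilon>\<^sub>1 \<epsilon>\<^sub>2 e\<^sub>1 e\<^sub>2 e\<^sub>3"
proof -
  obtain \<epsilon>\<^sub>1 \<epsilon>\<^sub>2 where \<epsilon>: "smooth_on V \<epsilon>\<^sub>1" "smooth_on V \<epsilon>\<^sub>2"
    "\<And>v. v \<in> V \<Longrightarrow> gram H v (\<epsilon>\<^sub>1 v) (\<epsilon>\<^sub>1 v) = 1" "\<And>v. v \<in> V \<Longrightarrow> gram H v (\<epsilon>\<^sub>2 v) (\<epsilon>\<^sub>2 v) = 1"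
    "\<And>v. v \<in> V \<Longrightarrow> gram H v (\<epsilon>\<^sub>1 v) (\<epsilon>\<^sub>2 v) = 0"
    using exists_orthonormal_frame_surface[OF N.metric_chart_axioms] by metis
  define n where "n i u = (\<chi> j. fd F u (axis j 1) $ i)" for i :: 2 and u
  have n: "fd F u x $ i = n i u \<bullet> x" if "u \<in> S" for u x i
  proof -
    have "x = (\<Sum>j\<in>UNIV. x $ j *\<^sub>R axis j 1)"
      using basis_expansion[of x] by (simp add: scalar_mult_eq_scaleR)
    then have "fd F u x = (\<Sum>j\<in>UNIV. x $ j *\<^sub>R fd F u (axis j 1))"
      by (metis (no_types, lifting) linear_sum[OF linear_F[OF that]] linear_scale[OF linear_F[OF that]] sum.cong)
    then show ?thesis by (simp add: n_def inner_vec_def mult.commute)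
  qed
  have sn: "smooth_on S (n i)" for i
    unfolding n_def[abs_def]
    by (intro smooth_on_vec smooth_on_component M.open_S smooth_on_fd_const smooth_F)
  define c where "c u = cross3 (n 1 u) (n 2 u)" for u
  have bc: "bounded_bilinear cross3"
    using bilinear_cross bilinear_conv_bounded_bilinear by blast
  have sc: "smooth_on S c" unfolding c_def[abs_def]
    by (rule smooth_on_bounded_bilinear[OF M.open_S bc sn sn])
  have nz: "c u \<noteq> 0" if "u \<in> S" for u
  proof
    assume "c u = 0"
    obtain a b where a: "fd F u a = axis 1 1" and b: "fd F u b = axis 2 1"
      using surj_F[OF \<open>u \<in> S\<close>] by (metis surjD)
    \<comment> \<open>The Binet-Cauchy identity; on preimages of the coordinate vectors the
      right-hand side is the determinant of the identity matrix.\<close>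
    have "(cross3 (n 1 u) (n 2 u)) \<bullet> (cross3 a b) = (n 1 u \<bullet> a) * (n 2 u \<bullet> b) - (n 1 u \<bullet> b) * (n 2 u \<bullet> a)"
      by (simp add: cross3_simps)
    also have "\<dots> = 1"
      using n[OF that, of a 1] n[OF that, of a 2] n[OF that, of b 1] n[OF that, of b 2]
      by (simp add: a b axis_def)
    finally show False using \<open>c u = 0\<close> by (simp add: c_def)
  qed
  have Fc: "fd F u (c u) = 0" if "u \<in> S" for u
    using n[OF that, of "c u"] by (simp add: vec_eq_iff forall_2 c_def dot_cross_self)
  \<comment> \<open>A vector orthogonal to both rows is parallel to their cross product.\<close>
  have ker: "\<exists>r. x = r *\<^sub>R c u" if "u \<in> S" "fd F u x = 0" for u x
  proof -
    have "n 1 u \<bullet> x = 0" "n 2 u \<bullet> x = 0" using n[OF that(1), of x] that(2) by (metis zero_index)+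
    then have "cross3 x (c u) = 0"
      by (simp add: c_def Lagrange inner_commute)
    then have "cross3 (c u) x = 0"
      using cross_skew[of "c u" x] by simp
    then have "collinear {0, c u, x}" by (simp add: cross_eq_0)
    then show ?thesis using nz[OF that(1)] by (auto simp: collinear_lemma)
  qed
  define e\<^sub>3 where "e\<^sub>3 u = (1 / sqrt (gram G u (c u) (c u))) *\<^sub>R c u" for u
  have e3: "smooth_on S e\<^sub>3" "\<And>u. u \<in> S \<Longrightarrow> gram G u (e\<^sub>3 u) (e\<^sub>3 u) = 1"
    using M.normalize[OF sc nz] by (simp_all add: e\<^sub>3_def[abs_def])
  have Fe3: "fd F u (e\<^sub>3 u) = 0" if "u \<in> S" for u
    using Fc[OF that] by (simp add: e\<^sub>3_def F_simps that)
  \<comment> \<open>A smooth right inverse of the differential, built from the basis dual to the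
    rows \<open>n 1 u\<close>, \<open>n 2 u\<close> in their own plane.\<close>
  define L where "L y u = (y $ 1 / (c u \<bullet> c u)) *\<^sub>R cross3 (n 2 u) (c u) + (y $ 2 / (c u \<bullet> c u)) *\<^sub>R cross3 (c u) (n 1 u)"
    for y :: "real^2" and u
  have FL: "fd F u (L y u) = y" if "u \<in> S" for y u
  proof -
    have "n 1 u \<bullet> cross3 (n 2 u) (c u) = c u \<bullet> c u" "n 2 u \<bullet> cross3 (c u) (n 1 u) = c u \<bullet> c u"
      unfolding c_def by (simp_all add: cross3_simps)
    moreover have "c u \<bullet> c u \<noteq> 0" using nz[OF that] by simp
    ultimately show ?thesis
      by (simp add: vec_eq_iff forall_2 n[OF that] L_def inner_right_distrib dot_cross_self)
  qed
  have sL: "smooth_on S (\<lambda>u. L (Y u) u)" if "smooth_on S Y" for Y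
    unfolding L_def
    by (intro smooth_on_add smooth_on_scaleR smooth_on_divide smooth_on_component smooth_on_inner
        smooth_on_bounded_bilinear[OF _ bc] M.open_S that sc sn) (simp_all add: nz)
  \<comment> \<open>The Euclidean lift \<open>L\<close> need not be horizontal for \<open>G\<close>;
    removing its component along \<open>e\<^sub>3\<close> makes it so without changing its
    projection.\<close>
  define h where "h Y u = L (Y (F u)) u - gram G u (e\<^sub>3 u) (L (Y (F u)) u) *\<^sub>R e\<^sub>3 u" for Y u
  have sh: "smooth_on S (h Y)" if "smooth_on V Y" for Y
    unfolding h_def[abs_def]
    by (intro smooth_on_diff smooth_on_scaleR M.smooth_gram sL smooth_comp_F[OF that] M.open_S e3)
  have Fh: "fd F u (h Y u) = Y (F u)" if "u \<in> S" for Y u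
    by (simp add: h_def F_simps that FL Fe3)
  have h3: "gram G u (e\<^sub>3 u) (h Y u) = 0" if "u \<in> S" for Y u
    by (simp add: h_def gram_simps e3 that)
  \<comment> \<open>The kernel is a line spanned by \<open>e\<^sub>3\<close>, so orthogonality to
    \<open>e\<^sub>3\<close> is the horizontality required by \<open>isometric\<close>.\<close>
  have hker: "gram G u (h Y u) x = 0" if "u \<in> S" "fd F u x = 0" for Y u x
  proof -
    obtain r where r: "x = r *\<^sub>R c u" using ker[OF \<open>u \<in> S\<close> \<open>fd F u x = 0\<close>] by blast
    have "sqrt (gram G u (c u) (c u)) > 0" using M.gram_pos[OF that(1) nz[OF that(1)]] by simp
    then have "c u = sqrt (gram G u (c u) (c u)) *\<^sub>R e\<^sub>3 u" by (simp add: e\<^sub>3_def)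
    then have "x = (r * sqrt (gram G u (c u) (c u))) *\<^sub>R e\<^sub>3 u" using r by (metis scaleR_scaleR)
    then show ?thesis using h3[OF that(1)] M.gram_sym[OF that(1)] by (simp add: gram_simps)
  qed
  have iso: "gram G u (h Y u) (h Z u) = gram H (F u) (Y (F u)) (Z (F u))" if "u \<in> S" for Y Z u
    using isometric[OF that, of "h Y u" "h Z u"] hker[OF that] Fh[OF that] by simp
  have "adapted_frame S G V H F \<kappa> \<epsilon>\<^sub>1 \<epsilon>\<^sub>2 (h \<epsilon>\<^sub>1) (h \<epsilon>\<^sub>2) e\<^sub>3"
    by unfold_locales (simp_all add: \<epsilon> sh e3 Fh Fe3 iso F_V hker)
  then show thesis by (rule that)
qed

lemma biharmonic_imp_harmonic:
  assumes "\<And>u. u \<in> S \<Longrightarrow> bitension G H F u = 0" "u \<in> S"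
  shows "tension G H F u = 0"
proof -
  obtain \<epsilon>\<^sub>1 \<epsilon>\<^sub>2 e\<^sub>1 e\<^sub>2 e\<^sub>3 where "adapted_frame S G V H F \<kappa> \<epsilon>\<^sub>1 \<epsilon>\<^sub>2 e\<^sub>1 e\<^sub>2 e\<^sub>3"
    using exists_adapted_frame by blast
  then show ?thesis using adapted_frame.tension_zero assms by blast
qed

text \<open>On the open set \<open>S\<close> the tension field agrees with the zero section, so its
  derivatives vanish there; the curvature term is linear in it.\<close>

lemma harmonic_imp_biharmonic:
  assumes "\<And>u. u \<in> S \<Longrightarrow> tension G H F u = 0" "u \<in> S"
  shows "bitension G H F u = 0"
proof -
  have z: "conn \<Gamma>F X (\<lambda>_. 0) v = 0" if "v \<in> S" for X v
    by (simp add: conn_def E.coeff_simps that)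
  have "conn \<Gamma>F X (conn \<Gamma>F Y (\<lambda>_. 0)) u = 0" for X Y
    using E.conn_cong[OF smooth_on_const[of S 0] assms(2), of "conn \<Gamma>F Y (\<lambda>_. 0)" X X] z assms(2) by simp
  then have "hess (\<lambda>_. 0) u a b = 0" for a b
    by (simp add: hess_def z assms(2))
  then show ?thesis
    using bitension_hess[OF smooth_on_const[of S 0] assms]
    by (simp add: metric_trace_def bilinear_simps[OF N.bilinear_conn_curv12[OF F_V[OF assms(2)]]])
qed

end

section \<open>Passage to manifolds\<close>

lemma smooth_atlas_chart_inv: "smooth_atlas A \<Longrightarrow> c \<in> A \<Longrightarrow> p \<in> fst c \<Longrightarrow> chart_inv c (snd c p) = p"
  unfolding smooth_atlas_def homeomorphism_def by blast

lemma open_local_dom: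
  assumes "smooth_atlas A" "c \<in> A" "continuous_on UNIV \<phi>" "open (fst d)"
  shows "open (local_dom c d \<phi>)"
proof -
  have h: "homeomorphism (fst c) (snd c ` fst c) (snd c) (chart_inv c)" "open (fst c)" "open (snd c ` fst c)"
    using assms unfolding smooth_atlas_def by blast+
  have "open (\<phi> -` fst d)" using assms(3,4) by (simp add: open_vimage)
  then have "openin (top_of_set (fst c)) (fst c \<inter> \<phi> -` fst d)" by (simp add: openin_open_Int)
  then show ?thesis
    unfolding local_dom_def using homeomorphism_imp_open_map[OF h(1)] openin_open_trans h(3) by blast
qed

lemma metric_chartI:
  assumes "riemannian_manifold A g" "c \<in> A" "open S" "S \<subseteq> snd c ` fst c"
  shows "metric_chart S (g c)"
  using assms unfolding riemannian_manifold_def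
  by unfold_locales (auto intro: smooth_on_subset)

text \<open>The source domain is the part of the chart that \<open>\<pi>\<close> sends into the
  chart \<open>d\<close>; on the surface the full coordinate image is kept, because frames are
  constructed there.\<close>

lemma submersion_chartI:
  fixes A :: "('m::{t2_space, second_countable_topology}, 3) chart set"
    and B :: "('k::{t2_space, second_countable_topology}, 2) chart set"
  assumes A: "riemannian_manifold A g" "constant_sectional_curvature A g \<kappa>" and B: "riemannian_manifold B h"
    and \<pi>: "riemannian_submersion A g B h \<pi>" and c: "c \<in> A" and d: "d \<in> B"
  shows "submersion_chart (local_dom c d \<pi>) (g c) (snd d ` fst d) (h d) (local_rep c d \<pi>) \<kappa>"
proof -
  have atlas: "smooth_atlas A" "smooth_atlas B" using A B by (simp_all add: riemannian_manifold_def)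
  have op: "open (fst d)" "open (snd d ` fst d)" using atlas(2) d by (auto simp: smooth_atlas_def)
  have cont: "continuous_on UNIV \<pi>" and sm: "smooth_on (local_dom c d \<pi>) (local_rep c d \<pi>)"
    using \<pi> c d by (auto simp: riemannian_submersion_def smooth_map_def)
  have sub: "local_dom c d \<pi> \<subseteq> snd c ` fst c" by (auto simp: local_dom_def)
  interpret M: metric_chart "local_dom c d \<pi>" "g c"
    by (rule metric_chartI[OF A(1) c open_local_dom[OF atlas(1) c cont op(1)] sub])
  interpret N: metric_chart "snd d ` fst d" "h d"
    by (rule metric_chartI[OF B d op(2)]) simp
  show ?thesis
  proof
    show "smooth_on (local_dom c d \<pi>) (local_rep c d \<pi>)" by (rule sm)
    show "local_rep c d \<pi> ` local_dom c d \<pi> \<subseteq> snd d ` fst d"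
      using smooth_atlas_chart_inv[OF atlas(1) c] by (auto simp: local_rep_def local_dom_def)
    fix u assume u: "u \<in> local_dom c d \<pi>"
    show "surj (fd (local_rep c d \<pi>) u)"
      using \<pi> c d u by (auto simp: riemannian_submersion_def Let_def)
    show "gram (h d) (local_rep c d \<pi> u) (fd (local_rep c d \<pi>) u a) (fd (local_rep c d \<pi>) u b) = gram (g c) u a b"
      if "\<And>v. fd (local_rep c d \<pi>) u v = 0 \<Longrightarrow> gram (g c) u a v = 0 \<and> gram (g c) u b v = 0" for a b
      using \<pi> c d u that unfolding riemannian_submersion_def Let_def by blast
    show "sectional_curv (g c) u a b = \<kappa>" if "a \<noteq> b" "independent {a, b}" for a b
      using A(2) c u sub that unfolding constant_sectional_curvature_def by blast
  qed
qed

theorem theorem3p3: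
  fixes A :: "('m::{t2_space, second_countable_topology}, 3) chart set"
    and g :: "('m, 3) chart \<Rightarrow> real^3 \<Rightarrow> real^3^3"
    and B :: "('k::{t2_space, second_countable_topology}, 2) chart set"
    and h :: "('k, 2) chart \<Rightarrow> real^2 \<Rightarrow> real^2^2"
    and \<kappa> :: real
    and \<pi> :: "'m \<Rightarrow> 'k"
  assumes "space_form A g \<kappa>"
    and "riemannian_manifold B h"
    and "riemannian_submersion A g B h \<pi>"
  shows "biharmonic A g B h \<pi> \<longleftrightarrow> harmonic A g B h \<pi>"
proof -
  \<comment> \<open>Both conditions quantify over the same pairs of charts, and for each pair the
    equivalence concerns a single coordinate expression.\<close>
  have "submersion_chart (local_dom c d \<pi>) (g c) (snd d ` fst d) (h d) (local_rep c d \<pi>) \<kappa>"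
    if "c \<in> A" "d \<in> B" for c d
    using assms that by (intro submersion_chartI) (auto simp: space_form_def)
  then show ?thesis
    unfolding biharmonic_def harmonic_def
    by (meson submersion_chart.biharmonic_imp_harmonic submersion_chart.harmonic_imp_biharmonic)
qed

end
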